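(* Let $\{P_\vartheta:\vartheta\in\Theta\}$, $\Theta\subseteq\mathbb{R}^d$ with nonempty interior, be a family of probability measures on $(\mathcal{X},\mathcal{A})$, each absolutely continuous with respect to a common $\sigma$-finite measure $\mu$, let $\Pi$ be a prior on $\Theta$, and let $\vartheta_0\in\Theta^\circ$. Assume: (a) the family is differentiable in quadratic mean at $\vartheta_0$ with nonsingular Fisher information matrix $I_{\vartheta_0}$; (b) for every $\varepsilon>0$ there is a sequence of tests $\phi_n:\mathcal{X}^n\to[0,1]$ with $\mathbb{E}_{P^n_{\vartheta_0}}[\phi_n(\boldsymbol X)]\to0$ and $\sup_{\vartheta\in\Theta:\|\vartheta-\vartheta_0\|\ge\varepsilon}\mathbb{E}_{P^n_\vartheta}[1-\phi_n(\boldsymbol X)]\to0$ as $n\to\infty$; (c) $\Pi$ has a Lebesgue density $\pi$ that is continuous in a neighborhood of $\vartheta_0$ with $\pi(\vartheta_0)>0$. Let $\ell:\Theta\times\Theta\to[0,\infty)$ be a loss function for which there exists $\delta>0$ with $\int_\Theta\sup_{t\in B_\delta(\vartheta_0)}\ell(t,\vartheta)\,\mathrm{d}\Pi(\vartheta)<\infty$. For some $p>0$ assume: (i) there exist $\varepsilon>0$ and constants $c_1,c_2>0$ such that $c_1\|t-\vartheta\|^p\le\ell(t,\vartheta)\le c_2\|t-\vartheta\|^p$ for all $t,\vartheta\in B_\varepsilon(\vartheta_0)$, and moreover $\int_\Theta\|\vartheta\|^p\,\mathrm{d}\Pi(\vartheta)<\infty$; (ii) there exist $\delta>0$ and constants $c_3,c_4>0$,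 $0<c_5<2$ such that $\ell(t,\vartheta)\le c_3\exp(c_4\|t\|^{c_5}+c_4\|\vartheta\|^{c_5})$ for all $t\in B_\delta(\vartheta_0)$ and $\vartheta\in\Theta$; (iii) for any compact set $K\subseteq\mathbb{R}^d$, $Z_n\stackrel{D}{\to}_{P^n_{\vartheta_0}}Z$ in $\ell^\infty(K)$ as $n\to\infty$, where $$Z_n(t):=\int_{H_n}n^{p/2}\,\ell\Bigl(\vartheta_0+\tfrac{t}{n^{1/2}},\,\vartheta_0+\tfrac{h}{n^{1/2}}\Bigr)\,\mathrm{d}P_{h_n\mid\boldsymbol X}(h),\qquad Z(t):=\int_{\mathbb{R}^d}\ell_0(t,h)\,\mathrm{d}\mathcal{N}_d(Y,I^{-1}_{\vartheta_0})(h),$$ with $Y\sim\mathcal{N}_d(0,I_{\vartheta_0}^{-1})$, and where $\ell_0:\mathbb{R}^d\times\mathbb{R}^d\to[0,\infty)$ is a loss function such that the mapping $t\mapsto\int_{\mathbb{R}^d}\ell_0(t,h)\,\mathrm{d}\mathcal{N}_d(Y,I^{-1}_{\vartheta_0})(h)$ is almost surely continuous and admits a minimizer $G$ which is almost surely unique. If $\hat\theta_n$ is a Bayes estimator with respect to $\ell$ and $\hat\theta_n\to\vartheta_0$ in $P^n_{\vartheta_0}$-probability, then $$n^{1/2}(\hat\theta_n-\vartheta_0)\stackrel{D}{\to}_{P^n_{\vartheta_0}}G,\qquad n\to\infty.$$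
   Context: Bayes model: $\theta\sim\Pi$, a probability measure on $(\Theta,\mathcal{B}(\Theta))$, and conditionally on $\theta=\vartheta$, $X_1,\dots,X_n$ are i.i.d. with law $P_\vartheta$ (so implicitly $\vartheta\mapsto P_\vartheta(A)$ is measurable for $A\in\mathcal{A}$). Write $\boldsymbol X=(X_1,\dots,X_n)$, $P^{\boldsymbol X}$ for the marginal law of $\boldsymbol X$ in this model, $P_{\theta\mid\boldsymbol X}$ for the posterior (conditional law of $\theta$ given $\boldsymbol X$), $P^n_\vartheta=\bigotimes_{i=1}^nP_\vartheta$. Standing assumption: $P^n_{\vartheta_0}\ll P^{\boldsymbol X}$ for all $n$. All convergence statements are under data distribution $P^n_{\vartheta_0}$. Local parameter: $h_n=n^{1/2}(\theta-\vartheta_0)$, $H_n=n^{1/2}(\Theta-\vartheta_0)$; $P_{h_n\mid\boldsymbol X}$ is the posterior law of $h_n$. $B_\delta(\vartheta_0)=\{\vartheta\in\Theta:\|\vartheta-\vartheta_0\|\le\delta\}$ (Euclidean norm). $\mathcal{N}_d(m,\Sigma)$ is the $d$-variate Gaussian law. Differentiability in quadratic mean at $\vartheta_0$: with $p_\vartheta=\mathrm{d}P_\vartheta/\mathrm{d}\mu$, there is $\ell'_{\vartheta_0}:\mathcal{X}\to\mathbb{R}^d$ with $\int_{\mathcal X}[p^{1/2}_{\vartheta_0+h}-p^{1/2}_{\vartheta_0}-\frac12\langle h,\ell'_{\vartheta_0}\rangle p^{1/2}_{\vartheta_0}]^2\,\mathrm{d}\mu=o(\|h\|^2)$ as $h\to0$.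 Fisher information: $I_{\vartheta_0}=\int\ell'_{\vartheta_0}(\ell'_{\vartheta_0})^\top\,\mathrm{d}P_{\vartheta_0}$. A loss function on a set $A\times A$, $A\subseteq\mathbb{R}^d$, is a jointly measurable function $\ell:A\times A\to[0,\infty)$ with $\ell(t,\vartheta)=0$ if and only if $t=\vartheta$. Standing assumption on $\ell$: $\int_\Theta\ell(t,\vartheta)\,\mathrm{d}\Pi(\vartheta)<\infty$ for every $t\in\Theta$. A Bayes estimator with respect to $\ell$ is a measurable $\hat\theta_n:\mathcal{X}^n\to\Theta$ with $\hat\theta_n(x)\in\arg\min_{t\in\Theta}\int_\Theta\ell(t,\vartheta)\,\mathrm{d}P_{\theta\mid\boldsymbol X=x}(\vartheta)$ for $P^{\boldsymbol X}$-a.e. $x$; $\hat\theta_n$ also denotes $\hat\theta_n(\boldsymbol X)$. $\ell^\infty(K)$ is the space of bounded functions $K\to\mathbb{R}$ with the sup norm. $g_n(\boldsymbol X)\stackrel{D}{\to}_{P_n}Z$ means $\int f(g_n)\,\mathrm{d}P_n\to\mathbb{E}f(Z)$ for all bounded continuous $f$ (in $\ell^\infty(K)$: with the usual outer-integral convention if measurability fails). Since $\vartheta_0\in\Theta^\circ$, for each compact $K$ the process $Z_n$ is defined on $K$ for all large $n$. *)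

theory Defs
  imports "HOL-Probability.Probability"
begin

section \<open>Bayes model\<close>

definition power_measure :: "'x measure \<Rightarrow> nat \<Rightarrow> (nat \<Rightarrow> 'x) measure" where
  "power_measure Q n = PiM {..<n} (\<lambda>_. Q)"

definition marginal_law ::
    "'t measure \<Rightarrow> ('t \<Rightarrow> 'x measure) \<Rightarrow> nat \<Rightarrow> (nat \<Rightarrow> 'x) measure" where
  "marginal_law prior P n = prior \<bind> (\<lambda>\<theta>. power_measure (P \<theta>) n)"

text \<open>A version of the posterior is a Markov kernel that disintegrates the joint law of the
  parameter and the sample over the marginal law of the sample.\<close>

definition is_posterior ::
    "'t measure \<Rightarrow> ('t \<Rightarrow> 'x measure) \<Rightarrow> nat \<Rightarrow> ((nat \<Rightarrow> 'x) \<Rightarrow> 't measure) \<Rightarrow> bool" where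
  "is_posterior prior P n post \<longleftrightarrow>
     post \<in> measurable (marginal_law prior P n) (prob_algebra prior) \<and>
     (\<forall>A\<in>sets (marginal_law prior P n). \<forall>B\<in>sets prior.
        (\<integral>\<^sup>+x\<in>A. emeasure (post x) B \<partial>marginal_law prior P n) =
        (\<integral>\<^sup>+\<theta>\<in>B. emeasure (power_measure (P \<theta>) n) A \<partial>prior))"

definition nbhd :: "(real^'d) set \<Rightarrow> real^'d \<Rightarrow> real \<Rightarrow> (real^'d) set" where
  "nbhd \<Theta> \<theta>\<^sub>0 \<delta> = {\<theta> \<in> \<Theta>. norm (\<theta> - \<theta>\<^sub>0) \<le> \<delta>}"

section \<open>Differentiability in quadratic mean and Gaussian laws\<close>

text \<open>The integral is taken in \<^typ>\<open>ennreal\<close>, so that the limit also expresses that it is finite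
  for all small \<open>h\<close>. The values of \<open>P\<close> outside the parameter set are irrelevant if \<open>\<theta>\<^sub>0\<close> is an
  interior point of that set.\<close>

definition dqm_at ::
    "'x measure \<Rightarrow> (real^'d \<Rightarrow> 'x measure) \<Rightarrow> real^'d \<Rightarrow> ('x \<Rightarrow> real^'d) \<Rightarrow> bool" where
  "dqm_at \<mu> P \<theta>\<^sub>0 score \<longleftrightarrow>
     score \<in> borel_measurable \<mu> \<and>
     (let s = (\<lambda>\<theta> x. sqrt (enn2real (RN_deriv \<mu> (P \<theta>) x))) in
       ((\<lambda>h. (\<integral>\<^sup>+x. ennreal ((s (\<theta>\<^sub>0 + h) x - s \<theta>\<^sub>0 x - 1/2 * (h \<bullet> score x) * s \<theta>\<^sub>0 x)\<^sup>2) \<partial>\<mu>)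
              / ennreal ((norm h)\<^sup>2)) \<longlongrightarrow> 0) (at 0))"

definition fisher_info :: "'x measure \<Rightarrow> ('x \<Rightarrow> real^'d) \<Rightarrow> real^'d^'d" where
  "fisher_info Q score = (\<chi> i j. \<integral>x. score x $ i * score x $ j \<partial>Q)"

text \<open>Only meaningful for symmetric positive definite \<open>\<Sigma>\<close>.\<close>

definition gaussian :: "real^'d \<Rightarrow> real^'d^'d \<Rightarrow> (real^'d) measure" where
  "gaussian m \<Sigma> = density lborel (\<lambda>x. ennreal
     (exp (- ((x - m) \<bullet> (matrix_inv \<Sigma> *v (x - m))) / 2) / sqrt ((2 * pi) ^ CARD('d) * det \<Sigma>)))"

section \<open>Loss functions and Bayes estimators\<close>

definition loss_function_on :: "(real^'d) set \<Rightarrow> (real^'d \<Rightarrow> real^'d \<Rightarrow> real) \<Rightarrow> bool" where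
  "loss_function_on A l \<longleftrightarrow>
     (\<lambda>(t, \<theta>). l t \<theta>) \<in> borel_measurable (restrict_space borel A \<Otimes>\<^sub>M restrict_space borel A) \<and>
     (\<forall>t\<in>A. \<forall>\<theta>\<in>A. 0 \<le> l t \<theta> \<and> (l t \<theta> = 0 \<longleftrightarrow> t = \<theta>))"

text \<open>The posterior risk is an \<^typ>\<open>ennreal\<close>: a \<open>t\<close> with infinite risk must not count as a
  minimizer, as it would with the Bochner integral, which is then 0.\<close>

definition is_bayes_estimator ::
    "(real^'d) set \<Rightarrow> 'x measure \<Rightarrow> (real^'d) measure \<Rightarrow> (real^'d \<Rightarrow> 'x measure)
      \<Rightarrow> (real^'d \<Rightarrow> real^'d \<Rightarrow> real) \<Rightarrow> nat \<Rightarrow> ((nat \<Rightarrow> 'x) \<Rightarrow> (real^'d) measure)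
      \<Rightarrow> ((nat \<Rightarrow> 'x) \<Rightarrow> real^'d) \<Rightarrow> bool" where
  "is_bayes_estimator \<Theta> \<mu> prior P l n post est \<longleftrightarrow>
     est \<in> measurable (power_measure \<mu> n) (restrict_space borel \<Theta>) \<and>
     (AE x in marginal_law prior P n.
        is_arg_min (\<lambda>t. \<integral>\<^sup>+\<theta>. ennreal (l t \<theta>) \<partial>post x) (\<lambda>t. t \<in> \<Theta>) (est x))"

text \<open>The law of \<open>\<surd>n (\<theta> - \<theta>\<^sub>0)\<close> when \<open>\<theta>\<close> has law \<open>\<nu>\<close> on \<open>\<Theta>\<close>. It lives on the rescaled parameter
  set, since the loss is measurable there only.\<close>

definition local_law ::
    "(real^'d) set \<Rightarrow> real^'d \<Rightarrow> nat \<Rightarrow> (real^'d) measure \<Rightarrow> (real^'d) measure" where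
  "local_law \<Theta> \<theta>\<^sub>0 n \<nu> =
     (let r = (\<lambda>\<theta>. sqrt (real n) *\<^sub>R (\<theta> - \<theta>\<^sub>0)) in distr \<nu> (restrict_space borel (r ` \<Theta>)) r)"

definition local_risk ::
    "(real^'d) set \<Rightarrow> real^'d \<Rightarrow> real \<Rightarrow> (real^'d \<Rightarrow> real^'d \<Rightarrow> real) \<Rightarrow> nat
      \<Rightarrow> (real^'d) measure \<Rightarrow> real^'d \<Rightarrow> real" where
  "local_risk \<Theta> \<theta>\<^sub>0 p l n \<nu> t =
     (\<integral>h. real n powr (p/2) * l (\<theta>\<^sub>0 + t /\<^sub>R sqrt (real n)) (\<theta>\<^sub>0 + h /\<^sub>R sqrt (real n))
        \<partial>local_law \<Theta> \<theta>\<^sub>0 n \<nu>)"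

definition limit_risk ::
    "(real^'d \<Rightarrow> real^'d \<Rightarrow> real) \<Rightarrow> real^'d^'d \<Rightarrow> real^'d \<Rightarrow> real^'d \<Rightarrow> real" where
  "limit_risk l\<^sub>0 \<Sigma> y t = (\<integral>h. l\<^sub>0 t h \<partial>gaussian y \<Sigma>)"

section \<open>Outer integrals and convergence in distribution\<close>

text \<open>Needed because a supremum of measurable functions over an uncountable set need not be
  measurable.\<close>

definition outer_nn_integral :: "'a measure \<Rightarrow> ('a \<Rightarrow> ennreal) \<Rightarrow> ennreal" where
  "outer_nn_integral M f =
     (INF g\<in>{g \<in> borel_measurable M. \<forall>x\<in>space M. f x \<le> g x}. \<integral>\<^sup>+x. g x \<partial>M)"

text \<open>For functions that are almost surely bounded. The usual definition lets the majorants take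
  the value \<open>\<infinity>\<close>; this is why real-valued majorants are only required to dominate almost everywhere.\<close>

definition outer_expectation :: "'a measure \<Rightarrow> ('a \<Rightarrow> real) \<Rightarrow> real" where
  "outer_expectation M f =
     Inf {integral\<^sup>L M g | g. integrable M g \<and> (AE x in M. f x \<le> g x)}"

text \<open>For Borel measurable maps only: no outer integral is taken here.\<close>

definition converges_in_distribution ::
    "(nat \<Rightarrow> 'a measure) \<Rightarrow> (nat \<Rightarrow> 'a \<Rightarrow> 'e::topological_space) \<Rightarrow> 'w measure \<Rightarrow> ('w \<Rightarrow> 'e) \<Rightarrow> bool"
  where
  "converges_in_distribution P g Q Z \<longleftrightarrow>
     (\<forall>f :: 'e \<Rightarrow> real. continuous_on UNIV f \<longrightarrow> bounded (range f) \<longrightarrow>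
        (\<lambda>n. \<integral>x. f (g n x) \<partial>P n) \<longlonglongrightarrow> (\<integral>w. f (Z w) \<partial>Q))"

text \<open>\<open>\<ell>\<^sup>\<infinity>(K)\<close> is \<^term>\<open>funspace K euclidean_metric\<close>; its elements are extensional functions. The
  processes need to be defined and bounded on \<open>K\<close> only almost surely and for large \<open>n\<close>. The limit
  is required to have a Borel measurable version \<open>Z'\<close> in \<open>\<ell>\<^sup>\<infinity>(K)\<close>.\<close>

definition converges_in_distribution_linf ::
    "'e set \<Rightarrow> (nat \<Rightarrow> 'a measure) \<Rightarrow> (nat \<Rightarrow> 'a \<Rightarrow> 'e \<Rightarrow> real) \<Rightarrow> 'w measure
      \<Rightarrow> ('w \<Rightarrow> 'e \<Rightarrow> real) \<Rightarrow> bool" where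
  "converges_in_distribution_linf K P g Q Z \<longleftrightarrow>
     (let S = funspace K (euclidean_metric :: real metric) in
       (\<forall>\<^sub>F n in sequentially. AE x in P n. restrict (g n x) K \<in> mspace S) \<and>
       (\<exists>Z' \<in> measurable Q (sigma (mspace S) {U. openin (mtopology_of S) U}).
          (AE w in Q. restrict (Z w) K = Z' w) \<and>
          (\<forall>f. continuous_map (mtopology_of S) euclideanreal f \<longrightarrow> bounded (f ` mspace S) \<longrightarrow>
             (\<lambda>n. outer_expectation (P n) (\<lambda>x. f (restrict (g n x) K)))
               \<longlonglongrightarrow> (\<integral>w. f (Z' w) \<partial>Q))))"

end

theory Submission
  imports Defs
begin

text \<open>Once \<open>\<surd>n (est\<^sub>n - \<theta>\<^sub>0)\<close> is known to be tight, assumption (iii) and the argmin theorem give the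
  claim. Tightness follows from comparing risks: the posterior risks at \<open>est\<^sub>n\<close> and at \<open>\<theta>\<^sub>0\<close> are both
  at most the one at \<open>\<theta>\<^sub>0\<close>, so by the lower bound in (i) and the triangle inequality
  \<open>\<parallel>\<surd>n (est\<^sub>n - \<theta>\<^sub>0)\<parallel>\<^sup>p\<close> is bounded by a multiple of \<open>Z\<^sub>n(0)\<close>, as soon as the posterior gives mass at
  least 1/2 to a neighbourhood of \<open>\<theta>\<^sub>0\<close>; and \<open>Z\<^sub>n(0)\<close> converges in law by (iii). Thus only posterior
  consistency is needed, not asymptotic normality of the posterior. It holds because differentiability in
  quadratic mean bounds the total variation distance of \<open>P\<^sub>\<theta>\<close> and \<open>P\<^sub>\<theta>\<^sub>0\<close> by \<open>K \<parallel>\<theta> - \<theta>\<^sub>0\<parallel>\<close>: on the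
  ball of radius \<open>n\<^sup>-\<^sup>2\<close>, whose prior mass is only polynomially small, the sampling laws \<open>P\<^sub>\<theta>\<^sup>n\<close> are
  within \<open>K/n\<close> of \<open>P\<^sub>\<theta>\<^sub>0\<^sup>n\<close>, while the tests, applied to blocks, have exponentially small errors.\<close>

section \<open>The argmin theorem\<close>

text \<open>The tests only control \<open>P \<theta>\<close> for \<theta> far away, whereas
  posterior mass has to be bounded under \<open>P \<theta>\<^sub>0\<close>, and a posterior is known
  here only through the joint law of parameter and sample. Passing from one to the other usually
  rests on a lower bound for the evidence or on contiguity. Here it is enough to average over a
  prior ball \<open>C\<close>: on it the sampling law may be exchanged for the one at
  \<open>\<theta>\<^sub>0\<close>, and the average is dominated by the marginal law, under which the
  disintegration applies. The price is a factor one over the prior mass of \<open>C\<close>. With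
  radius n^(-a) the exchange costs K * n^(1-a), which vanishes for a > 1, and the price is of order
  n^(a*d); a = 2 is a convenient choice. Test errors that merely tend to 0 could not pay a
  polynomial price, which is why blocks are needed. The processes \<open>Zn\<close> need not be
  measurable in the sample, so probabilities are bounded through measurable events and
  majorants.\<close>

lemma measure_le_outer_expectation:
  assumes M: "prob_space M" and f: "\<And>x. 0 \<le> f x \<and> f x \<le> 1"
    and E: "E \<in> sets M" "AE x in M. x \<in> E \<longrightarrow> f x = 1"
  shows "measure M E \<le> outer_expectation M f"
  unfolding outer_expectation_def
proof (rule cInf_greatest)
  interpret prob_space M by fact
  \<comment> \<open>The constant 1 is an admissible majorant; over an empty set \<open>Inf\<close>
    of reals would say nothing.\<close>
  have "integrable M (\<lambda>x. 1::real) \<and> (AE x in M. f x \<le> 1)" using f by simp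
  then show "{integral\<^sup>L M g |g. integrable M g \<and> (AE x in M. f x \<le> g x)} \<noteq> {}" by blast
  fix y assume "y \<in> {integral\<^sup>L M g |g. integrable M g \<and> (AE x in M. f x \<le> g x)}"
  then obtain g where g: "y = integral\<^sup>L M g" "integrable M g" "AE x in M. f x \<le> g x" by blast
  have "measure M E = (\<integral>x. indicator E x \<partial>M)"
    using E(1) by simp
  also have "\<dots> \<le> integral\<^sup>L M g"
  proof (rule integral_mono_AE)
    show "AE x in M. indicator E x \<le> g x"
      using g(3) E(2)
    proof eventually_elim
      case (elim x)
      then show ?case using f[of x] by (auto simp: indicator_def)
    qed
  qed (use g E in \<open>auto simp: less_top[symmetric]\<close>)
  finally show "measure M E \<le> y" using g by simp
qed

lemma funspace_real_bounded:
  fixes z :: "'e \<Rightarrow> real"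
  assumes "z \<in> mspace (funspace K euclidean_metric)" "S \<subseteq> K"
  shows "bdd_below (z ` S)"
proof -
  have "K = {} \<or> (\<exists>c B. \<forall>x\<in>K. dist c (z x) \<le> B)"
    using funspace_imp_bounded[OF assms(1)] by simp
  then have "\<exists>b. \<forall>x\<in>S. b \<le> z x"
  proof
    assume "\<exists>c B. \<forall>x\<in>K. dist c (z x) \<le> B"
    then obtain c B where "\<And>x. x \<in> K \<Longrightarrow> dist c (z x) \<le> B" by blast
    then have "\<And>x. x \<in> S \<Longrightarrow> c - B \<le> z x" using assms(2) by (force simp: dist_real_def)
    then show ?thesis by blast
  qed (use assms(2) in auto)
  then show ?thesis by (auto simp: bdd_below_def)
qed

lemma dist_le_mdist_funspace:
  fixes y z :: "'e \<Rightarrow> real"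
  assumes "y \<in> mspace (funspace K euclidean_metric)" "z \<in> mspace (funspace K euclidean_metric)" "t \<in> K"
  shows "\<bar>y t - z t\<bar> \<le> mdist (funspace K euclidean_metric) y z"
proof -
  have fs: "y \<in> Met_TC.fspace K" "z \<in> Met_TC.fspace K" using assms by auto
  have "dist (y t) (z t) \<le> (SUP x\<in>K. dist (y x) (z x))"
  proof (rule cSUP_upper)
    show "bdd_above ((\<lambda>x. dist (y x) (z x)) ` K)"
      using fs assms(3) by (intro Met_TC.bdd_above_dist) auto
  qed fact
  then show ?thesis using fs assms(3) by (auto simp: Met_TC.fdist_def dist_real_def)
qed

text \<open>If two functions differ by at most \<open>?d y z\<close> at every point of
  \<open>S\<close>, so do their infima; one inequality suffices by symmetry.\<close>

lemma INF_funspace_lipschitz: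
  fixes y z :: "'e \<Rightarrow> real"
  assumes y: "y \<in> mspace (funspace K euclidean_metric)" and z: "z \<in> mspace (funspace K euclidean_metric)"
    and S: "S \<subseteq> K" "S \<noteq> {}"
  shows "\<bar>(INF t\<in>S. y t) - (INF t\<in>S. z t)\<bar> \<le> mdist (funspace K euclidean_metric) y z"
proof -
  let ?d = "mdist (funspace K euclidean_metric) :: ('e \<Rightarrow> real) \<Rightarrow> _"
  have *: "(INF t\<in>S. y t) - ?d y z \<le> (INF t\<in>S. z t)"
    if y: "y \<in> mspace (funspace K euclidean_metric)" and z: "z \<in> mspace (funspace K euclidean_metric)"
    for y z :: "'e \<Rightarrow> real"
  proof (rule cINF_greatest[OF S(2)])
    fix t assume t: "t \<in> S"
    have "(INF t\<in>S. y t) \<le> y t" using funspace_real_bounded[OF y S(1)] t by (rule cINF_lower)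
    then show "(INF t\<in>S. y t) - ?d y z \<le> z t"
      using dist_le_mdist_funspace[OF y z, of t] t S by auto
  qed
  show ?thesis using *[OF y z] *[OF z y] mdist_commute[of "funspace K euclidean_metric" y z] by linarith
qed

text \<open>A difference of two 1-Lipschitz functionals. It turns the statement that a minimizer
  over \<open>K\<close> lies in \<open>S\<close> into a condition on a continuous functional of the
  path, to which weak convergence applies.\<close>

lemma continuous_map_INF_diff:
  assumes "S \<subseteq> K" "S \<noteq> {}"
  shows "continuous_map (mtopology_of (funspace K (euclidean_metric :: real metric))) euclideanreal
    (\<lambda>z. (INF t\<in>S. z t) - (INF t\<in>K. z t))"
proof -
  let ?S = "funspace K (euclidean_metric :: real metric)"
  have K: "K \<noteq> {}" using assms by auto
  have "Lipschitz_continuous_map ?S euclidean_metric (\<lambda>z. (INF t\<in>S. z t) - (INF t\<in>K. z t))"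
    unfolding Lipschitz_continuous_map_def
  proof (intro conjI exI[of _ 2] ballI)
    fix y z assume yz: "y \<in> mspace ?S" "z \<in> mspace ?S"
    show "mdist euclidean_metric ((INF t\<in>S. y t) - (INF t\<in>K. y t)) ((INF t\<in>S. z t) - (INF t\<in>K. z t))
        \<le> 2 * mdist ?S y z"
      using INF_funspace_lipschitz[OF yz assms] INF_funspace_lipschitz[OF yz order_refl] K
      by (simp add: dist_real_def del: mspace_funspace mdist_funspace)
  qed auto
  from Lipschitz_continuous_imp_continuous_map[OF this] show ?thesis by (simp only: mtopology_of_euclidean)
qed

text \<open>The sigma-algebra is generated by the open sets of \<open>S\<close>, and
  \<open>f\<close> pulls open sets back to open sets; only points of \<open>mspace S\<close> matter,
  since \<open>Z\<close> takes its values there.\<close>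

lemma measurable_borel_funspace:
  assumes Z: "Z \<in> M \<rightarrow>\<^sub>M sigma (mspace S) {U. openin (mtopology_of S) U}"
    and f: "continuous_map (mtopology_of S) euclideanreal f"
  shows "(\<lambda>w. f (Z w)) \<in> borel_measurable M"
proof (rule borel_measurableI)
  have sub: "{U. openin (mtopology_of S) U} \<subseteq> Pow (mspace S)"
    using openin_subset[of "mtopology_of S"] by auto
  fix U :: "real set" assume "open U"
  then have "openin (mtopology_of S) {x \<in> mspace S. f x \<in> U}"
    using f by (auto simp: continuous_map_def)
  then have "{x \<in> mspace S. f x \<in> U} \<in> sets (sigma (mspace S) {U. openin (mtopology_of S) U})"
    by (simp add: sets_measure_of[OF sub])
  from measurable_sets[OF Z this] have "Z -` {x \<in> mspace S. f x \<in> U} \<inter> space M \<in> sets M" .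
  also have "Z -` {x \<in> mspace S. f x \<in> U} \<inter> space M = (\<lambda>w. f (Z w)) -` U \<inter> space M"
    using measurable_space[OF Z] by (auto simp: space_measure_of_conv)
  finally show "(\<lambda>w. f (Z w)) -` U \<inter> space M \<in> sets M" .
qed

text \<open>If \<open>H n x\<close> lies in \<open>F \<inter> K\<close> and minimizes the path over
  \<open>K\<close>, then the infimum over \<open>F \<inter> K\<close> is at most that over
  \<open>K\<close>. This is a closed condition on the path, so it survives the limit, where
  compactness, continuity and uniqueness of the minimizer force \<open>G\<close> into
  \<open>F\<close>. Nothing can be said if \<open>G\<close> falls outside \<open>K\<close>, hence
  the second alternative on the right.\<close>

lemma argmin_portmanteau_compact:
  fixes H :: "nat \<Rightarrow> 'a \<Rightarrow> 'e::euclidean_space" and G :: "'w \<Rightarrow> 'e"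
  assumes M: "\<forall>\<^sub>F n in sequentially. prob_space (M n) \<and> H n \<in> borel_measurable (M n)"
    and Q: "prob_space Q" and G: "G \<in> borel_measurable Q"
    and K: "compact K" and F: "closed F"
    and conv: "converges_in_distribution_linf K M Zn Q Z"
    and argmin: "\<forall>\<^sub>F n in sequentially. AE x in M n. H n x \<in> K \<longrightarrow> (\<forall>t\<in>K. Zn n x (H n x) \<le> Zn n x t)"
    and Z: "AE w in Q. continuous_on UNIV (Z w) \<and> is_arg_min (Z w) (\<lambda>_. True) (G w) \<and>
      (\<forall>t. is_arg_min (Z w) (\<lambda>_. True) t \<longrightarrow> t = G w)"
    and e: "e > 0"
  shows "\<forall>\<^sub>F n in sequentially. measure (M n) {x \<in> space (M n). H n x \<in> F \<inter> K} \<le>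
    measure Q {w \<in> space Q. G w \<in> F \<or> G w \<notin> K} + e"
proof (cases "F \<inter> K = {}")
  \<comment> \<open>For an empty \<open>S\<close> the infimum used below would be meaningless, but
    then the event is empty too.\<close>
  case True
  then show ?thesis using e by (simp add: add_nonneg_nonneg)
next
  case False
  define S where "S = F \<inter> K"
  have S: "S \<subseteq> K" "S \<noteq> {}" "compact S" using False K F by (auto simp: S_def intro: closed_Int_compact)
  have Kc [measurable]: "K \<in> sets borel" "F \<in> sets borel" "S \<in> sets borel"
    using compact_imp_closed[OF K] compact_imp_closed[OF S(3)] F by simp_all
  interpret Q: prob_space Q by fact
  note [measurable] = G
  define fs where "fs = funspace K (euclidean_metric :: real metric)"
  obtain Z' where Z': "Z' \<in> Q \<rightarrow>\<^sub>M sigma (mspace fs) {U. openin (mtopology_of fs) U}"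
      "AE w in Q. restrict (Z w) K = Z' w"
      "\<And>f. continuous_map (mtopology_of fs) euclideanreal f \<Longrightarrow> bounded (f ` mspace fs) \<Longrightarrow>
         (\<lambda>n. outer_expectation (M n) (\<lambda>x. f (restrict (Zn n x) K))) \<longlonglongrightarrow> (\<integral>w. f (Z' w) \<partial>Q)"
    and Zn: "\<forall>\<^sub>F n in sequentially. AE x in M n. restrict (Zn n x) K \<in> mspace fs"
    using conv unfolding converges_in_distribution_linf_def fs_def Let_def by blast
  define u where "u = (\<lambda>z :: 'e \<Rightarrow> real. (INF t\<in>S. z t) - (INF t\<in>K. z t))"
  have u: "continuous_map (mtopology_of fs) euclideanreal u"
    unfolding u_def fs_def using S by (intro continuous_map_INF_diff) auto
  \<comment> \<open>Continuous surrogates for the indicator of the nonpositive reals: equal to 1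
    there and eventually 0 at every positive argument. Weak convergence tests continuous functionals
    only.\<close>
  define \<phi> where "\<phi> = (\<lambda>(j::nat) u. max 0 (min 1 (1 - real j * u)))"
  have \<phi>: "0 \<le> \<phi> j v \<and> \<phi> j v \<le> 1" for j v by (auto simp: \<phi>_def)
  have \<phi>u: "continuous_map (mtopology_of fs) euclideanreal (\<lambda>z. \<phi> j (u z))" for j
  proof -
    have "continuous_map euclideanreal euclideanreal (\<phi> j)"
      unfolding \<phi>_def continuous_map_iff_continuous2 by (intro continuous_intros)
    then show ?thesis using continuous_map_compose[OF u, of euclideanreal "\<phi> j"] by (simp only: comp_def)
  qed
  have [measurable]: "(\<lambda>w. u (Z' w)) \<in> borel_measurable Q" "(\<lambda>w. \<phi> j (u (Z' w))) \<in> borel_measurable Q" for j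
    using measurable_borel_funspace[OF Z'(1) u] measurable_borel_funspace[OF Z'(1) \<phi>u] by auto
  have "(\<lambda>j. \<integral>w. \<phi> j (u (Z' w)) \<partial>Q) \<longlonglongrightarrow> (\<integral>w. indicator {w\<in>space Q. u (Z' w) \<le> 0} w \<partial>Q)"
  proof (rule integral_dominated_convergence[where w="\<lambda>_. 1"])
    show "AE w in Q. (\<lambda>j. \<phi> j (u (Z' w))) \<longlonglongrightarrow> indicator {w\<in>space Q. u (Z' w) \<le> 0} w"
    proof (rule AE_I2)
      fix w assume w: "w \<in> space Q"
      show "(\<lambda>j. \<phi> j (u (Z' w))) \<longlonglongrightarrow> indicator {w\<in>space Q. u (Z' w) \<le> 0} w"
      proof (cases "u (Z' w) \<le> 0")
        case True
        then have "\<phi> j (u (Z' w)) = 1" for j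
          using mult_nonneg_nonpos[of "real j" "u (Z' w)"] by (auto simp: \<phi>_def)
        then show ?thesis using True w by simp
      next
        case False
        then have "\<forall>\<^sub>F j in sequentially. \<phi> j (u (Z' w)) = 0"
        proof -
          obtain N where N: "1 < real N * u (Z' w)" using False reals_Archimedean3[of "u (Z' w)"] by fastforce
          show ?thesis
          proof (rule eventually_sequentiallyI[of N])
            fix j assume "N \<le> j"
            then have "real N * u (Z' w) \<le> real j * u (Z' w)" using False by (intro mult_right_mono) auto
            then show "\<phi> j (u (Z' w)) = 0" using N by (auto simp: \<phi>_def)
          qed
        qed
        then show ?thesis using False w by (simp add: tendsto_eventually)
      qed
    qed
  qed (use \<phi> in auto)
  also have "(\<integral>w. indicator {w\<in>space Q. u (Z' w) \<le> 0} w \<partial>Q) = measure Q {w\<in>space Q. u (Z' w) \<le> 0}"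
    by simp
  finally have "\<forall>\<^sub>F j in sequentially. (\<integral>w. \<phi> j (u (Z' w)) \<partial>Q) < measure Q {w\<in>space Q. u (Z' w) \<le> 0} + e / 2"
    by (rule order_tendstoD(2)) (use e in simp)
  then obtain j where j: "(\<integral>w. \<phi> j (u (Z' w)) \<partial>Q) < measure Q {w\<in>space Q. u (Z' w) \<le> 0} + e / 2"
    by (auto simp: eventually_sequentially)
  have sub: "measure Q {w\<in>space Q. u (Z' w) \<le> 0} \<le> measure Q {w \<in> space Q. G w \<in> F \<or> G w \<notin> K}"
  proof (rule Q.finite_measure_mono_AE)
    show "AE w in Q. w \<in> {w\<in>space Q. u (Z' w) \<le> 0} \<longrightarrow> w \<in> {w \<in> space Q. G w \<in> F \<or> G w \<notin> K}"
      using Z Z'(2) AE_space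
    proof eventually_elim
      case (elim w)
      show ?case
      proof (intro impI CollectI conjI)
        assume w: "w \<in> {w\<in>space Q. u (Z' w) \<le> 0}"
        show "G w \<in> F \<or> G w \<notin> K"
        proof (rule disjCI)
          assume "\<not> G w \<notin> K"
          then have GK: "G w \<in> K" by simp
          have e1: "Z' w t = Z w t" if "t \<in> K" for t using elim(2) that by (metis restrict_apply')
          \<comment> \<open>The limit path attains its infimum over the compact \<open>S\<close>;
            the chain below makes that point a global minimizer, hence equal to
            \<open>G w\<close>.\<close>
          obtain t where t: "t \<in> S" "\<And>s. s \<in> S \<Longrightarrow> Z w t \<le> Z w s"
            using continuous_attains_inf[OF S(3,2)] elim(1) continuous_on_subset by (metis subset_UNIV)
          have "Z w t \<le> (INF t\<in>S. Z w t)" using t S(2) by (intro cINF_greatest) auto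
          also have "\<dots> = (INF t\<in>S. Z' w t)" using e1 S by (intro INF_cong) auto
          also have "\<dots> \<le> (INF t\<in>K. Z' w t)" using w by (simp add: u_def)
          also have "\<dots> \<le> Z' w (G w)"
          proof (rule cINF_lower[OF _ GK])
            have "Z' w \<in> mspace fs"
              using measurable_space[OF Z'(1) elim(3)] by (simp add: space_measure_of_conv)
            then show "bdd_below (Z' w ` K)" unfolding fs_def by (rule funspace_real_bounded) simp
          qed
          also have "\<dots> = Z w (G w)" using e1 GK by simp
          finally have "Z w t \<le> Z w (G w)" .
          then have "is_arg_min (Z w) (\<lambda>_. True) t" using elim(1) by (auto simp: is_arg_min_linorder intro: order_trans)
          then have "t = G w" using elim(1) by blast
          then show "G w \<in> F" using t by (simp add: S_def)
        qed
      qed (use elim in auto)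
    qed
  qed measurable
  have "(\<lambda>n. outer_expectation (M n) (\<lambda>x. \<phi> j (u (restrict (Zn n x) K)))) \<longlonglongrightarrow> (\<integral>w. \<phi> j (u (Z' w)) \<partial>Q)"
    using \<phi>u \<phi> by (intro Z'(3)) (auto simp: bounded_iff intro!: exI[of _ 1])
  then have "\<forall>\<^sub>F n in sequentially. outer_expectation (M n) (\<lambda>x. \<phi> j (u (restrict (Zn n x) K))) <
      measure Q {w \<in> space Q. G w \<in> F \<or> G w \<notin> K} + e"
    by (rule order_tendstoD(2)) (use j sub e in linarith)
  then show ?thesis
    using M Zn argmin
  proof eventually_elim
    case (elim n)
    have [measurable]: "H n \<in> borel_measurable (M n)" using elim by simp
    have "measure (M n) {x \<in> space (M n). H n x \<in> F \<inter> K} \<le> outer_expectation (M n) (\<lambda>x. \<phi> j (u (restrict (Zn n x) K)))"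
    proof (rule measure_le_outer_expectation)
      show "prob_space (M n)" using elim by simp
      show "AE x in M n. x \<in> {x \<in> space (M n). H n x \<in> F \<inter> K} \<longrightarrow> \<phi> j (u (restrict (Zn n x) K)) = 1"
        using elim(3,4)
      proof eventually_elim
        case (elim x)
        show ?case
        proof
          assume x: "x \<in> {x \<in> space (M n). H n x \<in> F \<inter> K}"
          let ?z = "restrict (Zn n x) K"
          \<comment> \<open>\<open>H n x\<close> is a point of \<open>S\<close> and a minimizer over
            \<open>K\<close>, so its value lies between the two infima.\<close>
          have "(INF t\<in>S. ?z t) \<le> ?z (H n x)"
            using x funspace_real_bounded[OF elim(1)[unfolded fs_def] S(1)] by (intro cINF_lower) (auto simp: S_def)
          also have "\<dots> \<le> (INF t\<in>K. ?z t)"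
            using elim x S by (intro cINF_greatest) auto
          finally have "u ?z \<le> 0" by (simp add: u_def)
          then show "\<phi> j (u ?z) = 1"
            using mult_nonneg_nonpos[of "real j" "u ?z"] by (auto simp: \<phi>_def)
        qed
      qed
    qed (use \<phi> in auto)
    then show ?case using elim by linarith
  qed
qed

text \<open>The sum counts the integers i with 1 <= i <= k*y, so the average is floor(k*y)/k. This
  layer-cake staircase reduces a function with values in [0,1] to its upper level sets.\<close>

lemma sum_indicator_levels:
  fixes y :: real
  assumes y: "0 \<le> y" "y \<le> 1" and k: "k > 0"
  shows "(\<Sum>i\<in>{1..k}. indicator {real i / real k..} y) / real k \<le> y"
    and "y \<le> 1 / real k + (\<Sum>i\<in>{1..k}. indicator {real i / real k..} y) / real k"
proof -
  let ?m = "nat \<lfloor>real k * y\<rfloor>"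
  have ky: "0 \<le> real k * y" "real k * y \<le> real k" using y k by (auto simp: mult_left_le)
  have "(\<Sum>i\<in>{1..k}. indicator {real i / real k..} y) = (\<Sum>i\<in>{1..k}. if real i \<le> real k * y then 1 else 0 :: real)"
    using k by (intro sum.cong) (auto simp: indicator_def field_simps)
  also have "\<dots> = (\<Sum>i\<in>{i \<in> {1..k}. real i \<le> real k * y}. 1)"
    by (rule sum.inter_filter[symmetric]) simp
  also have "{i \<in> {1..k}. real i \<le> real k * y} = {1..?m}"
    using ky by (auto simp: le_nat_floor) (linarith+)
  finally have s: "(\<Sum>i\<in>{1..k}. indicator {real i / real k..} y) = real ?m" by simp
  have "real ?m \<le> real k * y" "real k * y \<le> 1 + real ?m" using ky by linarith+
  then show "(\<Sum>i\<in>{1..k}. indicator {real i / real k..} y) / real k \<le> y"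
    and "y \<le> 1 / real k + (\<Sum>i\<in>{1..k}. indicator {real i / real k..} y) / real k"
    unfolding s using k by (auto simp: field_simps)
qed

text \<open>The portmanteau direction from closed sets to integrals: upper level sets of a
  continuous \<open>g\<close> are closed, so the staircase bounds integrals of \<open>g\<close> from
  above; the same bound for \<open>1 - g\<close> is the lower bound for \<open>g\<close>.\<close>

lemma converges_in_distribution_closed:
  fixes H :: "nat \<Rightarrow> 'a \<Rightarrow> 'e::euclidean_space" and G :: "'w \<Rightarrow> 'e"
  assumes M: "\<forall>\<^sub>F n in sequentially. prob_space (M n) \<and> H n \<in> borel_measurable (M n)"
    and Q: "prob_space Q" and G: "G \<in> borel_measurable Q"
    and cl: "\<And>F e. closed F \<Longrightarrow> e > 0 \<Longrightarrow> \<forall>\<^sub>F n in sequentially.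
      measure (M n) {x \<in> space (M n). H n x \<in> F} \<le> measure Q {w \<in> space Q. G w \<in> F} + e"
  shows "converges_in_distribution M H Q G"
proof -
  interpret Q: prob_space Q by fact
  note [measurable] = G
  have upper: "\<forall>\<^sub>F n in sequentially. (\<integral>x. g (H n x) \<partial>M n) \<le> (\<integral>w. g (G w) \<partial>Q) + e"
    if g: "continuous_on UNIV g" "\<And>t. 0 \<le> g t \<and> g t \<le> 1" and e: "e > 0" for g :: "'e \<Rightarrow> real" and e
  proof -
    \<comment> \<open>One \<open>e / 2\<close> pays for the step width \<open>1 / real k\<close> of
      the staircase, the other for the \<open>k\<close> level sets, whose errors are
      averaged.\<close>
    obtain k :: nat where k: "k > 0" "1 / real k < e / 2"
      using nat_approx_posE[of "e / 2"] e by (metis half_gt_zero of_nat_0_less_iff zero_less_Suc)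
    have [measurable]: "g \<in> borel_measurable borel" using g(1) by (rule borel_measurable_continuous_onI)
    define F where "F = (\<lambda>i::nat. {t. real i / real k \<le> g t})"
    have F: "closed (F i)" for i unfolding F_def using g(1) by (intro closed_Collect_le) auto
    then have [measurable]: "F i \<in> sets borel" for i by simp
    have ind: "indicator {real i / real k..} (g t) = (indicator (F i) t :: real)" for i t
      by (simp add: F_def indicator_def)
    have lo: "(\<Sum>i\<in>{1..k}. indicator (F i) t) / real k \<le> g t"
      and up: "g t \<le> 1 / real k + (\<Sum>i\<in>{1..k}. indicator (F i) t) / real k" for t
      using sum_indicator_levels[of "g t" k] g(2)[of t] k(1) by (simp_all only: ind)
    have "\<forall>\<^sub>F n in sequentially. \<forall>i\<in>{1..k}.
        measure (M n) {x \<in> space (M n). H n x \<in> F i} \<le> measure Q {w \<in> space Q. G w \<in> F i} + e / 2"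
      using cl F e by (intro eventually_ball_finite) auto
    then show ?thesis
      using M
    proof eventually_elim
      case (elim n)
      interpret Mn: prob_space "M n" using elim by simp
      have [measurable]: "H n \<in> borel_measurable (M n)" using elim by simp
      have ig: "integrable (M n) (\<lambda>x. g (H n x))" "integrable Q (\<lambda>w. g (G w))"
        using g(2) by (auto intro!: Mn.integrable_const_bound[where B=1] Q.integrable_const_bound[where B=1])
      have i1: "(\<integral>x. (indicator (F i) (H n x) :: real) \<partial>M n) = measure (M n) {x \<in> space (M n). H n x \<in> F i}" for i
      proof -
        have "(\<integral>x. (indicator (F i) (H n x) :: real) \<partial>M n) = (\<integral>x. indicator {x \<in> space (M n). H n x \<in> F i} x \<partial>M n)"
          by (rule Bochner_Integration.integral_cong) (auto simp: indicator_def)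
        then show ?thesis by simp
      qed
      have i2: "(\<integral>w. (indicator (F i) (G w) :: real) \<partial>Q) = measure Q {w \<in> space Q. G w \<in> F i}" for i
      proof -
        have "(\<integral>w. (indicator (F i) (G w) :: real) \<partial>Q) = (\<integral>w. indicator {w \<in> space Q. G w \<in> F i} w \<partial>Q)"
          by (rule Bochner_Integration.integral_cong) (auto simp: indicator_def)
        then show ?thesis by simp
      qed
      have ii: "integrable (M n) (\<lambda>x. indicator (F i) (H n x) :: real)" "integrable Q (\<lambda>w. indicator (F i) (G w) :: real)" for i
        by (auto intro!: Mn.integrable_const_bound[where B=1] Q.integrable_const_bound[where B=1])
      have "(\<integral>x. g (H n x) \<partial>M n) \<le> (\<integral>x. 1 / real k + (\<Sum>i\<in>{1..k}. indicator (F i) (H n x)) / real k \<partial>M n)"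
        using ig ii up by (intro integral_mono) auto
      also have "\<dots> = 1 / real k + (\<Sum>i\<in>{1..k}. measure (M n) {x \<in> space (M n). H n x \<in> F i}) / real k"
        using ii by (simp add: i1 Mn.prob_space)
      also have "\<dots> \<le> 1 / real k + (\<Sum>i\<in>{1..k}. measure Q {w \<in> space Q. G w \<in> F i} + e / 2) / real k"
        using elim(1) by (intro add_mono divide_right_mono sum_mono) auto
      also have "\<dots> = 1 / real k + (\<Sum>i\<in>{1..k}. measure Q {w \<in> space Q. G w \<in> F i}) / real k + e / 2"
        using k by (simp add: sum.distrib add_divide_distrib)
      also have "(\<Sum>i\<in>{1..k}. measure Q {w \<in> space Q. G w \<in> F i}) / real k =
          (\<integral>w. (\<Sum>i\<in>{1..k}. indicator (F i) (G w)) / real k \<partial>Q)"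
        using ii by (simp add: i2)
      also have "\<dots> \<le> (\<integral>w. g (G w) \<partial>Q)"
        using ig ii lo by (intro integral_mono) auto
      finally show ?case using k by linarith
    qed
  qed
  show ?thesis
    unfolding converges_in_distribution_def
  proof (intro allI impI)
    fix f :: "'e \<Rightarrow> real" assume f: "continuous_on UNIV f" "bounded (range f)"
    then obtain C where C: "C > 0" "\<And>t. \<bar>f t\<bar> \<le> C"
      by (auto simp: bounded_pos)
    \<comment> \<open>Affine rescaling of \<open>f\<close> into [0,1], the range for which
      \<open>upper\<close> is stated.\<close>
    define g where "g = (\<lambda>t. (f t + C) / (2 * C))"
    have gc: "continuous_on UNIV g" "continuous_on UNIV (\<lambda>t. 1 - g t)"
      unfolding g_def using C by (auto intro!: continuous_intros f)
    have g01: "0 \<le> g t \<and> g t \<le> 1" for t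
      unfolding g_def using C(1) C(2)[of t] by (auto simp: field_simps abs_le_iff)
    have [measurable]: "g \<in> borel_measurable borel" using gc(1) by (rule borel_measurable_continuous_onI)
    have iQ: "integrable Q (\<lambda>w. g (G w))"
      using g01 by (auto intro!: Q.integrable_const_bound[where B=1])
    have fg: "f t = 2 * C * g t - C" for t using C by (simp add: g_def)
    have "(\<lambda>n. \<integral>x. g (H n x) \<partial>M n) \<longlonglongrightarrow> (\<integral>w. g (G w) \<partial>Q)"
    proof (rule tendstoI)
      fix e :: real assume e: "e > 0"
      have "\<forall>\<^sub>F n in sequentially. (\<integral>x. g (H n x) \<partial>M n) \<le> (\<integral>w. g (G w) \<partial>Q) + e / 2"
        using upper[OF gc(1) g01, of "e / 2"] e by simp
      moreover have "\<forall>\<^sub>F n in sequentially. (\<integral>x. 1 - g (H n x) \<partial>M n) \<le> (\<integral>w. 1 - g (G w) \<partial>Q) + e / 2"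
        using upper[OF gc(2), of "e / 2"] g01 e by simp
      ultimately show "\<forall>\<^sub>F n in sequentially. dist (\<integral>x. g (H n x) \<partial>M n) (\<integral>w. g (G w) \<partial>Q) < e"
        using M
      proof eventually_elim
        case (elim n)
        interpret Mn: prob_space "M n" using elim by simp
        have [measurable]: "H n \<in> borel_measurable (M n)" using elim by simp
        have "integrable (M n) (\<lambda>x. g (H n x))"
          using g01 by (auto intro!: Mn.integrable_const_bound[where B=1])
        then show ?case using elim iQ e by (simp add: Mn.prob_space Q.prob_space dist_real_def)
      qed
    qed
    then have "(\<lambda>n. 2 * C * (\<integral>x. g (H n x) \<partial>M n) - C) \<longlonglongrightarrow> 2 * C * (\<integral>w. g (G w) \<partial>Q) - C"
      by (intro tendsto_intros)
    moreover have "2 * C * (\<integral>w. g (G w) \<partial>Q) - C = (\<integral>w. f (G w) \<partial>Q)"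
      unfolding fg using iQ by (simp add: Q.prob_space)
    moreover have "\<forall>\<^sub>F n in sequentially. 2 * C * (\<integral>x. g (H n x) \<partial>M n) - C = (\<integral>x. f (H n x) \<partial>M n)"
      using M
    proof eventually_elim
      case (elim n)
      interpret Mn: prob_space "M n" using elim by simp
      have [measurable]: "H n \<in> borel_measurable (M n)" using elim by simp
      have "integrable (M n) (\<lambda>x. g (H n x))"
        using g01 by (auto intro!: Mn.integrable_const_bound[where B=1])
      then show ?case unfolding fg by (simp add: Mn.prob_space)
    qed
    ultimately show "(\<lambda>n. \<integral>x. f (H n x) \<partial>M n) \<longlonglongrightarrow> (\<integral>w. f (G w) \<partial>Q)"
      using Lim_transform_eventually by force
  qed
qed

text \<open>Tightness confines \<open>H n\<close>, and continuity of the single measure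
  \<open>Q\<close> confines \<open>G\<close>, to a common ball up to \<open>e / 3\<close> each; the
  third \<open>e / 3\<close> is spent on the compact case.\<close>

lemma argmin_converges_in_distribution:
  fixes H :: "nat \<Rightarrow> 'a \<Rightarrow> 'e::euclidean_space" and G :: "'w \<Rightarrow> 'e"
  assumes M: "\<forall>\<^sub>F n in sequentially. prob_space (M n) \<and> H n \<in> borel_measurable (M n)"
    and Q: "prob_space Q" and G: "G \<in> borel_measurable Q"
    and conv: "\<And>K. compact K \<Longrightarrow> converges_in_distribution_linf K M Zn Q Z"
    and argmin: "\<And>K. compact K \<Longrightarrow>
      \<forall>\<^sub>F n in sequentially. AE x in M n. H n x \<in> K \<longrightarrow> (\<forall>t\<in>K. Zn n x (H n x) \<le> Zn n x t)"
    and tight: "\<And>e. e > 0 \<Longrightarrow> \<exists>B. \<forall>\<^sub>F n in sequentially. measure (M n) {x \<in> space (M n). norm (H n x) > B} \<le> e"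
    and Z: "AE w in Q. continuous_on UNIV (Z w) \<and> is_arg_min (Z w) (\<lambda>_. True) (G w) \<and>
      (\<forall>t. is_arg_min (Z w) (\<lambda>_. True) t \<longrightarrow> t = G w)"
  shows "converges_in_distribution M H Q G"
proof (rule converges_in_distribution_closed[OF M Q G])
  fix F :: "'e set" and e :: real assume F: "closed F" and e: "e > 0"
  interpret Q: prob_space Q by fact
  note [measurable] = G
  have [measurable]: "F \<in> sets borel" using F by simp
  obtain B where B: "\<forall>\<^sub>F n in sequentially. measure (M n) {x \<in> space (M n). norm (H n x) > B} \<le> e / 3"
    using tight[of "e / 3"] e by auto
  have "(\<lambda>m. measure Q {w \<in> space Q. norm (G w) > real m}) \<longlonglongrightarrow> measure Q (\<Inter>m. {w \<in> space Q. norm (G w) > real m})"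
    by (rule Q.finite_Lim_measure_decseq) (auto simp: decseq_def)
  also have "(\<Inter>m. {w \<in> space Q. norm (G w) > real m}) = {}"
  proof -
    have "\<exists>m. \<not> real m < norm (G w)" for w
      using reals_Archimedean2[of "norm (G w)"] by (meson less_asym)
    then show ?thesis by blast
  qed
  finally have "\<forall>\<^sub>F m in sequentially. measure Q {w \<in> space Q. norm (G w) > real m} < e / 3"
    by (rule order_tendstoD(2)) (use e in simp)
  then obtain m where m: "measure Q {w \<in> space Q. norm (G w) > real m} < e / 3"
    by (auto simp: eventually_sequentially)
  define K where "K = cball (0::'e) (max B (real m))"
  have K: "compact K" by (simp add: K_def)
  have [measurable]: "K \<in> sets borel" by (simp add: K_def)
  have "measure Q {w \<in> space Q. G w \<in> F \<or> G w \<notin> K} \<le>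
      measure Q ({w \<in> space Q. G w \<in> F} \<union> {w \<in> space Q. norm (G w) > real m})"
    by (rule Q.finite_measure_mono) (auto simp: K_def)
  also have "\<dots> \<le> measure Q {w \<in> space Q. G w \<in> F} + measure Q {w \<in> space Q. norm (G w) > real m}"
    by (rule measure_Un_le) measurable
  finally have q: "measure Q {w \<in> space Q. G w \<in> F \<or> G w \<notin> K} \<le> measure Q {w \<in> space Q. G w \<in> F} + e / 3"
    using m by simp
  have "\<forall>\<^sub>F n in sequentially. measure (M n) {x \<in> space (M n). H n x \<in> F \<inter> K} \<le>
      measure Q {w \<in> space Q. G w \<in> F \<or> G w \<notin> K} + e / 3"
    using e by (intro argmin_portmanteau_compact[OF M Q G K F conv[OF K] argmin[OF K] Z]) simp
  then show "\<forall>\<^sub>F n in sequentially.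
      measure (M n) {x \<in> space (M n). H n x \<in> F} \<le> measure Q {w \<in> space Q. G w \<in> F} + e"
    using M B
  proof eventually_elim
    case (elim n)
    interpret Mn: prob_space "M n" using elim by simp
    have [measurable]: "H n \<in> borel_measurable (M n)" using elim by simp
    have "measure (M n) {x \<in> space (M n). H n x \<in> F} \<le>
        measure (M n) ({x \<in> space (M n). H n x \<in> F \<inter> K} \<union> {x \<in> space (M n). norm (H n x) > B})"
      by (rule Mn.finite_measure_mono) (auto simp: K_def)
    also have "\<dots> \<le> measure (M n) {x \<in> space (M n). H n x \<in> F \<inter> K} + measure (M n) {x \<in> space (M n). norm (H n x) > B}"
      by (rule measure_Un_le) measurable
    finally show ?case using elim q by linarith
  qed
qed

text \<open>Evaluation at \<open>t\<close> is continuous on the function space, so the limit law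
  controls the upper tail of \<open>Zn n x t\<close>. As that value need not be measurable in
  \<open>x\<close>, the conclusion speaks of measurable events \<open>E\<close> on which it is at
  least \<open>b\<close>.\<close>

lemma converges_in_distribution_linf_tight:
  fixes Zn :: "nat \<Rightarrow> 'a \<Rightarrow> 'e \<Rightarrow> real"
  assumes M: "\<forall>\<^sub>F n in sequentially. prob_space (M n)" and Q: "prob_space Q"
    and conv: "converges_in_distribution_linf K M Zn Q Z" and t: "t \<in> K" and e: "e > 0"
  shows "\<exists>b. \<forall>\<^sub>F n in sequentially. \<forall>E\<in>sets (M n).
    (AE x in M n. x \<in> E \<longrightarrow> b \<le> Zn n x t) \<longrightarrow> measure (M n) E \<le> e"
proof -
  interpret Q: prob_space Q by fact
  define fs where "fs = funspace K (euclidean_metric :: real metric)"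
  obtain Z' where Z': "Z' \<in> Q \<rightarrow>\<^sub>M sigma (mspace fs) {U. openin (mtopology_of fs) U}"
      "\<And>f. continuous_map (mtopology_of fs) euclideanreal f \<Longrightarrow> bounded (f ` mspace fs) \<Longrightarrow>
         (\<lambda>n. outer_expectation (M n) (\<lambda>x. f (restrict (Zn n x) K))) \<longlonglongrightarrow> (\<integral>w. f (Z' w) \<partial>Q)"
    using conv unfolding converges_in_distribution_linf_def fs_def Let_def by blast
  \<comment> \<open>A ramp from 0 at level \<open>j\<close> to 1 at level \<open>j + 1\<close>; the
    bound found in the end is \<open>real j + 1\<close>.\<close>
  define \<phi> where "\<phi> = (\<lambda>(j::nat) v. max 0 (min 1 (v - real j)))"
  have \<phi>: "0 \<le> \<phi> j v \<and> \<phi> j v \<le> 1" for j v by (auto simp: \<phi>_def)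
  have "Lipschitz_continuous_map fs euclidean_metric (\<lambda>z. z t)"
    unfolding Lipschitz_continuous_map_def
  proof (intro conjI exI[of _ 1] ballI)
    fix y z assume "y \<in> mspace fs" "z \<in> mspace fs"
    then show "mdist euclidean_metric (y t) (z t) \<le> 1 * mdist fs y z"
      using dist_le_mdist_funspace[OF _ _ t] unfolding fs_def
      by (simp add: dist_real_def del: mspace_funspace mdist_funspace)
  qed auto
  from Lipschitz_continuous_imp_continuous_map[OF this]
  have ev: "continuous_map (mtopology_of fs) euclideanreal (\<lambda>z. z t)" by (simp only: mtopology_of_euclidean)
  have \<phi>c: "continuous_map (mtopology_of fs) euclideanreal (\<lambda>z. \<phi> j (z t))" for j
  proof -
    have "continuous_map euclideanreal euclideanreal (\<phi> j)"
      unfolding \<phi>_def continuous_map_iff_continuous2 by (intro continuous_intros)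
    then show ?thesis using continuous_map_compose[OF ev, of euclideanreal "\<phi> j"] by (simp only: comp_def)
  qed
  have [measurable]: "(\<lambda>w. \<phi> j (Z' w t)) \<in> borel_measurable Q" for j
    using measurable_borel_funspace[OF Z'(1) \<phi>c] by auto
  have "(\<lambda>j. \<integral>w. \<phi> j (Z' w t) \<partial>Q) \<longlonglongrightarrow> (\<integral>w. 0 \<partial>Q)"
  proof (rule integral_dominated_convergence[where w="\<lambda>_. 1"])
    show "AE w in Q. (\<lambda>j. \<phi> j (Z' w t)) \<longlonglongrightarrow> 0"
    proof (rule AE_I2)
      fix w
      obtain N :: nat where "Z' w t \<le> real N" using real_arch_simple by blast
      then have "\<forall>\<^sub>F j in sequentially. \<phi> j (Z' w t) = 0"
        by (intro eventually_sequentiallyI[of N]) (auto simp: \<phi>_def)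
      then show "(\<lambda>j. \<phi> j (Z' w t)) \<longlonglongrightarrow> 0" by (simp add: tendsto_eventually)
    qed
  qed (use \<phi> in auto)
  then have "\<forall>\<^sub>F j in sequentially. (\<integral>w. \<phi> j (Z' w t) \<partial>Q) < e"
    by (rule order_tendstoD(2)) (use e in simp)
  then obtain j where j: "(\<integral>w. \<phi> j (Z' w t) \<partial>Q) < e"
    by (auto simp: eventually_sequentially)
  have "(\<lambda>n. outer_expectation (M n) (\<lambda>x. \<phi> j (restrict (Zn n x) K t))) \<longlonglongrightarrow> (\<integral>w. \<phi> j (Z' w t) \<partial>Q)"
    using \<phi>c \<phi> by (intro Z'(2)) (auto simp: bounded_iff intro!: exI[of _ 1])
  then have "\<forall>\<^sub>F n in sequentially. outer_expectation (M n) (\<lambda>x. \<phi> j (restrict (Zn n x) K t)) < e"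
    by (rule order_tendstoD(2)) (use j in simp)
  then have "\<forall>\<^sub>F n in sequentially. \<forall>E\<in>sets (M n).
    (AE x in M n. x \<in> E \<longrightarrow> real j + 1 \<le> Zn n x t) \<longrightarrow> measure (M n) E \<le> e"
    using M
  proof eventually_elim
    case (elim n)
    show ?case
    proof (intro ballI impI)
      fix E assume E: "E \<in> sets (M n)" "AE x in M n. x \<in> E \<longrightarrow> real j + 1 \<le> Zn n x t"
      have "measure (M n) E \<le> outer_expectation (M n) (\<lambda>x. \<phi> j (restrict (Zn n x) K t))"
      proof (rule measure_le_outer_expectation[OF elim(2) \<phi> E(1)])
        show "AE x in M n. x \<in> E \<longrightarrow> \<phi> j (restrict (Zn n x) K t) = 1"
          using E(2) by eventually_elim (use t in \<open>auto simp: \<phi>_def\<close>)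
      qed
      then show "measure (M n) E \<le> e" using elim(1) by linarith
    qed
  qed
  then show ?thesis by blast
qed

section \<open>Powers of a measure\<close>

lemma sets_power_measure_cong: "sets Q = sets R \<Longrightarrow> sets (power_measure Q n) = sets (power_measure R n)"
  unfolding power_measure_def by (rule sets_PiM_cong) auto

lemma prob_space_power_measure: "prob_space Q \<Longrightarrow> prob_space (power_measure Q n)"
  unfolding power_measure_def by (rule prob_space_PiM)

text \<open>Rectangles form an intersection-stable generator, and the mass of a rectangle is a
  finite product of masses, each measurable in \<theta> because \<open>P\<close> is a
  kernel.\<close>

lemma power_measure_kernel:
  assumes P: "P \<in> M \<rightarrow>\<^sub>M prob_algebra N"
  shows "(\<lambda>\<theta>. power_measure (P \<theta>) n) \<in> M \<rightarrow>\<^sub>M prob_algebra (power_measure N n)"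
proof (rule measurable_prob_algebra_generated)
  show "sets (power_measure N n) = sigma_sets (\<Pi>\<^sub>E i\<in>{..<n}. space N) (prod_algebra {..<n} (\<lambda>_. N))"
    unfolding power_measure_def by (rule sets_PiM)
  show "Int_stable (prod_algebra {..<n} (\<lambda>_. N))" by (rule Int_stable_prod_algebra)
  show "prod_algebra {..<n} (\<lambda>_. N) \<subseteq> Pow (\<Pi>\<^sub>E i\<in>{..<n}. space N)"
    by (rule prod_algebra_sets_into_space)
  show pr: "prob_space (power_measure (P a) n)" if "a \<in> space M" for a
    using measurable_space[OF P that] by (intro prob_space_power_measure) (simp add: space_prob_algebra)
  show "sets (power_measure (P a) n) = sets (power_measure N n)" if "a \<in> space M" for a
    using measurable_space[OF P that] by (intro sets_power_measure_cong) (simp add: space_prob_algebra)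
  fix A assume "A \<in> prod_algebra {..<n} (\<lambda>_. N)"
  then obtain X where X: "A = (\<Pi>\<^sub>E i\<in>{..<n}. X i)" "\<And>i. i < n \<Longrightarrow> X i \<in> sets N"
    by (auto simp: prod_algebra_eq_finite)
  have "emeasure (power_measure (P a) n) A = (\<Prod>i<n. emeasure (P a) (X i))" if "a \<in> space M" for a
  proof -
    from measurable_space[OF P that] have a: "prob_space (P a)" "sets (P a) = sets N"
      by (auto simp: space_prob_algebra)
    interpret prob_space "P a" by fact
    interpret product_sigma_finite "\<lambda>_::nat. P a" by standard
    show ?thesis unfolding power_measure_def X(1) using X(2) a by (subst emeasure_PiM) auto
  qed
  moreover have "(\<lambda>a. \<Prod>i<n. emeasure (P a) (X i)) \<in> borel_measurable M"
    using X(2) measurable_prob_algebraD[OF P]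
    by (intro borel_measurable_prod_ennreal measurable_emeasure_kernel) auto
  ultimately show "(\<lambda>a. emeasure (power_measure (P a) n) A) \<in> borel_measurable M"
    by (simp cong: measurable_cong)
qed

text \<open>Disjoint blocks of coordinates are independent and each, once shifted to start at 0, has
  law \<open>power_measure Q k\<close>; so the expectation of the product factors. Coordinates from
  \<open>m * k\<close> on are ignored, which covers an \<open>n\<close> not divisible by
  \<open>k\<close>.\<close>

lemma nn_integral_blocks:
  fixes F :: "(nat \<Rightarrow> 'x) \<Rightarrow> ennreal"
  assumes Q: "prob_space Q" and F: "F \<in> borel_measurable (power_measure Q k)" and mk: "m * k \<le> n"
  shows "(\<integral>\<^sup>+x. (\<Prod>j<m. F (\<lambda>i\<in>{..<k}. x (j * k + i))) \<partial>power_measure Q n) =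
    (\<integral>\<^sup>+x. F x \<partial>power_measure Q k) ^ m"
proof -
  let ?M = "power_measure Q n"
  let ?K = "\<lambda>j. {j * k..<j * k + k}"
  let ?S = "\<lambda>j x. \<lambda>i\<in>{..<k}. x (j * k + i) :: 'x"
  interpret Q: prob_space Q by fact
  interpret M: prob_space ?M using Q by (rule prob_space_power_measure)
  have sub: "j * k + k \<le> n" if "j < m" for j
  proof -
    have "j * k + k = Suc j * k" by simp
    also have "\<dots> \<le> m * k" using that by (intro mult_le_mono1) auto
    finally show ?thesis using mk by simp
  qed
  have "M.indep_vars (\<lambda>_. Q) (\<lambda>i x. x i) {..<n}"
  proof (cases "n = 0")
    \<comment> \<open>Independence of an empty family is vacuous; the joint-law criterion used
      otherwise is for nonempty index sets.\<close>
    case True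
    then show ?thesis unfolding M.indep_vars_def M.indep_sets_def by auto
  next
    case False
    have id: "distr ?M ?M (\<lambda>x. \<lambda>i\<in>{..<n}. x i) = distr ?M ?M (\<lambda>x. x)"
      by (rule distr_cong) (auto simp: power_measure_def space_PiM)
    have co: "distr ?M Q (\<lambda>x. x i) = Q" if "i < n" for i
      unfolding power_measure_def by (rule distr_PiM_component) (use that Q in auto)
    show ?thesis
      using False id co
      by (subst M.indep_vars_iff_distr_eq_PiM')
         (auto simp: power_measure_def distr_id[unfolded id_def] intro!: PiM_cong)
  qed
  then have "M.indep_vars (\<lambda>j. PiM (?K j) (\<lambda>_. Q)) (\<lambda>j x. restrict (\<lambda>i. x i) (?K j)) {..<m}"
  proof (rule M.indep_vars_restrict)
    show "disjoint_family_on ?K {..<m}"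
    proof (unfold disjoint_family_on_def, intro ballI impI)
      fix a b :: nat assume ab: "a \<noteq> b"
      \<comment> \<open>Division by \<open>k\<close> recovers the block number of an index, so no
        index lies in two blocks.\<close>
      have "x div k = c" if "x \<in> ?K c" for x c :: nat
        using that by (intro div_nat_eqI) (auto simp: mult.commute)
      then show "?K a \<inter> ?K b = {}" using ab by (metis disjoint_iff)
    qed
    fix j assume "j \<in> {..<m}" then show "?K j \<subseteq> {..<n}" using sub[of j] by auto
  qed
  then have "M.indep_vars (\<lambda>_. borel) (\<lambda>j x. F (?S j (restrict (\<lambda>i. x i) (?K j)))) {..<m}"
  proof (rule M.indep_vars_compose2)
    fix j
    have "?S j \<in> PiM (?K j) (\<lambda>_. Q) \<rightarrow>\<^sub>M power_measure Q k"
      unfolding power_measure_def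
      by (intro measurable_restrict measurable_component_singleton) auto
    then show "(\<lambda>x. F (?S j x)) \<in> PiM (?K j) (\<lambda>_. Q) \<rightarrow>\<^sub>M borel"
      using F by (rule measurable_compose)
  qed
  moreover have "?S j (restrict (\<lambda>i. x i) (?K j)) = ?S j x" for j and x :: "nat \<Rightarrow> 'x"
    by (auto simp: fun_eq_iff)
  ultimately have ind: "M.indep_vars (\<lambda>_. borel) (\<lambda>j x. F (?S j x)) {..<m}" by simp
  have "(\<integral>\<^sup>+x. (\<Prod>j<m. F (?S j x)) \<partial>?M) = (\<Prod>j<m. \<integral>\<^sup>+x. F (?S j x) \<partial>?M)"
    using ind by (intro M.indep_vars_nn_integral) auto
  also have "\<dots> = (\<Prod>j<m. \<integral>\<^sup>+x. F x \<partial>power_measure Q k)"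
  proof (intro prod.cong refl)
    fix j assume "j \<in> {..<m}"
    then have j: "j * k + k \<le> n" using sub by auto
    have d: "distr ?M (power_measure Q k) (?S j) = power_measure Q k"
      unfolding power_measure_def
      by (rule distr_PiM_reindex) (use Q j in \<open>auto simp: inj_on_def\<close>)
    have [measurable]: "?S j \<in> ?M \<rightarrow>\<^sub>M power_measure Q k"
      unfolding power_measure_def
      by (intro measurable_restrict measurable_component_singleton) (use j in auto)
    show "(\<integral>\<^sup>+x. F (?S j x) \<partial>?M) = (\<integral>\<^sup>+x. F x \<partial>power_measure Q k)"
      using nn_integral_distr[of "?S j" ?M "power_measure Q k" F] F by (simp add: d)
  qed
  finally show ?thesis by simp
qed

lemma integrable_unit_interval:
  fixes f :: "'a \<Rightarrow> real"
  assumes "prob_space M" "f \<in> borel_measurable M" "\<And>x. x \<in> space M \<Longrightarrow> 0 \<le> f x \<and> f x \<le> 1"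
  shows "integrable M f"
proof -
  interpret prob_space M by fact
  show ?thesis using assms(2,3) by (intro integrable_const_bound[where B=1]) (auto intro!: AE_I2)
qed

lemma integral_unit_interval:
  fixes f :: "'a \<Rightarrow> real"
  assumes "prob_space M" "f \<in> borel_measurable M" "\<And>x. x \<in> space M \<Longrightarrow> 0 \<le> f x \<and> f x \<le> 1"
  shows "0 \<le> (\<integral>x. f x \<partial>M) \<and> (\<integral>x. f x \<partial>M) \<le> 1"
proof -
  interpret prob_space M by fact
  have "(\<integral>x. f x \<partial>M) \<le> (\<integral>x. 1 \<partial>M)"
    using integrable_unit_interval[OF assms] assms(3) by (intro integral_mono) auto
  then show ?thesis using assms(3) by (auto intro!: Bochner_Integration.integral_nonneg simp: prob_space)
qed

text \<open>Coordinates are exchanged one at a time, each at cost \<open>c\<close>. Total variation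
  is phrased through functions with values in [0,1] because integrating out the last coordinate
  yields a function of the same kind, to which the induction hypothesis applies.\<close>

lemma power_measure_total_variation:
  fixes f :: "(nat \<Rightarrow> 'x) \<Rightarrow> real"
  assumes Q: "prob_space Q" and R: "prob_space R" and QR: "sets Q = sets R"
    and c: "\<And>f. f \<in> borel_measurable Q \<Longrightarrow> (\<And>x. x \<in> space Q \<Longrightarrow> 0 \<le> f x \<and> f x \<le> (1::real)) \<Longrightarrow>
      \<bar>(\<integral>x. f x \<partial>Q) - (\<integral>x. f x \<partial>R)\<bar> \<le> c"
    and f: "f \<in> borel_measurable (power_measure Q n)"
      "\<And>x. x \<in> space (power_measure Q n) \<Longrightarrow> 0 \<le> f x \<and> f x \<le> 1"
  shows "\<bar>(\<integral>x. f x \<partial>power_measure Q n) - (\<integral>x. f x \<partial>power_measure R n)\<bar> \<le> real n * c"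
  using f
proof (induction n arbitrary: f)
  case 0
  then show ?case by (simp add: power_measure_def PiM_empty)
next
  case (Suc n)
  interpret Q: prob_space Q by fact
  interpret R: prob_space R by fact
  interpret PQ: product_sigma_finite "\<lambda>_::nat. Q" by standard
  interpret PR: product_sigma_finite "\<lambda>_::nat. R" by standard
  have sp: "space Q = space R" using QR by (rule sets_eq_imp_space_eq)
  have pQ: "prob_space (power_measure Q m)" and pR: "prob_space (power_measure R m)" for m
    using Q R by (auto intro: prob_space_power_measure)
  have ss: "sets (power_measure Q m) = sets (power_measure R m)" for m
    using QR by (rule sets_power_measure_cong)
  have s3: "space (power_measure Q m) = space (power_measure R m)" for m
    using ss by (rule sets_eq_imp_space_eq)
  have fR: "f \<in> borel_measurable (power_measure R (Suc n))"
    using Suc.prems(1) measurable_cong_sets[OF ss refl] by blast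
  have up: "x(n := y) \<in> space (power_measure Q (Suc n))"
    if "x \<in> space (power_measure Q n)" "y \<in> space Q" for x y
    using that by (auto simp: power_measure_def space_PiM PiE_def extensional_def Pi_def less_Suc_eq)
  have upm: "(\<lambda>(x, y). x(n := y)) \<in> power_measure Q n \<Otimes>\<^sub>M Q \<rightarrow>\<^sub>M power_measure Q (Suc n)"
    using measurable_add_dim[of n "{..<n}" "\<lambda>_. Q"] by (simp add: power_measure_def lessThan_Suc)
  have m2: "(\<lambda>(x, y). f (x(n := y))) \<in> borel_measurable (power_measure Q n \<Otimes>\<^sub>M Q)"
    using measurable_compose[OF upm Suc.prems(1)] by (simp add: case_prod_unfold fun_upd_def)
  let ?FQ = "\<lambda>x. \<integral>y. f (x(n := y)) \<partial>Q"
  let ?FR = "\<lambda>x. \<integral>y. f (x(n := y)) \<partial>R"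
  have FQ: "?FQ \<in> borel_measurable (power_measure Q n)"
    using m2 by (rule Q.borel_measurable_lebesgue_integral)
  have "(\<lambda>(x, y). f (x(n := y))) \<in> borel_measurable (power_measure R n \<Otimes>\<^sub>M R)"
    using m2 measurable_cong_sets[OF sets_pair_measure_cong[OF ss QR] refl] by blast
  then have FR: "?FR \<in> borel_measurable (power_measure R n)"
    by (rule R.borel_measurable_lebesgue_integral)
  have FQR: "?FQ \<in> borel_measurable (power_measure R n)"
    using FQ measurable_cong_sets[OF ss refl] by blast
  have sl: "(\<lambda>y. f (x(n := y))) \<in> borel_measurable Q" if "x \<in> space (power_measure Q n)" for x
    using measurable_compose[OF measurable_Pair1'[OF that, of Q] m2] by simp
  have slR: "(\<lambda>y. f (x(n := y))) \<in> borel_measurable R" if "x \<in> space (power_measure R n)" for x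
    using sl[of x] that s3 measurable_cong_sets[OF QR refl] by blast
  have bQ: "0 \<le> ?FQ x \<and> ?FQ x \<le> 1" if "x \<in> space (power_measure Q n)" for x
    using that sl up Suc.prems(2) by (intro integral_unit_interval[OF Q]) auto
  have bR: "0 \<le> ?FR x \<and> ?FR x \<le> 1" if "x \<in> space (power_measure R n)" for x
    using that slR up Suc.prems(2) sp s3
    by (intro integral_unit_interval[OF R]) auto
  have eQ: "(\<integral>x. f x \<partial>power_measure Q (Suc n)) = (\<integral>x. ?FQ x \<partial>power_measure Q n)"
    using integrable_unit_interval[OF pQ Suc.prems] unfolding power_measure_def lessThan_Suc
    by (intro PQ.product_integral_insert) auto
  have ifR: "integrable (power_measure R (Suc n)) f"
    using Suc.prems(2) s3 by (intro integrable_unit_interval[OF pR fR]) auto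
  have eR: "(\<integral>x. f x \<partial>power_measure R (Suc n)) = (\<integral>x. ?FR x \<partial>power_measure R n)"
    using ifR unfolding power_measure_def lessThan_Suc
    by (intro PR.product_integral_insert) auto
  have iQ: "integrable (power_measure R n) ?FQ"
    using bQ s3 by (intro integrable_unit_interval[OF pR FQR]) auto
  have iR: "integrable (power_measure R n) ?FR"
    using bR by (intro integrable_unit_interval[OF pR FR]) auto
  interpret Rn: prob_space "power_measure R n" by (rule pR)
  \<comment> \<open>The exchange of the last coordinate, with the first \<open>n\<close> already
    under \<open>R\<close>.\<close>
  have "\<bar>(\<integral>x. ?FQ x \<partial>power_measure R n) - (\<integral>x. ?FR x \<partial>power_measure R n)\<bar>
      = \<bar>\<integral>x. ?FQ x - ?FR x \<partial>power_measure R n\<bar>"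
    using iQ iR by simp
  also have "\<dots> \<le> (\<integral>x. \<bar>?FQ x - ?FR x\<bar> \<partial>power_measure R n)" by (rule integral_abs_bound)
  also have "\<dots> \<le> (\<integral>x. c \<partial>power_measure R n)"
  proof (rule integral_mono)
    fix x assume "x \<in> space (power_measure R n)"
    then have x: "x \<in> space (power_measure Q n)" by (simp add: s3)
    show "\<bar>?FQ x - ?FR x\<bar> \<le> c" by (rule c[OF sl[OF x] Suc.prems(2)[OF up[OF x]]])
  qed (use iQ iR in auto)
  also have "\<dots> = c" by (simp add: Rn.prob_space)
  finally have "\<bar>(\<integral>x. ?FQ x \<partial>power_measure R n) - (\<integral>x. ?FR x \<partial>power_measure R n)\<bar> \<le> c" .
  moreover have "\<bar>(\<integral>x. ?FQ x \<partial>power_measure Q n) - (\<integral>x. ?FQ x \<partial>power_measure R n)\<bar> \<le> real n * c"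
    using FQ bQ by (rule Suc.IH)
  ultimately show ?case unfolding eQ eR by (simp add: algebra_simps)
qed

section \<open>Total variation and differentiability in quadratic mean\<close>

text \<open>A finite \<open>P\<close> has an almost everywhere finite density, so replacing the
  \<open>ennreal\<close> density by the square of a real root changes it on a null set only.\<close>

lemma square_density:
  fixes \<mu> :: "'x measure"
  assumes "sigma_finite_measure \<mu>" and P: "prob_space P" "sets P = sets \<mu>" "absolutely_continuous \<mu> P"
  defines "s \<equiv> \<lambda>x. sqrt (enn2real (RN_deriv \<mu> P x))"
  shows "s \<in> borel_measurable \<mu>"
    and "P = density \<mu> (\<lambda>x. ennreal ((s x)\<^sup>2))"
    and "(\<integral>\<^sup>+x. ennreal ((s x)\<^sup>2) \<partial>\<mu>) = 1"
proof -
  interpret sigma_finite_measure \<mu> by fact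
  interpret P: prob_space P by fact
  show [measurable]: "s \<in> borel_measurable \<mu>" unfolding s_def by measurable
  have "AE x in \<mu>. RN_deriv \<mu> P x \<noteq> \<infinity>"
    using P by (intro RN_deriv_finite) unfold_locales
  then have "density \<mu> (RN_deriv \<mu> P) = density \<mu> (\<lambda>x. ennreal ((s x)\<^sup>2))"
    by (intro density_cong) (auto simp: s_def less_top)
  then show d: "P = density \<mu> (\<lambda>x. ennreal ((s x)\<^sup>2))"
    using density_RN_deriv[OF P(3,2)] by simp
  have "1 = emeasure P (space P)" by (simp add: P.emeasure_space_1)
  also have "\<dots> = (\<integral>\<^sup>+x. ennreal ((s x)\<^sup>2) \<partial>\<mu>)"
    by (subst d, subst emeasure_density) (auto simp: sets_eq_imp_space_eq[OF P(2)] intro!: nn_integral_cong)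
  finally show "(\<integral>\<^sup>+x. ennreal ((s x)\<^sup>2) \<partial>\<mu>) = 1" by simp
qed

text \<open>A weighted arithmetic-geometric mean takes the place of Cauchy-Schwarz: |s^2 - r^2| = |s
  - r| |s + r| <= (s - r)^2 / (2a) + a (s + r)^2 / 2, and (s + r)^2 <= 2 s^2 + 2 r^2. As both
  squares have integral 1, the total is at most D a / 2 + 2 a. The weight \<open>a\<close> will be
  the distance of the two parameters, so that both terms have its order.\<close>

lemma total_variation_le_hellinger:
  fixes s r :: "'x \<Rightarrow> real" and f :: "'x \<Rightarrow> real"
  assumes [measurable]: "s \<in> borel_measurable \<mu>" "r \<in> borel_measurable \<mu>" "f \<in> borel_measurable \<mu>"
    and f: "\<And>x. x \<in> space \<mu> \<Longrightarrow> 0 \<le> f x \<and> f x \<le> 1"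
    and s: "(\<integral>\<^sup>+x. ennreal ((s x)\<^sup>2) \<partial>\<mu>) = 1" and r: "(\<integral>\<^sup>+x. ennreal ((r x)\<^sup>2) \<partial>\<mu>) = 1"
    and h: "(\<integral>\<^sup>+x. ennreal ((s x - r x)\<^sup>2) \<partial>\<mu>) \<le> ennreal (D * a\<^sup>2)" and a: "a > 0" and D: "D \<ge> 0"
  shows "\<bar>(\<integral>x. f x \<partial>density \<mu> (\<lambda>x. ennreal ((s x)\<^sup>2))) - (\<integral>x. f x \<partial>density \<mu> (\<lambda>x. ennreal ((r x)\<^sup>2)))\<bar>
    \<le> (D / 2 + 2) * a"
proof -
  have iS: "integrable \<mu> (\<lambda>x. (s x)\<^sup>2)" "(\<integral>x. (s x)\<^sup>2 \<partial>\<mu>) = 1"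
    using s by (auto intro!: integrableI_nn_integral_finite[where x=1] simp: integral_eq_nn_integral)
  have ir: "integrable \<mu> (\<lambda>x. (r x)\<^sup>2)" "(\<integral>x. (r x)\<^sup>2 \<partial>\<mu>) = 1"
    using r by (auto intro!: integrableI_nn_integral_finite[where x=1] simp: integral_eq_nn_integral)
  have "(\<integral>\<^sup>+x. ennreal ((s x - r x)\<^sup>2) \<partial>\<mu>) < \<infinity>"
    using h le_less_trans ennreal_less_top by (metis infinity_ennreal_def)
  then have id: "integrable \<mu> (\<lambda>x. (s x - r x)\<^sup>2)" by (intro integrableI_nonneg) auto
  have ih: "(\<integral>x. (s x - r x)\<^sup>2 \<partial>\<mu>) \<le> D * a\<^sup>2"
    using h D by (subst (asm) nn_integral_eq_integral[OF id]) (auto simp: ennreal_le_iff)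
  have ifs: "integrable \<mu> (\<lambda>x. (s x)\<^sup>2 * f x)"
    by (rule Bochner_Integration.integrable_bound[OF iS(1)])
       (auto intro!: AE_I2 mult_right_le_one_le simp: abs_mult f)
  have ifr: "integrable \<mu> (\<lambda>x. (r x)\<^sup>2 * f x)"
    by (rule Bochner_Integration.integrable_bound[OF ir(1)])
       (auto intro!: AE_I2 mult_right_le_one_le simp: abs_mult f)
  have "\<bar>(\<integral>x. f x \<partial>density \<mu> (\<lambda>x. ennreal ((s x)\<^sup>2))) - (\<integral>x. f x \<partial>density \<mu> (\<lambda>x. ennreal ((r x)\<^sup>2)))\<bar>
      = \<bar>\<integral>x. (s x)\<^sup>2 * f x - (r x)\<^sup>2 * f x \<partial>\<mu>\<bar>"
    using ifs ifr by (simp add: integral_density)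
  also have "\<dots> \<le> (\<integral>x. \<bar>(s x)\<^sup>2 * f x - (r x)\<^sup>2 * f x\<bar> \<partial>\<mu>)" by (rule integral_abs_bound)
  also have "\<dots> \<le> (\<integral>x. (s x - r x)\<^sup>2 * (1 / (2 * a)) + (s x)\<^sup>2 * a + (r x)\<^sup>2 * a \<partial>\<mu>)"
  proof (rule integral_mono)
    fix x assume x: "x \<in> space \<mu>"
    have "\<bar>(s x)\<^sup>2 * f x - (r x)\<^sup>2 * f x\<bar> = \<bar>(s x - r x) * (s x + r x)\<bar> * f x"
    proof -
      have "(s x)\<^sup>2 * f x - (r x)\<^sup>2 * f x = ((s x - r x) * (s x + r x)) * f x"
        by (simp add: power2_eq_square algebra_simps)
      then show ?thesis using f[OF x] by (simp only: abs_mult abs_of_nonneg)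
    qed
    also have "\<dots> \<le> \<bar>s x - r x\<bar> * \<bar>s x + r x\<bar>"
      using f[OF x] by (simp add: abs_mult mult_right_le_one_le)
    also have "\<dots> \<le> (s x - r x)\<^sup>2 * (1 / (2 * a)) + (s x + r x)\<^sup>2 * a / 2"
    proof -
      have "0 \<le> (\<bar>s x - r x\<bar> - a * \<bar>s x + r x\<bar>)\<^sup>2" by simp
      also have "\<dots> = (s x - r x)\<^sup>2 + a\<^sup>2 * (s x + r x)\<^sup>2 - 2 * a * (\<bar>s x - r x\<bar> * \<bar>s x + r x\<bar>)"
        by (simp add: power2_diff power_mult_distrib)
      finally have "2 * a * (\<bar>s x - r x\<bar> * \<bar>s x + r x\<bar>) \<le> (s x - r x)\<^sup>2 + a\<^sup>2 * (s x + r x)\<^sup>2" by simp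
      also have "\<dots> = 2 * a * ((s x - r x)\<^sup>2 * (1 / (2 * a)) + (s x + r x)\<^sup>2 * a / 2)"
        using a by (simp add: field_simps power2_eq_square)
      finally show ?thesis using a by simp
    qed
    also have "\<dots> \<le> (s x - r x)\<^sup>2 * (1 / (2 * a)) + (s x)\<^sup>2 * a + (r x)\<^sup>2 * a"
    proof -
      have "(s x + r x)\<^sup>2 \<le> 2 * (s x)\<^sup>2 + 2 * (r x)\<^sup>2"
        using zero_le_power2[of "s x - r x"] by (simp add: power2_diff power2_sum)
      then have "(s x + r x)\<^sup>2 * a \<le> (2 * (s x)\<^sup>2 + 2 * (r x)\<^sup>2) * a" using a by (intro mult_right_mono) auto
      then show ?thesis by (simp add: algebra_simps)
    qed
    finally show "\<bar>(s x)\<^sup>2 * f x - (r x)\<^sup>2 * f x\<bar> \<le> (s x - r x)\<^sup>2 * (1 / (2 * a)) + (s x)\<^sup>2 * a + (r x)\<^sup>2 * a" .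
  qed (use ifs ifr id iS ir in auto)
  also have "\<dots> = (\<integral>x. (s x - r x)\<^sup>2 \<partial>\<mu>) * (1 / (2 * a)) + a + a"
    using id iS ir by simp
  also have "\<dots> \<le> D * a\<^sup>2 * (1 / (2 * a)) + a + a"
    using a ih by (intro add_mono mult_right_mono) auto
  also have "\<dots> = (D / 2 + 2) * a" using a by (simp add: field_simps power2_eq_square)
  finally show ?thesis .
qed

lemma nn_integral_norm_square_vec:
  fixes v :: "'x \<Rightarrow> real^'d" and r :: "'x \<Rightarrow> real"
  assumes [measurable]: "v \<in> borel_measurable M" "r \<in> borel_measurable M"
    and "\<And>i. (\<integral>\<^sup>+x. ennreal ((v x $ i * r x)\<^sup>2) \<partial>M) < \<infinity>"
  shows "(\<integral>\<^sup>+x. ennreal ((norm (v x) * r x)\<^sup>2) \<partial>M) < \<infinity>"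
proof -
  have "(norm (v x) * r x)\<^sup>2 = (\<Sum>i\<in>UNIV. (v x $ i * r x)\<^sup>2)" for x
    by (simp add: power_mult_distrib norm_vec_def L2_set_def sum_nonneg sum_distrib_right)
  then have "(\<integral>\<^sup>+x. ennreal ((norm (v x) * r x)\<^sup>2) \<partial>M) = (\<integral>\<^sup>+x. (\<Sum>i\<in>UNIV. ennreal ((v x $ i * r x)\<^sup>2)) \<partial>M)"
    by (simp add: sum_ennreal)
  also have "\<dots> = (\<Sum>i\<in>UNIV. \<integral>\<^sup>+x. ennreal ((v x $ i * r x)\<^sup>2) \<partial>M)"
    by (rule nn_integral_sum) (simp add: cart_eq_inner_axis)
  finally show ?thesis using assms(3) by simp
qed

text \<open>Differentiability makes the squared Hellinger distance O(|h|^2) once the score is square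
  integrable under \<open>P \<theta>\<^sub>0\<close>. \<open>dqm_at\<close> does not state this; it
  follows by solving the expansion for the score in each coordinate direction.\<close>

lemma dqm_total_variation:
  fixes P :: "real^'d \<Rightarrow> 'x measure"
  assumes sf: "sigma_finite_measure \<mu>"
    and P: "\<And>\<theta>. \<theta> \<in> \<Theta> \<Longrightarrow> prob_space (P \<theta>)" "\<And>\<theta>. \<theta> \<in> \<Theta> \<Longrightarrow> sets (P \<theta>) = sets \<mu>"
      "\<And>\<theta>. \<theta> \<in> \<Theta> \<Longrightarrow> absolutely_continuous \<mu> (P \<theta>)"
    and int: "\<theta>\<^sub>0 \<in> interior \<Theta>" and dqm: "dqm_at \<mu> P \<theta>\<^sub>0 score"
  shows "\<exists>K\<ge>0. \<exists>r>0. \<forall>\<theta>. norm (\<theta> - \<theta>\<^sub>0) < r \<longrightarrow> \<theta> \<in> \<Theta> \<and>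
    (\<forall>f :: 'x \<Rightarrow> real. f \<in> borel_measurable \<mu> \<longrightarrow> (\<forall>x\<in>space \<mu>. 0 \<le> f x \<and> f x \<le> 1) \<longrightarrow>
      \<bar>(\<integral>x. f x \<partial>P \<theta>) - (\<integral>x. f x \<partial>P \<theta>\<^sub>0)\<bar> \<le> K * norm (\<theta> - \<theta>\<^sub>0))"
proof -
  define s where "s = (\<lambda>\<theta> x. sqrt (enn2real (RN_deriv \<mu> (P \<theta>) x)))"
  define \<Delta> where "\<Delta> = (\<lambda>h x. s (\<theta>\<^sub>0 + h) x - s \<theta>\<^sub>0 x - 1/2 * (h \<bullet> score x) * s \<theta>\<^sub>0 x)"
  have [measurable]: "score \<in> borel_measurable \<mu>" using dqm by (simp add: dqm_at_def)
  have lim: "((\<lambda>h. (\<integral>\<^sup>+x. ennreal ((\<Delta> h x)\<^sup>2) \<partial>\<mu>) / ennreal ((norm h)\<^sup>2)) \<longlongrightarrow> 0) (at 0)"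
    using dqm by (simp add: dqm_at_def s_def \<Delta>_def Let_def)
  \<comment> \<open>Of the little-o only the bound with constant 1 is kept.\<close>
  have "\<forall>\<^sub>F h in at 0. (\<integral>\<^sup>+x. ennreal ((\<Delta> h x)\<^sup>2) \<partial>\<mu>) / ennreal ((norm h)\<^sup>2) < 1"
    using lim by (rule order_tendstoD(2)) simp
  then obtain r1 where r1: "r1 > 0"
    "\<And>h. h \<noteq> 0 \<Longrightarrow> norm h < r1 \<Longrightarrow> (\<integral>\<^sup>+x. ennreal ((\<Delta> h x)\<^sup>2) \<partial>\<mu>) / ennreal ((norm h)\<^sup>2) < 1"
    by (auto simp: eventually_at dist_norm)
  have rem: "(\<integral>\<^sup>+x. ennreal ((\<Delta> h x)\<^sup>2) \<partial>\<mu>) \<le> ennreal ((norm h)\<^sup>2)" if "h \<noteq> 0" "norm h < r1" for h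
  proof -
    have "(\<integral>\<^sup>+x. ennreal ((\<Delta> h x)\<^sup>2) \<partial>\<mu>) =
        (\<integral>\<^sup>+x. ennreal ((\<Delta> h x)\<^sup>2) \<partial>\<mu>) / ennreal ((norm h)\<^sup>2) * ennreal ((norm h)\<^sup>2)"
      using that(1) by (subst mult.commute, subst ennreal_times_divide, subst mult.commute)
        (simp add: mult_divide_eq_ennreal)
    also have "\<dots> \<le> 1 * ennreal ((norm h)\<^sup>2)"
      using r1(2)[OF that] by (intro mult_right_mono) auto
    finally show ?thesis by simp
  qed
  obtain r2 where r2: "r2 > 0" "ball \<theta>\<^sub>0 r2 \<subseteq> \<Theta>"
    using int by (meson mem_interior)
  define r where "r = min r1 r2"
  have r: "r > 0" using r1 r2 by (simp add: r_def)
  have Th: "\<theta>\<^sub>0 + h \<in> \<Theta>" if "norm h < r" for h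
    using r2(2) that by (auto simp: r_def dist_norm subset_iff)
  have th0: "\<theta>\<^sub>0 \<in> \<Theta>" using Th[of 0] r by simp
  note sd = square_density[OF sf P, folded s_def]
  have s_meas [measurable]: "s \<theta> \<in> borel_measurable \<mu>" if "\<theta> \<in> \<Theta>" for \<theta>
    using sd(1)[OF that that that] unfolding s_def by simp
  have s_den: "P \<theta> = density \<mu> (\<lambda>x. ennreal ((s \<theta> x)\<^sup>2))" if "\<theta> \<in> \<Theta>" for \<theta>
    using sd(2)[OF that that that] unfolding s_def by simp
  have s_one: "(\<integral>\<^sup>+x. ennreal ((s \<theta> x)\<^sup>2) \<partial>\<mu>) = 1" if "\<theta> \<in> \<Theta>" for \<theta>
    using sd(3)[OF that that that] unfolding s_def by simp
  note s_meas[OF th0, measurable]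
  have \<Delta>_meas [measurable]: "\<Delta> h \<in> borel_measurable \<mu>" if "norm h < r" for h
    using s_meas[OF Th[OF that]] unfolding \<Delta>_def by measurable
  have fin: "(\<integral>\<^sup>+x. ennreal ((score x $ i * s \<theta>\<^sub>0 x)\<^sup>2) \<partial>\<mu>) < \<infinity>" for i
  proof -
    \<comment> \<open>A step of length r/2 along axis \<open>i\<close> makes the linear term r/4
      times \<open>score x $ i * s \<theta>\<^sub>0 x\<close>, hence the factor 16 / r^2; squaring a
      sum of three terms costs another 3, which gives 48.\<close>
    define h :: "real^'d" where "h = (r / 2) *\<^sub>R axis i 1"
    have h: "norm h < r" "norm h < r1" "h \<noteq> 0" using r by (auto simp: h_def norm_axis_1 r_def)
    note [measurable] = s_meas[OF Th[OF h(1)]] \<Delta>_meas[OF h(1)]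
    have "(score x $ i * s \<theta>\<^sub>0 x)\<^sup>2 \<le> (48 / r\<^sup>2) * ((\<Delta> h x)\<^sup>2 + (s (\<theta>\<^sub>0 + h) x)\<^sup>2 + (s \<theta>\<^sub>0 x)\<^sup>2)" for x
    proof -
      have "score x $ i = (2 / r) * (h \<bullet> score x)" using r by (simp add: h_def inner_axis' inner_real_def)
      then have "score x $ i * s \<theta>\<^sub>0 x = (4 / r) * (s (\<theta>\<^sub>0 + h) x - s \<theta>\<^sub>0 x - \<Delta> h x)"
        using r by (simp add: \<Delta>_def)
      then have "(score x $ i * s \<theta>\<^sub>0 x)\<^sup>2 = (16 / r\<^sup>2) * (s (\<theta>\<^sub>0 + h) x - s \<theta>\<^sub>0 x - \<Delta> h x)\<^sup>2"
        by (simp only: power_mult_distrib power_divide) simp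
      moreover have "(s (\<theta>\<^sub>0 + h) x - s \<theta>\<^sub>0 x - \<Delta> h x)\<^sup>2 \<le> 3 * ((\<Delta> h x)\<^sup>2 + (s (\<theta>\<^sub>0 + h) x)\<^sup>2 + (s \<theta>\<^sub>0 x)\<^sup>2)"
      proof -
        have "3 * (a\<^sup>2 + b\<^sup>2 + c\<^sup>2) - (b - c - a)\<^sup>2 = (a + b)\<^sup>2 + (b + c)\<^sup>2 + (a - c)\<^sup>2" for a b c :: real
          by (simp add: power2_eq_square algebra_simps)
        then have "(b - c - a)\<^sup>2 \<le> 3 * (a\<^sup>2 + b\<^sup>2 + c\<^sup>2)" for a b c :: real
          by (metis add_nonneg_nonneg diff_ge_0_iff_ge zero_le_power2)
        then show ?thesis .
      qed
      then have "(16 / r\<^sup>2) * (s (\<theta>\<^sub>0 + h) x - s \<theta>\<^sub>0 x - \<Delta> h x)\<^sup>2 \<le>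
          (16 / r\<^sup>2) * (3 * ((\<Delta> h x)\<^sup>2 + (s (\<theta>\<^sub>0 + h) x)\<^sup>2 + (s \<theta>\<^sub>0 x)\<^sup>2))"
        by (rule mult_left_mono) simp
      ultimately show ?thesis by simp
    qed
    then have "(\<integral>\<^sup>+x. ennreal ((score x $ i * s \<theta>\<^sub>0 x)\<^sup>2) \<partial>\<mu>) \<le>
        (\<integral>\<^sup>+x. ennreal (48 / r\<^sup>2) * (ennreal ((\<Delta> h x)\<^sup>2) + ennreal ((s (\<theta>\<^sub>0 + h) x)\<^sup>2) + ennreal ((s \<theta>\<^sub>0 x)\<^sup>2)) \<partial>\<mu>)"
      by (intro nn_integral_mono) (auto simp flip: ennreal_plus ennreal_mult' intro!: ennreal_leI)
    also have "\<dots> = ennreal (48 / r\<^sup>2) * ((\<integral>\<^sup>+x. ennreal ((\<Delta> h x)\<^sup>2) \<partial>\<mu>) + 1 + 1)"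
      by (simp add: nn_integral_cmult nn_integral_add s_one[OF Th[OF h(1)]] s_one[OF th0])
    also have "\<dots> < \<infinity>"
      using le_less_trans[OF rem[OF h(3,2)] ennreal_less_top]
      by (auto simp: ennreal_mult_less_top ennreal_add_eq_top)
    finally show ?thesis .
  qed
  define J where "J = enn2real (\<integral>\<^sup>+x. ennreal ((norm (score x) * s \<theta>\<^sub>0 x)\<^sup>2) \<partial>\<mu>)"
  have J: "(\<integral>\<^sup>+x. ennreal ((norm (score x) * s \<theta>\<^sub>0 x)\<^sup>2) \<partial>\<mu>) = ennreal J" "J \<ge> 0"
    unfolding J_def using nn_integral_norm_square_vec[of score \<mu> "s \<theta>\<^sub>0"] fin by auto
  \<comment> \<open>From (x + y)^2 <= 2 x^2 + 2 y^2: the remainder contributes 2, the linear term at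
    most \<open>J\<close> (a factor 1/2 is given away there).\<close>
  define D where "D = 2 + J"
  have D: "D \<ge> 0" using J by (simp add: D_def)
  have hell: "(\<integral>\<^sup>+x. ennreal ((s (\<theta>\<^sub>0 + h) x - s \<theta>\<^sub>0 x)\<^sup>2) \<partial>\<mu>) \<le> ennreal (D * (norm h)\<^sup>2)"
    if h: "h \<noteq> 0" "norm h < r" for h
  proof -
    note [measurable] = s_meas[OF Th[OF h(2)]] \<Delta>_meas[OF h(2)]
    have "(s (\<theta>\<^sub>0 + h) x - s \<theta>\<^sub>0 x)\<^sup>2 \<le> 2 * (\<Delta> h x)\<^sup>2 + (norm h)\<^sup>2 * (norm (score x) * s \<theta>\<^sub>0 x)\<^sup>2" for x
    proof -
      let ?b = "1/2 * (h \<bullet> score x) * s \<theta>\<^sub>0 x"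
      have "s (\<theta>\<^sub>0 + h) x - s \<theta>\<^sub>0 x = \<Delta> h x + ?b" by (simp add: \<Delta>_def)
      moreover have "(\<Delta> h x + ?b)\<^sup>2 \<le> 2 * (\<Delta> h x)\<^sup>2 + 2 * ?b\<^sup>2"
        using zero_le_power2[of "\<Delta> h x - ?b"] by (simp only: power2_diff power2_sum)
      moreover have "?b\<^sup>2 = (1/4) * (h \<bullet> score x)\<^sup>2 * (s \<theta>\<^sub>0 x)\<^sup>2" by (simp add: power_mult_distrib power_divide)
      moreover have "(h \<bullet> score x)\<^sup>2 \<le> (norm h)\<^sup>2 * (norm (score x))\<^sup>2"
        using Cauchy_Schwarz_ineq[of h "score x"] by (simp add: power2_norm_eq_inner)
      then have "(h \<bullet> score x)\<^sup>2 * (s \<theta>\<^sub>0 x)\<^sup>2 \<le> (norm h)\<^sup>2 * (norm (score x))\<^sup>2 * (s \<theta>\<^sub>0 x)\<^sup>2"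
        by (rule mult_right_mono) simp
      moreover have "0 \<le> (h \<bullet> score x)\<^sup>2 * (s \<theta>\<^sub>0 x)\<^sup>2" by simp
      ultimately show ?thesis by (simp only: power_mult_distrib mult.assoc)
    qed
    then have "(\<integral>\<^sup>+x. ennreal ((s (\<theta>\<^sub>0 + h) x - s \<theta>\<^sub>0 x)\<^sup>2) \<partial>\<mu>) \<le>
        (\<integral>\<^sup>+x. 2 * ennreal ((\<Delta> h x)\<^sup>2) + ennreal ((norm h)\<^sup>2) * ennreal ((norm (score x) * s \<theta>\<^sub>0 x)\<^sup>2) \<partial>\<mu>)"
      by (intro nn_integral_mono)
         (auto simp flip: ennreal_plus ennreal_mult' ennreal_numeral intro!: ennreal_leI)
    also have "\<dots> = 2 * (\<integral>\<^sup>+x. ennreal ((\<Delta> h x)\<^sup>2) \<partial>\<mu>) + ennreal ((norm h)\<^sup>2) * ennreal J"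
      by (simp add: nn_integral_cmult nn_integral_add J)
    also have "\<dots> \<le> 2 * ennreal ((norm h)\<^sup>2) + ennreal ((norm h)\<^sup>2) * ennreal J"
      using rem[of h] h by (intro add_mono mult_left_mono) (auto simp: r_def)
    also have "\<dots> = ennreal (D * (norm h)\<^sup>2)"
      using J(2) by (simp add: D_def distrib_right mult.commute flip: ennreal_plus ennreal_mult' ennreal_numeral)
    finally show ?thesis .
  qed
  have "\<theta> \<in> \<Theta> \<and> (\<forall>f :: 'x \<Rightarrow> real. f \<in> borel_measurable \<mu> \<longrightarrow> (\<forall>x\<in>space \<mu>. 0 \<le> f x \<and> f x \<le> 1) \<longrightarrow>
      \<bar>(\<integral>x. f x \<partial>P \<theta>) - (\<integral>x. f x \<partial>P \<theta>\<^sub>0)\<bar> \<le> (D / 2 + 2) * norm (\<theta> - \<theta>\<^sub>0))"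
    if \<theta>: "norm (\<theta> - \<theta>\<^sub>0) < r" for \<theta>
  proof (intro conjI allI impI)
    show T: "\<theta> \<in> \<Theta>" using Th[of "\<theta> - \<theta>\<^sub>0"] \<theta> by simp
    fix f :: "'x \<Rightarrow> real" assume f: "f \<in> borel_measurable \<mu>" "\<forall>x\<in>space \<mu>. 0 \<le> f x \<and> f x \<le> 1"
    show "\<bar>(\<integral>x. f x \<partial>P \<theta>) - (\<integral>x. f x \<partial>P \<theta>\<^sub>0)\<bar> \<le> (D / 2 + 2) * norm (\<theta> - \<theta>\<^sub>0)"
    \<comment> \<open>At \<open>\<theta>\<^sub>0\<close> itself the weight \<open>a\<close> would be
      0; there both sides vanish.\<close>
    proof (cases "\<theta> = \<theta>\<^sub>0")
      case False
      show ?thesis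
        unfolding s_den[OF T] s_den[OF th0]
        using hell[of "\<theta> - \<theta>\<^sub>0"] \<theta> False f D s_one T th0 s_meas
        by (intro total_variation_le_hellinger) auto
    qed simp
  qed
  moreover have "0 \<le> D / 2 + 2" using D by simp
  ultimately show ?thesis using r by blast
qed

section \<open>Posterior consistency\<close>

text \<open>Within this locale \<mu> stands for the sigma-algebra of one observation; domination
  enters through the total variation bounds that the lemmas take as premises.\<close>

locale bayes_model = prior: prob_space prior
  for \<Theta> :: "(real^'d) set" and \<mu> :: "'x measure" and P :: "real^'d \<Rightarrow> 'x measure"
    and prior :: "(real^'d) measure" and post :: "nat \<Rightarrow> (nat \<Rightarrow> 'x) \<Rightarrow> (real^'d) measure" +
  assumes family: "P \<in> restrict_space borel \<Theta> \<rightarrow>\<^sub>M prob_algebra \<mu>"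
    and sets_prior: "sets prior = sets (restrict_space borel \<Theta>)"
    and posterior: "\<And>n. n \<ge> 1 \<Longrightarrow> is_posterior prior P n (post n)"
begin

abbreviation marginal :: "nat \<Rightarrow> (nat \<Rightarrow> 'x) measure" where
  "marginal n \<equiv> marginal_law prior P n"

lemma space_prior: "space prior = \<Theta>"
  using sets_eq_imp_space_eq[OF sets_prior] by (simp add: space_restrict_space)

lemma family_kernel [measurable]: "P \<in> prior \<rightarrow>\<^sub>M prob_algebra \<mu>"
  using family measurable_cong_sets[OF sets_prior refl] by blast

lemma prob_space_P: "\<theta> \<in> \<Theta> \<Longrightarrow> prob_space (P \<theta>)"
  and sets_P: "\<theta> \<in> \<Theta> \<Longrightarrow> sets (P \<theta>) = sets \<mu>"
  using measurable_space[OF family_kernel] by (auto simp: space_prior space_prob_algebra)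

lemma prob_space_sample: "\<theta> \<in> \<Theta> \<Longrightarrow> prob_space (power_measure (P \<theta>) n)"
  by (intro prob_space_power_measure prob_space_P)

lemma sets_sample: "\<theta> \<in> \<Theta> \<Longrightarrow> sets (power_measure (P \<theta>) n) = sets (power_measure \<mu> n)"
  by (intro sets_power_measure_cong sets_P)

lemma space_sample: "\<theta> \<in> \<Theta> \<Longrightarrow> space (power_measure (P \<theta>) n) = space (power_measure \<mu> n)"
  by (intro sets_eq_imp_space_eq sets_sample)

lemma measurable_sample:
  "\<theta> \<in> \<Theta> \<Longrightarrow> f \<in> power_measure (P \<theta>) n \<rightarrow>\<^sub>M N \<longleftrightarrow> f \<in> power_measure \<mu> n \<rightarrow>\<^sub>M N"
  by (simp add: measurable_cong_sets[OF sets_sample refl])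

lemma sample_kernel:
  "(\<lambda>\<theta>. power_measure (P \<theta>) n) \<in> prior \<rightarrow>\<^sub>M subprob_algebra (power_measure \<mu> n)"
  by (intro measurable_prob_algebraD power_measure_kernel family_kernel)

lemma sets_marginal: "sets (marginal n) = sets (power_measure \<mu> n)"
  unfolding marginal_law_def
  by (rule sets_bind_measurable[OF sample_kernel]) (rule prior.not_empty)

lemma measurable_marginal:
  "f \<in> marginal n \<rightarrow>\<^sub>M N \<longleftrightarrow> f \<in> power_measure \<mu> n \<rightarrow>\<^sub>M N"
  by (simp add: measurable_cong_sets[OF sets_marginal refl])

lemma nn_integral_marginal:
  assumes "f \<in> borel_measurable (power_measure \<mu> n)"
  shows "(\<integral>\<^sup>+x. f x \<partial>marginal n) = (\<integral>\<^sup>+\<theta>. \<integral>\<^sup>+x. f x \<partial>power_measure (P \<theta>) n \<partial>prior)"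
  unfolding marginal_law_def by (rule nn_integral_bind[OF assms sample_kernel])

lemma measurable_nn_integral_sample:
  assumes "f \<in> borel_measurable (power_measure \<mu> n)"
  shows "(\<lambda>\<theta>. \<integral>\<^sup>+x. f x \<partial>power_measure (P \<theta>) n) \<in> borel_measurable prior"
  using measurable_compose[OF sample_kernel nn_integral_measurable_subprob_algebra[OF assms]] .

lemma posterior_kernel:
  assumes "n \<ge> 1"
  shows "post n \<in> power_measure \<mu> n \<rightarrow>\<^sub>M prob_algebra prior"
  using posterior[OF assms] unfolding is_posterior_def measurable_marginal by blast

lemma prob_space_post: "n \<ge> 1 \<Longrightarrow> x \<in> space (power_measure \<mu> n) \<Longrightarrow> prob_space (post n x)"
  and sets_post: "n \<ge> 1 \<Longrightarrow> x \<in> space (power_measure \<mu> n) \<Longrightarrow> sets (post n x) = sets prior"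
  using measurable_space[OF posterior_kernel] by (auto simp: space_prob_algebra)

lemma space_post: "n \<ge> 1 \<Longrightarrow> x \<in> space (power_measure \<mu> n) \<Longrightarrow> space (post n x) = \<Theta>"
  using sets_eq_imp_space_eq[OF sets_post] by (simp add: space_prior)

lemma measurable_emeasure_post:
  assumes "n \<ge> 1" "B \<in> sets prior"
  shows "(\<lambda>x. emeasure (post n x) B) \<in> borel_measurable (power_measure \<mu> n)"
  using measurable_prob_algebraD[OF posterior_kernel[OF assms(1)]] assms(2)
  by (rule measurable_emeasure_kernel)

text \<open>For indicators \<open>f\<close> of events this is the defining identity of
  \<open>is_posterior\<close>; linearity and monotone limits extend it to nonnegative statistics, as
  required for the statistic \<open>W\<close> built from the tests.\<close>

lemma nn_integral_posterior:
  assumes n: "n \<ge> 1" and B: "B \<in> sets prior" and f: "f \<in> borel_measurable (power_measure \<mu> n)"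
  shows "(\<integral>\<^sup>+x. f x * emeasure (post n x) B \<partial>marginal n) =
    (\<integral>\<^sup>+\<theta>. (\<integral>\<^sup>+x. f x \<partial>power_measure (P \<theta>) n) * indicator B \<theta> \<partial>prior)"
proof -
  have sm: "(\<lambda>\<theta>. (\<integral>\<^sup>+x. h x \<partial>power_measure (P \<theta>) n) * indicator B \<theta>) \<in> borel_measurable prior"
    if "h \<in> borel_measurable (power_measure \<mu> n)" for h
    using measurable_nn_integral_sample[OF that] B by (intro borel_measurable_times_ennreal borel_measurable_indicator)
  from f show ?thesis
  proof (induction rule: borel_measurable_induct)
    note [measurable] = measurable_emeasure_post[OF n B] B sm
    note [simp] = measurable_marginal
    case (cong f g)
    have "(\<integral>\<^sup>+x. f x * emeasure (post n x) B \<partial>marginal n) = (\<integral>\<^sup>+x. g x * emeasure (post n x) B \<partial>marginal n)"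
      using cong(3) sets_eq_imp_space_eq[OF sets_marginal[of n]] by (intro nn_integral_cong) auto
    moreover have "(\<integral>\<^sup>+\<theta>. (\<integral>\<^sup>+x. f x \<partial>power_measure (P \<theta>) n) * indicator B \<theta> \<partial>prior) =
        (\<integral>\<^sup>+\<theta>. (\<integral>\<^sup>+x. g x \<partial>power_measure (P \<theta>) n) * indicator B \<theta> \<partial>prior)"
      using cong(3) by (intro nn_integral_cong arg_cong2[where f="(*)"] refl) (simp add: space_sample space_prior)
    ultimately show ?case using cong by simp
  next
    case (set A)
    have "(\<integral>\<^sup>+x. indicator A x * emeasure (post n x) B \<partial>marginal n) =
        (\<integral>\<^sup>+x\<in>A. emeasure (post n x) B \<partial>marginal n)"
      by (simp add: mult.commute)
    also have "\<dots> = (\<integral>\<^sup>+\<theta>\<in>B. emeasure (power_measure (P \<theta>) n) A \<partial>prior)"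
      using posterior[OF n] set B sets_marginal unfolding is_posterior_def by blast
    also have "\<dots> = (\<integral>\<^sup>+\<theta>. (\<integral>\<^sup>+x. indicator A x \<partial>power_measure (P \<theta>) n) * indicator B \<theta> \<partial>prior)"
      using set by (intro nn_integral_cong) (simp add: sets_sample space_prior)
    finally show ?case .
  next
    note [measurable] = measurable_emeasure_post[OF n B] B sm
    case (mult u c)
    have [measurable]: "(\<lambda>x. u x * emeasure (post n x) B) \<in> borel_measurable (marginal n)"
      using mult(2) unfolding measurable_marginal by measurable
    have "(\<integral>\<^sup>+x. c * u x * emeasure (post n x) B \<partial>marginal n) =
        c * (\<integral>\<^sup>+x. u x * emeasure (post n x) B \<partial>marginal n)"
      by (simp add: nn_integral_cmult mult.assoc)
    also have "\<dots> = c * (\<integral>\<^sup>+\<theta>. (\<integral>\<^sup>+x. u x \<partial>power_measure (P \<theta>) n) * indicator B \<theta> \<partial>prior)"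
      by (simp add: mult)
    also have "\<dots> = (\<integral>\<^sup>+\<theta>. c * ((\<integral>\<^sup>+x. u x \<partial>power_measure (P \<theta>) n) * indicator B \<theta>) \<partial>prior)"
      using sm[OF mult(2)] by (intro nn_integral_cmult[symmetric])
    also have "\<dots> = (\<integral>\<^sup>+\<theta>. (\<integral>\<^sup>+x. c * u x \<partial>power_measure (P \<theta>) n) * indicator B \<theta> \<partial>prior)"
      using mult(2) by (intro nn_integral_cong)
        (simp add: nn_integral_cmult measurable_sample space_prior mult.assoc)
    finally show ?case .
  next
    note [measurable] = measurable_emeasure_post[OF n B] B sm
    case (add u v)
    have [measurable]: "(\<lambda>x. u x * emeasure (post n x) B) \<in> borel_measurable (marginal n)"
      "(\<lambda>x. v x * emeasure (post n x) B) \<in> borel_measurable (marginal n)"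
      using add(1,3) unfolding measurable_marginal by measurable
    have "(\<integral>\<^sup>+x. (v x + u x) * emeasure (post n x) B \<partial>marginal n) =
        (\<integral>\<^sup>+x. v x * emeasure (post n x) B \<partial>marginal n) + (\<integral>\<^sup>+x. u x * emeasure (post n x) B \<partial>marginal n)"
      by (simp add: nn_integral_add distrib_right)
    also have "\<dots> = (\<integral>\<^sup>+\<theta>. (\<integral>\<^sup>+x. v x \<partial>power_measure (P \<theta>) n) * indicator B \<theta> +
        (\<integral>\<^sup>+x. u x \<partial>power_measure (P \<theta>) n) * indicator B \<theta> \<partial>prior)"
      using sm[OF add(1)] sm[OF add(3)] by (simp add: add.IH nn_integral_add)
    also have "\<dots> = (\<integral>\<^sup>+\<theta>. (\<integral>\<^sup>+x. v x + u x \<partial>power_measure (P \<theta>) n) * indicator B \<theta> \<partial>prior)"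
      using add(1,3) by (intro nn_integral_cong)
        (simp add: nn_integral_add measurable_sample space_prior distrib_right)
    finally show ?case .
  next
    note [measurable] = measurable_emeasure_post[OF n B] B sm
    case (seq U)
    have [measurable]: "(\<lambda>x. U i x * emeasure (post n x) B) \<in> borel_measurable (marginal n)" for i
      using seq(1) unfolding measurable_marginal by measurable
    have "(\<integral>\<^sup>+x. Sup (range U) x * emeasure (post n x) B \<partial>marginal n) =
        (\<integral>\<^sup>+x. (SUP i. U i x * emeasure (post n x) B) \<partial>marginal n)"
      by (simp add: SUP_mult_right_ennreal image_comp)
    also have "\<dots> = (SUP i. \<integral>\<^sup>+x. U i x * emeasure (post n x) B \<partial>marginal n)"
      using seq(3) by (intro nn_integral_monotone_convergence_SUP)
        (auto simp: incseq_def le_fun_def intro!: mult_right_mono)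
    also have "\<dots> = (SUP i. \<integral>\<^sup>+\<theta>. (\<integral>\<^sup>+x. U i x \<partial>power_measure (P \<theta>) n) * indicator B \<theta> \<partial>prior)"
      using seq by simp
    also have "\<dots> = (\<integral>\<^sup>+\<theta>. (SUP i. (\<integral>\<^sup>+x. U i x \<partial>power_measure (P \<theta>) n) * indicator B \<theta>) \<partial>prior)"
      using sm[OF seq(1)] seq(3) by (intro nn_integral_monotone_convergence_SUP[symmetric])
        (auto simp: incseq_def le_fun_def intro!: mult_right_mono nn_integral_mono)
    also have "\<dots> = (\<integral>\<^sup>+\<theta>. (\<integral>\<^sup>+x. Sup (range U) x \<partial>power_measure (P \<theta>) n) * indicator B \<theta> \<partial>prior)"
    proof (intro nn_integral_cong)
      fix \<theta> assume "\<theta> \<in> space prior"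
      then have "(\<integral>\<^sup>+x. (SUP i. U i x) \<partial>power_measure (P \<theta>) n) = (SUP i. \<integral>\<^sup>+x. U i x \<partial>power_measure (P \<theta>) n)"
        using seq(1,3) by (intro nn_integral_monotone_convergence_SUP) (auto simp: measurable_sample space_prior)
      then show "(SUP i. (\<integral>\<^sup>+x. U i x \<partial>power_measure (P \<theta>) n) * indicator B \<theta>) =
          (\<integral>\<^sup>+x. Sup (range U) x \<partial>power_measure (P \<theta>) n) * indicator B \<theta>"
        by (simp add: SUP_mult_right_ennreal image_comp)
    qed
    finally show ?case .
  qed
qed

text \<open>With the constant statistic 1 the disintegration says that the posterior, averaged over
  the marginal law, is the prior.\<close>

lemma nn_integral_posterior_marginal:
  assumes n: "n \<ge> 1" and g: "g \<in> borel_measurable prior"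
  shows "(\<integral>\<^sup>+x. \<integral>\<^sup>+\<theta>. g \<theta> \<partial>post n x \<partial>marginal n) = (\<integral>\<^sup>+\<theta>. g \<theta> \<partial>prior)"
proof -
  have k: "post n \<in> marginal n \<rightarrow>\<^sub>M subprob_algebra prior"
    unfolding measurable_marginal by (intro measurable_prob_algebraD posterior_kernel n)
  have ne: "space (marginal n) \<noteq> {}"
    using sets_eq_imp_space_eq[OF sets_marginal] prior.not_empty space_sample
      prob_space.not_empty[OF prob_space_sample] space_prior by fastforce
  have "marginal n \<bind> post n = prior"
  proof (rule measure_eqI)
    show s: "sets (marginal n \<bind> post n) = sets prior"
      using sets_bind_measurable[OF k ne] .
    fix B assume "B \<in> sets (marginal n \<bind> post n)"
    then have B: "B \<in> sets prior" using s by simp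
    have "emeasure (marginal n \<bind> post n) B = (\<integral>\<^sup>+x. 1 * emeasure (post n x) B \<partial>marginal n)"
      using emeasure_bind[OF ne k B] by simp
    also have "\<dots> = (\<integral>\<^sup>+\<theta>. (\<integral>\<^sup>+x. 1 \<partial>power_measure (P \<theta>) n) * indicator B \<theta> \<partial>prior)"
      using n B by (rule nn_integral_posterior) simp
    also have "\<dots> = (\<integral>\<^sup>+\<theta>. indicator B \<theta> \<partial>prior)"
      by (intro nn_integral_cong)
        (simp add: prob_space.emeasure_space_1[OF prob_space_sample] space_prior)
    finally show "emeasure (marginal n \<bind> post n) B = emeasure prior B" using B by simp
  qed
  then show ?thesis using nn_integral_bind[OF g k] by simp
qed

text \<open>A finite average forces almost every term to be finite. It will be applied to a majorant
  of the loss near \<open>\<theta>\<^sub>0\<close>.\<close>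

lemma AE_posterior_integrable:
  assumes n: "n \<ge> 1" and g: "g \<in> borel_measurable prior" and fin: "(\<integral>\<^sup>+\<theta>. g \<theta> \<partial>prior) < \<infinity>"
  shows "AE x in marginal n. (\<integral>\<^sup>+\<theta>. g \<theta> \<partial>post n x) < \<infinity>"
proof -
  have "(\<lambda>x. \<integral>\<^sup>+\<theta>. g \<theta> \<partial>post n x) \<in> borel_measurable (marginal n)"
    unfolding measurable_marginal
    using measurable_compose[OF measurable_prob_algebraD[OF posterior_kernel[OF n]]
        nn_integral_measurable_subprob_algebra[OF g]] .
  then have "AE x in marginal n. (\<integral>\<^sup>+\<theta>. g \<theta> \<partial>post n x) \<noteq> \<infinity>"
    using fin nn_integral_posterior_marginal[OF n g] by (intro nn_integral_noteq_infinite) auto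
  then show ?thesis by (simp add: less_top)
qed

text \<open>The prior ball \<open>C\<close> replaces contiguity: its sampling laws are close to the one at
  \<open>\<theta>\<^sub>0\<close> in total variation, and integrating the posterior over \<open>C\<close> brings in the marginal law.\<close>

lemma posterior_mass_bound:
  fixes W :: "(nat \<Rightarrow> 'x) \<Rightarrow> ennreal"
  assumes n: "n \<ge> 1" and \<theta>\<^sub>0: "\<theta>\<^sub>0 \<in> \<Theta>" and B: "B \<in> sets prior" and C: "C \<in> sets prior" and c: "c \<ge> 0"
    and tv: "\<And>\<theta> f. \<theta> \<in> C \<Longrightarrow> f \<in> borel_measurable (power_measure \<mu> n) \<Longrightarrow>
      (\<And>x. x \<in> space (power_measure \<mu> n) \<Longrightarrow> 0 \<le> f x \<and> f x \<le> (1::real)) \<Longrightarrow>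
      \<bar>(\<integral>x. f x \<partial>power_measure (P \<theta>) n) - (\<integral>x. f x \<partial>power_measure (P \<theta>\<^sub>0) n)\<bar> \<le> c"
    and W: "W \<in> borel_measurable (power_measure \<mu> n)"
    and far: "\<And>\<theta>. \<theta> \<in> B \<Longrightarrow> (\<integral>\<^sup>+x. W x \<partial>power_measure (P \<theta>) n) \<le> \<rho>"
  shows "emeasure prior C * (\<integral>\<^sup>+x. emeasure (post n x) B * indicator {x. 1 \<le> W x} x \<partial>power_measure (P \<theta>\<^sub>0) n)
    \<le> \<rho> + emeasure prior C * ennreal c"
proof -
  note [measurable] = measurable_emeasure_post[OF n B] W B C
  let ?f = "\<lambda>x. emeasure (post n x) B * indicator {x. 1 \<le> W x} x"
  have f [measurable]: "?f \<in> borel_measurable (power_measure \<mu> n)" by measurable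
  have f1: "?f x \<le> 1" if "x \<in> space (power_measure \<mu> n)" for x
    using prob_space.emeasure_le_1[OF prob_space_post[OF n that]] by (auto simp: indicator_def)
  \<comment> \<open>\<open>tv\<close> speaks of real functions, so the integrand, which is at most
    1, is read as a real one.\<close>
  define g where "g = (\<lambda>x. enn2real (?f x))"
  have [measurable]: "g \<in> borel_measurable (power_measure \<mu> n)" unfolding g_def by measurable
  have fg: "?f x = ennreal (g x)" "0 \<le> g x" "g x \<le> 1" if "x \<in> space (power_measure \<mu> n)" for x
  proof -
    have "?f x \<noteq> top" using f1[OF that] by (auto simp: top_unique)
    then show "?f x = ennreal (g x)" unfolding g_def by (simp add: less_top)
    show "0 \<le> g x" by (simp add: g_def)
    show "g x \<le> 1" using f1[OF that] unfolding g_def by (metis enn2real_leI ennreal_1 zero_le_one)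
  qed
  have int: "(\<integral>\<^sup>+x. ?f x \<partial>power_measure (P \<theta>) n) = ennreal (\<integral>x. g x \<partial>power_measure (P \<theta>) n)"
    if "\<theta> \<in> \<Theta>" for \<theta>
  proof -
    have "(\<integral>\<^sup>+x. ?f x \<partial>power_measure (P \<theta>) n) = (\<integral>\<^sup>+x. ennreal (g x) \<partial>power_measure (P \<theta>) n)"
      using fg that by (intro nn_integral_cong) (simp add: space_sample)
    also have "\<dots> = ennreal (\<integral>x. g x \<partial>power_measure (P \<theta>) n)"
      using fg that by (intro nn_integral_eq_integral integrable_unit_interval prob_space_sample)
        (auto simp: measurable_sample space_sample)
    finally show ?thesis .
  qed
  have CT: "\<theta> \<in> \<Theta>" if "\<theta> \<in> C" for \<theta> using sets.sets_into_space[OF C] that by (auto simp: space_prior)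
  have BT: "\<theta> \<in> \<Theta>" if "\<theta> \<in> B" for \<theta> using sets.sets_into_space[OF B] that by (auto simp: space_prior)
  have close: "(\<integral>\<^sup>+x. ?f x \<partial>power_measure (P \<theta>\<^sub>0) n) \<le> (\<integral>\<^sup>+x. ?f x \<partial>power_measure (P \<theta>) n) + ennreal c"
    if \<theta>: "\<theta> \<in> C" for \<theta>
  proof -
    have "\<bar>(\<integral>x. g x \<partial>power_measure (P \<theta>) n) - (\<integral>x. g x \<partial>power_measure (P \<theta>\<^sub>0) n)\<bar> \<le> c"
      using \<theta> fg by (intro tv) auto
    moreover have "0 \<le> (\<integral>x. g x \<partial>power_measure (P \<theta>) n)"
      using fg CT[OF \<theta>] by (intro Bochner_Integration.integral_nonneg) (simp add: space_sample)
    ultimately show ?thesis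
      unfolding int[OF CT[OF \<theta>]] int[OF \<theta>\<^sub>0] using c by (simp flip: ennreal_plus)
  qed
  have fmeas: "(\<lambda>\<theta>. \<integral>\<^sup>+x. ?f x \<partial>power_measure (P \<theta>) n) \<in> borel_measurable prior"
    using f by (rule measurable_nn_integral_sample)
  have "emeasure prior C * (\<integral>\<^sup>+x. ?f x \<partial>power_measure (P \<theta>\<^sub>0) n) =
      (\<integral>\<^sup>+\<theta>. (\<integral>\<^sup>+x. ?f x \<partial>power_measure (P \<theta>\<^sub>0) n) * indicator C \<theta> \<partial>prior)"
    using C by (subst nn_integral_cmult_indicator) (auto simp: mult.commute)
  \<comment> \<open>On \<open>C\<close> the law at \<open>\<theta>\<^sub>0\<close> is exchanged for
    the one at \<theta> at cost \<open>c\<close>; the restriction to \<open>C\<close> is then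
    dropped from the first term, which thereby becomes an integral under the marginal law.\<close>
  also have "\<dots> \<le> (\<integral>\<^sup>+\<theta>. (\<integral>\<^sup>+x. ?f x \<partial>power_measure (P \<theta>) n) + ennreal c * indicator C \<theta> \<partial>prior)"
    using close by (intro nn_integral_mono) (auto simp: indicator_def)
  also have "\<dots> = (\<integral>\<^sup>+\<theta>. \<integral>\<^sup>+x. ?f x \<partial>power_measure (P \<theta>) n \<partial>prior) + emeasure prior C * ennreal c"
    using fmeas C by (simp add: nn_integral_add nn_integral_cmult_indicator mult.commute)
  also have "(\<integral>\<^sup>+\<theta>. \<integral>\<^sup>+x. ?f x \<partial>power_measure (P \<theta>) n \<partial>prior) = (\<integral>\<^sup>+x. ?f x \<partial>marginal n)"
    using f by (rule nn_integral_marginal[symmetric])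
  \<comment> \<open>Markov's inequality in pointwise form: the indicator of
    \<open>1 \<le> W x\<close> is at most \<open>W x\<close>. The disintegration then moves the
    integral to parameters in \<open>B\<close>, where \<open>W\<close> has small mean.\<close>
  also have "\<dots> \<le> (\<integral>\<^sup>+x. W x * emeasure (post n x) B \<partial>marginal n)"
  proof (intro nn_integral_mono)
    fix x
    show "?f x \<le> W x * emeasure (post n x) B"
      using mult_right_mono[of 1 "W x" "emeasure (post n x) B"] by (auto simp: indicator_def)
  qed
  also have "\<dots> = (\<integral>\<^sup>+\<theta>. (\<integral>\<^sup>+x. W x \<partial>power_measure (P \<theta>) n) * indicator B \<theta> \<partial>prior)"
    using n B W by (rule nn_integral_posterior)
  also have "\<dots> \<le> (\<integral>\<^sup>+\<theta>. \<rho> \<partial>prior)"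
    using far by (intro nn_integral_mono) (auto simp: indicator_def)
  also have "\<dots> = \<rho>" by (simp add: prior.emeasure_space_1)
  finally show ?thesis by (simp add: add_right_mono)
qed

end

text \<open>Since n div k >= n/k - 1, the geometric factor is at most exp(-c n) / q with c = -ln q /
  k; the incomplete last block costs the 1/q.\<close>

lemma power_times_geometric_tendsto_0:
  assumes q: "0 < q" "q < (1::real)" and k: "k > 0"
  shows "(\<lambda>n. real n ^ D * q ^ (n div k)) \<longlonglongrightarrow> 0"
proof (rule Lim_null_comparison)
  define c where "c = - ln q / real k"
  have c: "c > 0" using q k divide_neg_pos[of "ln q" "real k"] by (simp add: c_def)
  have "filterlim (\<lambda>n. c * real n) at_top sequentially"
    using c by (intro filterlim_tendsto_pos_mult_at_top[OF tendsto_const] filterlim_real_sequentially)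
  from filterlim_compose[OF tendsto_power_div_exp_0 this]
  have "(\<lambda>n. (c * real n) ^ D / exp (c * real n)) \<longlonglongrightarrow> 0" .
  then show "(\<lambda>n. 1 / (q * c ^ D) * ((c * real n) ^ D / exp (c * real n))) \<longlonglongrightarrow> 0"
    by (rule tendsto_mult_right_zero)
  show "\<forall>\<^sub>F n in sequentially. norm (real n ^ D * q ^ (n div k)) \<le>
      1 / (q * c ^ D) * ((c * real n) ^ D / exp (c * real n))"
  proof (rule always_eventually, rule allI)
    fix n
    have "real n < real k * (1 + real (n div k))"
      using dividend_less_times_div[OF k, of n] by (metis of_nat_less_iff of_nat_mult of_nat_Suc mult.commute mult_Suc_right add.commute)
    then have "real n / real k - 1 \<le> real (n div k)" using k by (simp add: field_simps)
    then have "real (n div k) * ln q \<le> (real n / real k - 1) * ln q"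
      using q by (intro mult_right_mono_neg) auto
    then have "q ^ (n div k) \<le> exp ((real n / real k - 1) * ln q)"
      using q by (metis exp_le_cancel_iff exp_ln exp_of_nat_mult)
    also have "(real n / real k - 1) * ln q = - (c * real n) - ln q"
      by (simp add: c_def left_diff_distrib)
    also have "exp \<dots> = 1 / (q * exp (c * real n))"
      using q by (simp add: exp_diff exp_minus divide_inverse)
    finally have "real n ^ D * q ^ (n div k) \<le> real n ^ D * (1 / (q * exp (c * real n)))"
      by (intro mult_left_mono) auto
    then show "norm (real n ^ D * q ^ (n div k)) \<le> 1 / (q * c ^ D) * ((c * real n) ^ D / exp (c * real n))"
      using q c by (simp add: power_mult_distrib abs_mult)
  qed
qed

text \<open>By continuity the density is at least half its value at \<open>\<theta>\<^sub>0\<close>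
  on a small ball, and volume scales with the power \<open>DIM('a)\<close> of the radius. So a
  radius polynomial in 1/n leaves a mass no smaller than polynomial.\<close>

lemma density_ball_lower_bound:
  fixes \<pi> :: "'a::euclidean_space \<Rightarrow> real"
  assumes \<pi>: "\<pi> \<in> borel_measurable borel" and U: "open U" "\<theta>\<^sub>0 \<in> U" "continuous_on U \<pi>" "\<pi> \<theta>\<^sub>0 > 0"
  shows "\<exists>c>0. \<exists>r>0. \<forall>s. 0 < s \<longrightarrow> s < r \<longrightarrow>
    ennreal (c * s ^ DIM('a)) \<le> emeasure (density lborel (\<lambda>\<theta>. ennreal (\<pi> \<theta>))) (cball \<theta>\<^sub>0 s)"
proof -
  have "isCont \<pi> \<theta>\<^sub>0" using U by (simp add: continuous_on_eq_continuous_at)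
  then have "\<forall>\<^sub>F \<theta> in at \<theta>\<^sub>0. \<pi> \<theta>\<^sub>0 / 2 < \<pi> \<theta>"
    unfolding isCont_def by (rule order_tendstoD(1)) (use U in simp)
  then obtain r where r: "r > 0" "\<And>\<theta>. \<theta> \<noteq> \<theta>\<^sub>0 \<Longrightarrow> dist \<theta> \<theta>\<^sub>0 < r \<Longrightarrow> \<pi> \<theta>\<^sub>0 / 2 < \<pi> \<theta>"
    by (auto simp: eventually_at)
  then have r2: "\<pi> \<theta>\<^sub>0 / 2 \<le> \<pi> \<theta>" if "dist \<theta> \<theta>\<^sub>0 < r" for \<theta>
    using that U(4) by (cases "\<theta> = \<theta>\<^sub>0") (auto intro: less_imp_le)
  define c where "c = \<pi> \<theta>\<^sub>0 / 2 * unit_ball_vol (real DIM('a))"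
  show ?thesis
  proof (rule exI[of _ c], intro conjI exI[of _ r] allI impI)
    show "c > 0" using U by (simp add: c_def)
    fix s :: real assume s: "0 < s" "s < r"
    have "ennreal (c * s ^ DIM('a)) = ennreal (\<pi> \<theta>\<^sub>0 / 2) * emeasure lborel (cball \<theta>\<^sub>0 s)"
      using s U ennreal_mult'[of "\<pi> \<theta>\<^sub>0 / 2" "unit_ball_vol (real DIM('a)) * s ^ DIM('a)"]
      by (simp only: emeasure_cball less_imp_le c_def mult.assoc)
    also have "\<dots> = (\<integral>\<^sup>+\<theta>. ennreal (\<pi> \<theta>\<^sub>0 / 2) * indicator (cball \<theta>\<^sub>0 s) \<theta> \<partial>lborel)"
      by (simp add: nn_integral_cmult_indicator)
    also have "\<dots> \<le> (\<integral>\<^sup>+\<theta>. ennreal (\<pi> \<theta>) * indicator (cball \<theta>\<^sub>0 s) \<theta> \<partial>lborel)"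
      using r2 s by (intro nn_integral_mono) (auto simp: indicator_def dist_commute intro!: ennreal_leI)
    also have "\<dots> = emeasure (density lborel (\<lambda>\<theta>. ennreal (\<pi> \<theta>))) (cball \<theta>\<^sub>0 s)"
      using \<pi> by (subst emeasure_density) auto
    finally show "ennreal (c * s ^ DIM('a)) \<le> emeasure (density lborel (\<lambda>\<theta>. ennreal (\<pi> \<theta>))) (cball \<theta>\<^sub>0 s)" .
  qed (use r in auto)
qed

context bayes_model
begin

lemma measurable_id_prior: "(\<lambda>\<theta>. \<theta>) \<in> borel_measurable prior"
  using measurable_restrict_space1[OF measurable_ident, of borel \<Theta>] measurable_cong_sets[OF sets_prior refl]
  by (auto simp: id_def)

lemma sets_prior_norm:
  "{\<theta>\<in>\<Theta>. \<epsilon> \<le> norm (\<theta> - \<theta>\<^sub>0)} \<in> sets prior" "{\<theta>\<in>\<Theta>. norm (\<theta> - \<theta>\<^sub>0) \<le> \<epsilon>} \<in> sets prior"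
proof -
  note [measurable] = measurable_id_prior
  have "{\<theta>\<in>space prior. \<epsilon> \<le> norm (\<theta> - \<theta>\<^sub>0)} \<in> sets prior" "{\<theta>\<in>space prior. norm (\<theta> - \<theta>\<^sub>0) \<le> \<epsilon>} \<in> sets prior"
    by measurable
  then show "{\<theta>\<in>\<Theta>. \<epsilon> \<le> norm (\<theta> - \<theta>\<^sub>0)} \<in> sets prior" "{\<theta>\<in>\<Theta>. norm (\<theta> - \<theta>\<^sub>0) \<le> \<epsilon>} \<in> sets prior"
    by (simp_all add: space_prior)
qed

text \<open>A test with error probabilities at most 1/4 on samples of size \<open>k\<close>, applied to disjoint blocks,
  yields a statistic \<open>W\<close> that behaves like a likelihood ratio: it is exponentially small in mean far
  from \<open>\<theta>\<^sub>0\<close>, and it dominates \<open>1 / V\<close> where \<open>V\<close> is exponentially small in mean at \<open>\<theta>\<^sub>0\<close>.\<close>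

lemma block_test:
  fixes \<phi> :: "(nat \<Rightarrow> 'x) \<Rightarrow> real"
  assumes \<theta>\<^sub>0: "\<theta>\<^sub>0 \<in> \<Theta>" and B: "B \<subseteq> \<Theta>" and k: "k > 0"
    and \<phi>: "\<phi> \<in> borel_measurable (power_measure \<mu> k)"
      "\<And>x. x \<in> space (power_measure \<mu> k) \<Longrightarrow> 0 \<le> \<phi> x \<and> \<phi> x \<le> 1"
    and err0: "(\<integral>x. \<phi> x \<partial>power_measure (P \<theta>\<^sub>0) k) \<le> 1/4"
    and err1: "\<And>\<theta>. \<theta> \<in> B \<Longrightarrow> (\<integral>x. 1 - \<phi> x \<partial>power_measure (P \<theta>) k) \<le> 1/4"
  shows "\<exists>W V :: (nat \<Rightarrow> 'x) \<Rightarrow> ennreal.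
    W \<in> borel_measurable (power_measure \<mu> n) \<and> V \<in> borel_measurable (power_measure \<mu> n) \<and>
    (\<forall>x. 1 \<le> W x * V x) \<and>
    (\<integral>\<^sup>+x. V x \<partial>power_measure (P \<theta>\<^sub>0) n) \<le> ennreal ((7/8) ^ (n div k)) \<and>
    (\<forall>\<theta>\<in>B. (\<integral>\<^sup>+x. W x \<partial>power_measure (P \<theta>) n) \<le> ennreal ((7/8) ^ (n div k)))"
proof -
  \<comment> \<open>Tests are bounded on the sample space only; truncation makes
    \<open>1 \<le> W x * V x\<close> valid at every \<open>x\<close>.\<close>
  define \<psi> where "\<psi> = (\<lambda>x. max 0 (min 1 (\<phi> x)))"
  have \<psi>01: "0 \<le> \<psi> x" "\<psi> x \<le> 1" for x by (auto simp: \<psi>_def)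
  have [measurable]: "\<psi> \<in> borel_measurable (power_measure \<mu> k)" using \<phi>(1) unfolding \<psi>_def by measurable
  have \<psi>\<phi>: "\<psi> x = \<phi> x" if "x \<in> space (power_measure \<mu> k)" for x using \<phi>(2)[OF that] by (simp add: \<psi>_def)
  \<comment> \<open>Affine in \<psi>: \<open>?F\<close> falls from 2 at 0 to 1/2 at 1, and
    \<open>?F'\<close> joins the reciprocals. An error of at most 1/4 gives a mean of at most 1/2 +
    3/2 * 1/4 = 7/8, for \<open>?F'\<close> at \<open>\<theta>\<^sub>0\<close> and for
    \<open>?F\<close> on \<open>B\<close>.\<close>
  let ?F = "\<lambda>x. ennreal (2 - 3/2 * \<psi> x)" and ?F' = "\<lambda>x. ennreal (1/2 + 3/2 * \<psi> x)"
  let ?S = "\<lambda>j x. \<lambda>i\<in>{..<k}. x (j * k + i) :: 'x"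
  let ?m = "n div k"
  have mk: "?m * k \<le> n" by simp
  have F: "?F \<in> borel_measurable (power_measure \<mu> k)" "?F' \<in> borel_measurable (power_measure \<mu> k)"
    by measurable
  have int: "integrable (power_measure (P \<theta>) k) \<psi>" if "\<theta> \<in> \<Theta>" for \<theta>
    using \<psi>01 that by (intro integrable_unit_interval prob_space_sample) (auto simp: measurable_sample)
  have e0: "(\<integral>\<^sup>+x. ?F' x \<partial>power_measure (P \<theta>\<^sub>0) k) \<le> ennreal (7/8)"
  proof -
    interpret p: prob_space "power_measure (P \<theta>\<^sub>0) k" using \<theta>\<^sub>0 by (rule prob_space_sample)
    have "(\<integral>x. \<psi> x \<partial>power_measure (P \<theta>\<^sub>0) k) = (\<integral>x. \<phi> x \<partial>power_measure (P \<theta>\<^sub>0) k)"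
      using \<psi>\<phi> \<theta>\<^sub>0 by (intro Bochner_Integration.integral_cong) (auto simp: space_sample)
    moreover have "(\<integral>\<^sup>+x. ?F' x \<partial>power_measure (P \<theta>\<^sub>0) k) = ennreal (\<integral>x. 1/2 + 3/2 * \<psi> x \<partial>power_measure (P \<theta>\<^sub>0) k)"
      using int[OF \<theta>\<^sub>0] \<psi>01 by (intro nn_integral_eq_integral) (auto intro!: add_nonneg_nonneg)
    moreover have "(\<integral>x. 1/2 + 3/2 * \<psi> x \<partial>power_measure (P \<theta>\<^sub>0) k) = 1/2 + 3/2 * (\<integral>x. \<psi> x \<partial>power_measure (P \<theta>\<^sub>0) k)"
      using int[OF \<theta>\<^sub>0] by (simp add: p.prob_space)
    ultimately show ?thesis using err0 by (auto intro!: ennreal_leI)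
  qed
  have e1: "(\<integral>\<^sup>+x. ?F x \<partial>power_measure (P \<theta>) k) \<le> ennreal (7/8)" if "\<theta> \<in> B" for \<theta>
  proof -
    have \<theta>: "\<theta> \<in> \<Theta>" using that B by auto
    interpret p: prob_space "power_measure (P \<theta>) k" using \<theta> by (rule prob_space_sample)
    have "(\<integral>x. 1 - \<psi> x \<partial>power_measure (P \<theta>) k) = (\<integral>x. 1 - \<phi> x \<partial>power_measure (P \<theta>) k)"
      using \<psi>\<phi> \<theta> by (intro Bochner_Integration.integral_cong) (auto simp: space_sample)
    moreover have "(\<integral>\<^sup>+x. ?F x \<partial>power_measure (P \<theta>) k) = ennreal (\<integral>x. 2 - 3/2 * \<psi> x \<partial>power_measure (P \<theta>) k)"
    proof (intro nn_integral_eq_integral)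
      show "AE x in power_measure (P \<theta>) k. 0 \<le> 2 - 3/2 * \<psi> x"
      proof (rule AE_I2)
        fix x show "0 \<le> 2 - 3/2 * \<psi> x" using \<psi>01(2)[of x] by simp
      qed
    qed (use int[OF \<theta>] in auto)
    moreover have "(\<integral>x. 2 - 3/2 * \<psi> x \<partial>power_measure (P \<theta>) k) = 1/2 + 3/2 * (\<integral>x. 1 - \<psi> x \<partial>power_measure (P \<theta>) k)"
      using int[OF \<theta>] by (simp add: p.prob_space field_simps)
    ultimately show ?thesis using err1[OF that] by (auto intro!: ennreal_leI)
  qed
  have blk: "(\<lambda>x. \<Prod>j<?m. f (?S j x)) \<in> borel_measurable (power_measure \<mu> n)"
    if f: "f \<in> borel_measurable (power_measure \<mu> k)" for f :: "_ \<Rightarrow> ennreal"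
  proof (intro borel_measurable_prod_ennreal)
    fix j assume "j \<in> {..<?m}"
    then have "Suc j * k \<le> ?m * k" by (intro mult_le_mono1) auto
    then have j: "j * k + k \<le> n" using mk unfolding mult_Suc by linarith
    have "?S j \<in> power_measure \<mu> n \<rightarrow>\<^sub>M power_measure \<mu> k"
      unfolding power_measure_def
      by (intro measurable_restrict measurable_component_singleton) (use j in auto)
    from measurable_compose[OF this f] show "(\<lambda>x. f (?S j x)) \<in> borel_measurable (power_measure \<mu> n)" .
  qed
  have prod: "(\<integral>\<^sup>+x. (\<Prod>j<?m. f (?S j x)) \<partial>power_measure (P \<theta>) n) \<le> ennreal ((7/8) ^ ?m)"
    if f: "f \<in> borel_measurable (power_measure \<mu> k)" "(\<integral>\<^sup>+x. f x \<partial>power_measure (P \<theta>) k) \<le> ennreal (7/8)"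
      and \<theta>: "\<theta> \<in> \<Theta>" for f \<theta>
  proof -
    have "(\<integral>\<^sup>+x. (\<Prod>j<?m. f (?S j x)) \<partial>power_measure (P \<theta>) n) = (\<integral>\<^sup>+x. f x \<partial>power_measure (P \<theta>) k) ^ ?m"
      using f \<theta> mk by (intro nn_integral_blocks prob_space_P) (auto simp: measurable_sample)
    also have "\<dots> \<le> ennreal (7/8) ^ ?m" using f(2) by (intro power_mono) auto
    also have "\<dots> = ennreal ((7/8) ^ ?m)" by (rule ennreal_power) simp
    finally show ?thesis .
  qed
  have FF: "1 \<le> ?F x * ?F' x" for x
  proof -
    \<comment> \<open>The product is 1 at \<psi> = 0 and \<psi> = 1 and exceeds 1 in between, so
      randomized tests do no harm.\<close>
    have "(2 - 3/2 * \<psi> x) * (1/2 + 3/2 * \<psi> x) = 1 + 9/4 * (\<psi> x * (1 - \<psi> x))" by (simp add: field_simps)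
    also have "\<dots> \<ge> 1" using \<psi>01 by (simp add: mult_nonneg_nonneg)
    finally have "ennreal 1 \<le> ennreal ((2 - 3/2 * \<psi> x) * (1/2 + 3/2 * \<psi> x))" by (rule ennreal_leI)
    then show ?thesis using \<psi>01 by (simp add: ennreal_mult'')
  qed
  have WV: "1 \<le> (\<Prod>j<?m. ?F (?S j x)) * (\<Prod>j<?m. ?F' (?S j x))" for x
  proof -
    have "(\<Prod>j<?m. 1) \<le> (\<Prod>j<?m. ?F (?S j x) * ?F' (?S j x))"
      by (intro prod_mono_ennreal FF)
    then show ?thesis by (simp add: prod.distrib)
  qed
  show ?thesis
    using blk[OF F(1)] blk[OF F(2)] WV prod[OF F(2) e0 \<theta>\<^sub>0] prod[OF F(1) e1] B
    by (intro exI[of _ "\<lambda>x. \<Prod>j<?m. ?F (?S j x)"] exI[of _ "\<lambda>x. \<Prod>j<?m. ?F' (?S j x)"]) auto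
qed

text \<open>Where \<open>1 \<le> W x\<close> the bound by prior mass applies. Elsewhere
  \<open>1 \<le> W x * V x\<close> makes \<open>V x\<close> at least 1, hence at least the posterior
  mass of the far set, and \<open>V\<close> has small mean at
  \<open>\<theta>\<^sub>0\<close>.\<close>

lemma posterior_consistent:
  fixes \<phi> :: "nat \<Rightarrow> (nat \<Rightarrow> 'x) \<Rightarrow> real"
  assumes \<theta>\<^sub>0: "\<theta>\<^sub>0 \<in> \<Theta>" and K: "K \<ge> 0" and r: "r > 0"
    and tv: "\<And>\<theta> f. norm (\<theta> - \<theta>\<^sub>0) < r \<Longrightarrow> f \<in> borel_measurable \<mu> \<Longrightarrow>
      (\<And>x. x \<in> space \<mu> \<Longrightarrow> 0 \<le> f x \<and> f x \<le> (1::real)) \<Longrightarrow>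
      \<bar>(\<integral>x. f x \<partial>P \<theta>) - (\<integral>x. f x \<partial>P \<theta>\<^sub>0)\<bar> \<le> K * norm (\<theta> - \<theta>\<^sub>0)"
    and density: "\<pi> \<in> borel_measurable borel"
      "distr prior borel (\<lambda>\<theta>. \<theta>) = density lborel (\<lambda>\<theta>. ennreal (\<pi> \<theta>))"
      "\<exists>U. open U \<and> \<theta>\<^sub>0 \<in> U \<and> continuous_on U \<pi>" "\<pi> \<theta>\<^sub>0 > 0"
    and \<phi>: "\<And>n. \<phi> n \<in> borel_measurable (power_measure \<mu> n)"
      "\<And>n x. x \<in> space (power_measure \<mu> n) \<Longrightarrow> 0 \<le> \<phi> n x \<and> \<phi> n x \<le> 1"
    and err0: "(\<lambda>n. \<integral>x. \<phi> n x \<partial>power_measure (P \<theta>\<^sub>0) n) \<longlonglongrightarrow> 0"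
    and err1: "(\<lambda>n. SUP \<theta>\<in>{\<theta> \<in> \<Theta>. \<epsilon> \<le> norm (\<theta> - \<theta>\<^sub>0)}.
      ennreal (\<integral>x. 1 - \<phi> n x \<partial>power_measure (P \<theta>) n)) \<longlonglongrightarrow> 0"
  shows "(\<lambda>n. \<integral>\<^sup>+x. emeasure (post n x) {\<theta>\<in>\<Theta>. \<epsilon> \<le> norm (\<theta> - \<theta>\<^sub>0)} \<partial>power_measure (P \<theta>\<^sub>0) n) \<longlonglongrightarrow> 0"
proof -
  define B where "B = {\<theta>\<in>\<Theta>. \<epsilon> \<le> norm (\<theta> - \<theta>\<^sub>0)}"
  have B: "B \<in> sets prior" "B \<subseteq> \<Theta>" unfolding B_def by (auto intro: sets_prior_norm)
  \<comment> \<open>A single sample size \<open>k\<close> with both errors below 1/4 is taken from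
    the tests; the decay comes from repetition.\<close>
  have "\<forall>\<^sub>F n in sequentially. (\<integral>x. \<phi> n x \<partial>power_measure (P \<theta>\<^sub>0) n) < 1/4 \<and>
      (SUP \<theta>\<in>B. ennreal (\<integral>x. 1 - \<phi> n x \<partial>power_measure (P \<theta>) n)) < ennreal (1/4) \<and> n > 0"
    by (intro eventually_conj order_tendstoD(2)[OF err0] order_tendstoD(2)[OF err1[folded B_def]]
        eventually_gt_at_top) auto
  then obtain k where k: "(\<integral>x. \<phi> k x \<partial>power_measure (P \<theta>\<^sub>0) k) < 1/4"
      "(SUP \<theta>\<in>B. ennreal (\<integral>x. 1 - \<phi> k x \<partial>power_measure (P \<theta>) k)) < ennreal (1/4)" "k > 0"
    by (auto simp: eventually_sequentially)
  have k1: "(\<integral>x. 1 - \<phi> k x \<partial>power_measure (P \<theta>) k) \<le> 1/4" if "\<theta> \<in> B" for \<theta>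
  proof -
    have "ennreal (\<integral>x. 1 - \<phi> k x \<partial>power_measure (P \<theta>) k) < ennreal (1/4)"
      using le_less_trans[OF SUP_upper[OF that] k(2)] .
    then show ?thesis by (meson ennreal_leI leD le_cases)
  qed
  obtain U where U: "open U" "\<theta>\<^sub>0 \<in> U" "continuous_on U \<pi>" using density(3) by blast
  obtain c r1 where c: "c > 0" "r1 > 0" "\<And>s. 0 < s \<Longrightarrow> s < r1 \<Longrightarrow>
      ennreal (c * s ^ CARD('d)) \<le> emeasure (density lborel (\<lambda>\<theta>. ennreal (\<pi> \<theta>))) (cball \<theta>\<^sub>0 s)"
    using density_ball_lower_bound[OF density(1) U density(4)] by auto
  define C where "C = (\<lambda>s. {\<theta>\<in>\<Theta>. norm (\<theta> - \<theta>\<^sub>0) \<le> s})"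
  have C: "C s \<in> sets prior" for s unfolding C_def by (rule sets_prior_norm)
  have Cmass: "c * s ^ CARD('d) \<le> measure prior (C s)" if "0 < s" "s < r1" for s
  proof -
    have "emeasure (distr prior borel (\<lambda>\<theta>. \<theta>)) (cball \<theta>\<^sub>0 s) = emeasure prior (C s)"
      using measurable_id_prior
      by (subst emeasure_distr) (auto simp: C_def space_prior dist_norm norm_minus_commute intro!: arg_cong[where f="emeasure prior"])
    then have "ennreal (c * s ^ CARD('d)) \<le> ennreal (measure prior (C s))"
      using c(3)[OF that] by (simp add: density(2) prior.emeasure_eq_measure)
    then show ?thesis using that by (subst (asm) ennreal_le_iff) auto
  qed
  \<comment> \<open>The ball of radius n^(-2) has prior mass at least c * n^(-D).\<close>
  define D where "D = 2 * CARD('d)"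
  let ?X = "\<lambda>n. \<integral>\<^sup>+x. emeasure (post n x) B \<partial>power_measure (P \<theta>\<^sub>0) n"
  \<comment> \<open>In this order: the mean of \<open>V\<close>; the far mean of \<open>W\<close>
    over the prior mass of the ball; the total variation error. The trivial power 0 lets the same
    limit serve twice.\<close>
  define b where "b = (\<lambda>n. real n ^ 0 * (7/8) ^ (n div k) + (1 / c) * (real n ^ D * (7/8) ^ (n div k)) + K * (1 / real n))"
  have "b \<longlonglongrightarrow> 0 + (1 / c) * 0 + K * 0"
    unfolding b_def using k(3) lim_1_over_n
    by (intro tendsto_add tendsto_mult_left power_times_geometric_tendsto_0) auto
  then have b: "(\<lambda>n. ennreal (b n)) \<longlonglongrightarrow> 0" using tendsto_ennrealI by fastforce
  have "(\<lambda>n. 1 / real n) \<longlonglongrightarrow> 0" by (rule lim_1_over_n)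
  then have "\<forall>\<^sub>F n in sequentially. 1 / real n < min r r1"
    by (rule order_tendstoD(2)) (use r c in simp)
  then have "\<forall>\<^sub>F n in sequentially. ?X n \<le> ennreal (b n)"
    using eventually_ge_at_top[of "1::nat"]
  proof eventually_elim
    case (elim n)
    then have n: "n \<ge> 1" by simp
    define s where "s = 1 / (real n)\<^sup>2"
    have s0: "0 < s" using n by (simp add: s_def)
    have "s \<le> 1 / real n" using n by (simp add: s_def field_simps power2_eq_square)
    then have s: "s < r" "s < r1" using elim by auto
    obtain W V :: "(nat \<Rightarrow> 'x) \<Rightarrow> ennreal" where
      W: "W \<in> borel_measurable (power_measure \<mu> n)" and V: "V \<in> borel_measurable (power_measure \<mu> n)"
      and WV: "\<And>x. 1 \<le> W x * V x"
      and V0: "(\<integral>\<^sup>+x. V x \<partial>power_measure (P \<theta>\<^sub>0) n) \<le> ennreal ((7/8) ^ (n div k))"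
      and W1: "\<And>\<theta>. \<theta> \<in> B \<Longrightarrow> (\<integral>\<^sup>+x. W x \<partial>power_measure (P \<theta>) n) \<le> ennreal ((7/8) ^ (n div k))"
      using block_test[OF \<theta>\<^sub>0 B(2) k(3) \<phi>, of n] k(1) k1 by (auto simp: less_imp_le)
    let ?Y = "\<integral>\<^sup>+x. emeasure (post n x) B * indicator {x. 1 \<le> W x} x \<partial>power_measure (P \<theta>\<^sub>0) n"
    have le1: "emeasure (post n x) B \<le> 1" if "x \<in> space (power_measure (P \<theta>\<^sub>0) n)" for x
      using that \<theta>\<^sub>0 by (intro prob_space.emeasure_le_1 prob_space_post n) (simp add: space_sample)
    have "emeasure prior (C s) * ?Y \<le> ennreal ((7/8) ^ (n div k)) + emeasure prior (C s) * ennreal (real n * (K * s))"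
    proof (rule posterior_mass_bound[OF n \<theta>\<^sub>0 B(1) C _ _ W W1])
      show "0 \<le> real n * (K * s)" using K s0 by simp
      fix \<theta> and f :: "(nat \<Rightarrow> 'x) \<Rightarrow> real"
      assume \<theta>: "\<theta> \<in> C s" and f: "f \<in> borel_measurable (power_measure \<mu> n)"
        "\<And>x. x \<in> space (power_measure \<mu> n) \<Longrightarrow> 0 \<le> f x \<and> f x \<le> 1"
      have T: "\<theta> \<in> \<Theta>" "norm (\<theta> - \<theta>\<^sub>0) \<le> s" using \<theta> by (auto simp: C_def)
      show "\<bar>(\<integral>x. f x \<partial>power_measure (P \<theta>) n) - (\<integral>x. f x \<partial>power_measure (P \<theta>\<^sub>0) n)\<bar> \<le> real n * (K * s)"
      proof (rule power_measure_total_variation)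
        fix g :: "'x \<Rightarrow> real" assume g: "g \<in> borel_measurable (P \<theta>)" "\<And>x. x \<in> space (P \<theta>) \<Longrightarrow> 0 \<le> g x \<and> g x \<le> 1"
        have "\<bar>(\<integral>x. g x \<partial>P \<theta>) - (\<integral>x. g x \<partial>P \<theta>\<^sub>0)\<bar> \<le> K * norm (\<theta> - \<theta>\<^sub>0)"
          using g s T sets_eq_imp_space_eq[OF sets_P[OF T(1)]] measurable_cong_sets[OF sets_P[OF T(1)] refl]
          by (intro tv) auto
        also have "\<dots> \<le> K * s" using K T by (intro mult_left_mono) auto
        finally show "\<bar>(\<integral>x. g x \<partial>P \<theta>) - (\<integral>x. g x \<partial>P \<theta>\<^sub>0)\<bar> \<le> K * s" .
      qed (use T \<theta>\<^sub>0 f in \<open>auto simp: prob_space_P sets_P measurable_sample space_sample\<close>)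
    qed
    \<comment> \<open>Finiteness permits the passage to reals, where the inequality can be divided
      by the prior mass of the ball.\<close>
    moreover have "?Y \<le> 1"
    proof -
      interpret p: prob_space "power_measure (P \<theta>\<^sub>0) n" using \<theta>\<^sub>0 by (rule prob_space_sample)
      have "?Y \<le> (\<integral>\<^sup>+x. 1 \<partial>power_measure (P \<theta>\<^sub>0) n)"
        using le1 by (intro nn_integral_mono) (auto simp: indicator_def)
      then show ?thesis by (simp add: p.emeasure_space_1)
    qed
    then obtain y where y: "?Y = ennreal y" "y \<ge> 0"
      by (cases ?Y) (auto simp: top_unique)
    moreover have a: "c * s ^ CARD('d) \<le> measure prior (C s)" "0 < c * s ^ CARD('d)"
      using Cmass[OF s0 s(2)] c(1) s0 by auto
    ultimately have "measure prior (C s) * y \<le> (7/8) ^ (n div k) + measure prior (C s) * (real n * (K * s))"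
      using K s0 by (simp add: prior.emeasure_eq_measure flip: ennreal_mult' ennreal_plus)
    then have "y \<le> (7/8) ^ (n div k) / measure prior (C s) + real n * (K * s)"
      using a by (simp add: field_simps)
    also have "\<dots> \<le> (7/8) ^ (n div k) / (c * s ^ CARD('d)) + real n * (K * s)"
      using a less_le_trans[OF a(2,1)]
      by (intro add_mono divide_left_mono mult_pos_pos[OF _ a(2)]) simp_all
    also have "\<dots> = (1 / c) * (real n ^ D * (7/8) ^ (n div k)) + K * (1 / real n)"
    proof -
      have "s ^ CARD('d) = 1 / real n ^ D" by (simp add: s_def D_def power_mult power_divide)
      moreover have "real n * (K * s) = K * (1 / real n)" using n by (simp add: s_def power2_eq_square)
      ultimately show ?thesis by simp
    qed
    finally have y2: "?Y \<le> ennreal ((1 / c) * (real n ^ D * (7/8) ^ (n div k)) + K * (1 / real n))"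
      unfolding y(1) by (rule ennreal_leI)
    have "?X n \<le> (\<integral>\<^sup>+x. V x + emeasure (post n x) B * indicator {x. 1 \<le> W x} x \<partial>power_measure (P \<theta>\<^sub>0) n)"
    proof (intro nn_integral_mono)
      fix x assume x: "x \<in> space (power_measure (P \<theta>\<^sub>0) n)"
      show "emeasure (post n x) B \<le> V x + emeasure (post n x) B * indicator {x. 1 \<le> W x} x"
      proof (cases "1 \<le> W x")
        case False
        then have "W x * V x \<le> 1 * V x" by (intro mult_right_mono) auto
        then have "1 \<le> V x" using WV[of x] by simp
        then show ?thesis using le1[OF x] False by (auto intro: order_trans)
      qed simp
    qed
    also have "\<dots> = (\<integral>\<^sup>+x. V x \<partial>power_measure (P \<theta>\<^sub>0) n) + ?Y"
      using V W measurable_emeasure_post[OF n B(1)] \<theta>\<^sub>0 by (intro nn_integral_add) (auto simp: measurable_sample)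
    also have "\<dots> \<le> ennreal ((7/8) ^ (n div k)) + ennreal ((1 / c) * (real n ^ D * (7/8) ^ (n div k)) + K * (1 / real n))"
      using V0 y2 by (rule add_mono)
    also have "\<dots> = ennreal (b n)"
      using c K by (simp add: b_def add.assoc flip: ennreal_plus)
    finally show ?case .
  qed
  from tendsto_sandwich[OF _ this tendsto_const b] show ?thesis
    unfolding B_def by simp
qed

end

section \<open>Bayes estimators\<close>

lemma loss_function_measurable:
  assumes "loss_function_on A l" "t \<in> A"
  shows "l t \<in> borel_measurable (restrict_space borel A)"
proof -
  have "(\<lambda>\<theta>. case (t, \<theta>) of (t, \<theta>) \<Rightarrow> l t \<theta>) \<in> borel_measurable (restrict_space borel A)"
    using assms by (intro measurable_Pair2[where x=t]) (auto simp: loss_function_on_def space_restrict_space)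
  then show ?thesis by simp
qed

text \<open>For \<theta> in \<open>N\<close>, |a - b| is at most twice the larger of |a - \<theta>|
  and |b - \<theta>|, so |a - b|^p <= 2^p (|a - \<theta>|^p + |b - \<theta>|^p) for every p > 0,
  including p < 1. Integration over \<open>N\<close> keeps at least half of the left side, and the
  two risks add up to at most twice the risk at \<open>b\<close>; together this is the factor 4 *
  2^p.\<close>

lemma risk_lower_bound:
  fixes l :: "'a::real_normed_vector \<Rightarrow> 'a \<Rightarrow> real"
  assumes \<nu>: "prob_space \<nu>" and N: "N \<in> sets \<nu>" "measure \<nu> N \<ge> 1/2"
    and meas: "l a \<in> borel_measurable \<nu>" "l b \<in> borel_measurable \<nu>"
    and c: "c > 0" and p: "p > 0"
    and lower: "\<And>\<theta>. \<theta> \<in> N \<Longrightarrow> c * norm (a - \<theta>) powr p \<le> l a \<theta>" "\<And>\<theta>. \<theta> \<in> N \<Longrightarrow> c * norm (b - \<theta>) powr p \<le> l b \<theta>"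
    and le: "(\<integral>\<^sup>+\<theta>. ennreal (l a \<theta>) \<partial>\<nu>) \<le> (\<integral>\<^sup>+\<theta>. ennreal (l b \<theta>) \<partial>\<nu>)"
  shows "ennreal (c * norm (a - b) powr p) \<le> ennreal (4 * 2 powr p) * (\<integral>\<^sup>+\<theta>. ennreal (l b \<theta>) \<partial>\<nu>)"
proof -
  interpret prob_space \<nu> by fact
  let ?R = "\<integral>\<^sup>+\<theta>. ennreal (l b \<theta>) \<partial>\<nu>"
  note [measurable] = meas N(1)
  have "ennreal (c * norm (a - b) powr p) * indicator N \<theta> \<le> ennreal (2 powr p) * (ennreal (l a \<theta>) + ennreal (l b \<theta>))" for \<theta>
  proof (cases "\<theta> \<in> N")
    case True
    let ?m = "max (norm (a - \<theta>)) (norm (b - \<theta>))"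
    have nn: "0 \<le> l a \<theta>" "0 \<le> l b \<theta>"
      using lower[OF True] c by (meson mult_nonneg_nonneg less_imp_le powr_ge_zero order_trans)+
    have "norm (a - b) \<le> norm (a - \<theta>) + norm (b - \<theta>)"
      using norm_triangle_ineq4[of "a - \<theta>" "b - \<theta>"] by simp
    then have "norm (a - b) powr p \<le> (2 * ?m) powr p"
      using p by (intro powr_mono2) auto
    also have "\<dots> = 2 powr p * ?m powr p" by (rule powr_mult)
    also have "\<dots> \<le> 2 powr p * (norm (a - \<theta>) powr p + norm (b - \<theta>) powr p)"
      by (intro mult_left_mono) (auto simp: max_def)
    finally have "c * norm (a - b) powr p \<le> c * (2 powr p * (norm (a - \<theta>) powr p + norm (b - \<theta>) powr p))"
      using c by (intro mult_left_mono) auto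
    also have "\<dots> = 2 powr p * (c * norm (a - \<theta>) powr p + c * norm (b - \<theta>) powr p)" by (simp add: algebra_simps)
    also have "\<dots> \<le> 2 powr p * (l a \<theta> + l b \<theta>)"
      using lower[OF True] by (intro mult_left_mono add_mono) auto
    finally have "ennreal (c * norm (a - b) powr p) \<le> ennreal (2 powr p * (l a \<theta> + l b \<theta>))" by (rule ennreal_leI)
    then show ?thesis using True nn by (simp add: ennreal_mult')
  qed simp
  then have "(\<integral>\<^sup>+\<theta>. ennreal (c * norm (a - b) powr p) * indicator N \<theta> \<partial>\<nu>) \<le>
      (\<integral>\<^sup>+\<theta>. ennreal (2 powr p) * (ennreal (l a \<theta>) + ennreal (l b \<theta>)) \<partial>\<nu>)"
    by (intro nn_integral_mono)
  also have "\<dots> = ennreal (2 powr p) * ((\<integral>\<^sup>+\<theta>. ennreal (l a \<theta>) \<partial>\<nu>) + ?R)"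
    by (simp add: nn_integral_cmult nn_integral_add)
  also have "\<dots> \<le> ennreal (2 powr p) * (?R + ?R)"
    using le by (intro mult_left_mono add_mono) auto
  finally have *: "ennreal (c * norm (a - b) powr p) * emeasure \<nu> N \<le> ennreal (2 powr p) * (?R + ?R)"
    by (simp add: nn_integral_cmult_indicator)
  have "ennreal (2 * (1/2)) = ennreal 2 * ennreal (1/2)" by (rule ennreal_mult') simp
  then have "2 * ennreal (1/2) = 1" by simp
  then have "ennreal (c * norm (a - b) powr p) = ennreal (c * norm (a - b) powr p) * (2 * ennreal (1/2))"
    by (simp only: mult_1_right)
  also have "\<dots> \<le> ennreal (c * norm (a - b) powr p) * (2 * emeasure \<nu> N)"
    unfolding emeasure_eq_measure by (intro mult_left_mono ennreal_leI N(2)) auto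
  also have "\<dots> = 2 * (ennreal (c * norm (a - b) powr p) * emeasure \<nu> N)" by (simp add: ac_simps)
  also have "\<dots> \<le> 2 * (ennreal (2 powr p) * (?R + ?R))" using * by (intro mult_left_mono) auto
  also have "\<dots> = ennreal (4 * 2 powr p) * ?R"
  proof -
    have "2 * (ennreal (2 powr p) * (?R + ?R)) = (2 * 2) * ennreal (2 powr p) * ?R"
      unfolding mult_2[of ?R, symmetric] by (simp only: ac_simps)
    also have "(2 * 2) * ennreal (2 powr p) = ennreal (4 * 2 powr p)"
      using ennreal_mult'[of 4 "2 powr p"] by simp
    finally show ?thesis .
  qed
  finally show ?thesis .
qed

text \<open>\<open>?s\<close> inverts the rescaling on the image of \<Theta>, so a change of
  variables returns to the measure on \<Theta> itself. The restricted spaces appear because the loss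
  is measurable on \<Theta> only.\<close>

lemma local_risk_eq:
  assumes sets: "sets \<nu> = sets (restrict_space borel \<Theta>)" and n: "n \<ge> 1"
    and l: "loss_function_on \<Theta> l" and t: "\<theta>\<^sub>0 + t /\<^sub>R sqrt (real n) \<in> \<Theta>"
  shows "local_risk \<Theta> \<theta>\<^sub>0 p l n \<nu> t = real n powr (p/2) * (\<integral>\<theta>. l (\<theta>\<^sub>0 + t /\<^sub>R sqrt (real n)) \<theta> \<partial>\<nu>)"
proof -
  define r where "r = (\<lambda>\<theta>. sqrt (real n) *\<^sub>R (\<theta> - \<theta>\<^sub>0))"
  let ?s = "\<lambda>h. \<theta>\<^sub>0 + h /\<^sub>R sqrt (real n)"
  have sr: "?s (r \<theta>) = \<theta>" for \<theta> using n by (simp add: r_def)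
  have sp: "space \<nu> = \<Theta>" using sets_eq_imp_space_eq[OF sets] by (simp add: space_restrict_space)
  have "r \<in> restrict_space borel \<Theta> \<rightarrow>\<^sub>M restrict_space borel (r ` \<Theta>)"
    unfolding r_def by (intro measurable_restrict_space2 measurable_restrict_space1) (auto simp: space_restrict_space)
  then have r: "r \<in> \<nu> \<rightarrow>\<^sub>M restrict_space borel (r ` \<Theta>)"
    using measurable_cong_sets[OF sets refl] by blast
  have s: "?s \<in> restrict_space borel (r ` \<Theta>) \<rightarrow>\<^sub>M restrict_space borel \<Theta>"
  proof (intro measurable_restrict_space2)
    show "?s \<in> space (restrict_space borel (r ` \<Theta>)) \<rightarrow> \<Theta>" using sr by (auto simp: space_restrict_space)
    show "?s \<in> borel_measurable (restrict_space borel (r ` \<Theta>))" by (intro measurable_restrict_space1) measurable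
  qed
  have "(\<lambda>h. l (?s t) (?s h)) \<in> borel_measurable (restrict_space borel (r ` \<Theta>))"
    using measurable_compose[OF s loss_function_measurable[OF l t]] .
  then have "(\<lambda>h. real n powr (p/2) * l (?s t) (?s h)) \<in> borel_measurable (restrict_space borel (r ` \<Theta>))"
    by measurable
  from integral_distr[OF r this] show ?thesis
    unfolding local_risk_def local_law_def Let_def r_def[symmetric] by (simp add: sr)
qed

text \<open>A Bochner integral that does not exist is 0 and could pose as a minimum of the limit
  risk; hence integrability of \<open>l\<^sub>0 t\<close> is demanded for every \<open>t\<close>
  along with continuity. The supremum over alternatives is an \<open>ennreal\<close>, so that it is
  0 if there are none. \<open>G\<close> lives on the space of \<open>Y\<close>, being the minimizer
  of a path that depends on \<open>Y\<close>.\<close>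

theorem theorem2:
  fixes \<Theta> :: "(real^'d) set"
    and \<mu> :: "'x measure"
    and P :: "real^'d \<Rightarrow> 'x measure"
    and prior :: "(real^'d) measure"
    and \<theta>\<^sub>0 :: "real^'d"
    and score :: "'x \<Rightarrow> real^'d"
    and \<pi> :: "real^'d \<Rightarrow> real"
    and post :: "nat \<Rightarrow> (nat \<Rightarrow> 'x) \<Rightarrow> (real^'d) measure"
    and l l\<^sub>0 :: "real^'d \<Rightarrow> real^'d \<Rightarrow> real"
    and p :: real
    and est :: "nat \<Rightarrow> (nat \<Rightarrow> 'x) \<Rightarrow> real^'d"
    and Q :: "'w measure"
    and Y G :: "'w \<Rightarrow> real^'d"
  assumes sigma_finite: "sigma_finite_measure \<mu>"
    and family: "P \<in> measurable (restrict_space borel \<Theta>) (prob_algebra \<mu>)"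
    and dominated: "\<And>\<theta>. \<theta> \<in> \<Theta> \<Longrightarrow> absolutely_continuous \<mu> (P \<theta>)"
    and prior_law: "prob_space prior" "sets prior = sets (restrict_space borel \<Theta>)"
    and interior: "\<theta>\<^sub>0 \<in> interior \<Theta>"
    and posterior: "\<And>n. n \<ge> 1 \<Longrightarrow> is_posterior prior P n (post n)"
    and marginal: "\<And>n. n \<ge> 1 \<Longrightarrow>
      absolutely_continuous (marginal_law prior P n) (power_measure (P \<theta>\<^sub>0) n)"
    and dqm: "dqm_at \<mu> P \<theta>\<^sub>0 score" "invertible (fisher_info (P \<theta>\<^sub>0) score)"
    and tests: "\<And>\<epsilon>. \<epsilon> > 0 \<Longrightarrow> \<exists>\<phi> :: nat \<Rightarrow> (nat \<Rightarrow> 'x) \<Rightarrow> real.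
      (\<forall>n. \<phi> n \<in> borel_measurable (power_measure \<mu> n) \<and>
           (\<forall>x\<in>space (power_measure \<mu> n). 0 \<le> \<phi> n x \<and> \<phi> n x \<le> 1)) \<and>
      (\<lambda>n. \<integral>x. \<phi> n x \<partial>power_measure (P \<theta>\<^sub>0) n) \<longlonglongrightarrow> 0 \<and>
      (\<lambda>n. SUP \<theta>\<in>{\<theta> \<in> \<Theta>. \<epsilon> \<le> norm (\<theta> - \<theta>\<^sub>0)}.
             ennreal (\<integral>x. 1 - \<phi> n x \<partial>power_measure (P \<theta>) n)) \<longlonglongrightarrow> 0"
    and density: "\<pi> \<in> borel_measurable borel" "\<And>\<theta>. 0 \<le> \<pi> \<theta>"
      "distr prior borel (\<lambda>\<theta>. \<theta>) = density lborel (\<lambda>\<theta>. ennreal (\<pi> \<theta>))"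
      "\<exists>U. open U \<and> \<theta>\<^sub>0 \<in> U \<and> continuous_on U \<pi>" "\<pi> \<theta>\<^sub>0 > 0"
    and loss: "loss_function_on \<Theta> l"
      "\<And>t. t \<in> \<Theta> \<Longrightarrow> (\<integral>\<^sup>+\<theta>. ennreal (l t \<theta>) \<partial>prior) < \<infinity>"
      "\<exists>\<delta>>0. outer_nn_integral prior (\<lambda>\<theta>. SUP t\<in>nbhd \<Theta> \<theta>\<^sub>0 \<delta>. ennreal (l t \<theta>)) < \<infinity>"
    and p: "p > 0"
    and i: "\<exists>\<epsilon>>0. \<exists>c\<^sub>1>0. \<exists>c\<^sub>2>0. \<forall>t\<in>nbhd \<Theta> \<theta>\<^sub>0 \<epsilon>. \<forall>\<theta>\<in>nbhd \<Theta> \<theta>\<^sub>0 \<epsilon>.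
        c\<^sub>1 * norm (t - \<theta>) powr p \<le> l t \<theta> \<and> l t \<theta> \<le> c\<^sub>2 * norm (t - \<theta>) powr p"
      "(\<integral>\<^sup>+\<theta>. ennreal (norm \<theta> powr p) \<partial>prior) < \<infinity>"
    and ii: "\<exists>\<delta>>0. \<exists>c\<^sub>3>0. \<exists>c\<^sub>4>0. \<exists>c\<^sub>5. 0 < c\<^sub>5 \<and> c\<^sub>5 < 2 \<and>
      (\<forall>t\<in>nbhd \<Theta> \<theta>\<^sub>0 \<delta>. \<forall>\<theta>\<in>\<Theta>.
        l t \<theta> \<le> c\<^sub>3 * exp (c\<^sub>4 * norm t powr c\<^sub>5 + c\<^sub>4 * norm \<theta> powr c\<^sub>5))"
    and Y: "prob_space Q" "Y \<in> borel_measurable Q"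
      "distr Q borel Y = gaussian 0 (matrix_inv (fisher_info (P \<theta>\<^sub>0) score))"
    and limit_loss: "loss_function_on UNIV l\<^sub>0"
      "AE w in Q. (\<forall>t. integrable (gaussian (Y w) (matrix_inv (fisher_info (P \<theta>\<^sub>0) score))) (l\<^sub>0 t)) \<and>
                  continuous_on UNIV (limit_risk l\<^sub>0 (matrix_inv (fisher_info (P \<theta>\<^sub>0) score)) (Y w))"
    and minimizer: "G \<in> borel_measurable Q"
      "AE w in Q. is_arg_min (limit_risk l\<^sub>0 (matrix_inv (fisher_info (P \<theta>\<^sub>0) score)) (Y w)) (\<lambda>_. True) (G w) \<and>
                  (\<forall>t. is_arg_min (limit_risk l\<^sub>0 (matrix_inv (fisher_info (P \<theta>\<^sub>0) score)) (Y w)) (\<lambda>_. True) t \<longrightarrow> t = G w)"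
    and iii: "\<And>K. compact K \<Longrightarrow>
      converges_in_distribution_linf K
        (\<lambda>n. power_measure (P \<theta>\<^sub>0) n) (\<lambda>n x. local_risk \<Theta> \<theta>\<^sub>0 p l n (post n x))
        Q (\<lambda>w. limit_risk l\<^sub>0 (matrix_inv (fisher_info (P \<theta>\<^sub>0) score)) (Y w))"
    and bayes: "\<And>n. n \<ge> 1 \<Longrightarrow> is_bayes_estimator \<Theta> \<mu> prior P l n (post n) (est n)"
    and consistent: "\<And>\<epsilon>. \<epsilon> > 0 \<Longrightarrow>
      (\<lambda>n. measure (power_measure (P \<theta>\<^sub>0) n)
             {x \<in> space (power_measure (P \<theta>\<^sub>0) n). norm (est n x - \<theta>\<^sub>0) > \<epsilon>}) \<longlonglongrightarrow> 0"
  shows "converges_in_distribution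
           (\<lambda>n. power_measure (P \<theta>\<^sub>0) n) (\<lambda>n x. sqrt (real n) *\<^sub>R (est n x - \<theta>\<^sub>0)) Q G"
proof -
  interpret bayes_model \<Theta> \<mu> P prior post
    using prior_law family posterior by (intro bayes_model.intro bayes_model_axioms.intro)
  let ?M = "\<lambda>n. power_measure (P \<theta>\<^sub>0) n"
  let ?\<Sigma> = "matrix_inv (fisher_info (P \<theta>\<^sub>0) score)"
  let ?H = "\<lambda>n x. sqrt (real n) *\<^sub>R (est n x - \<theta>\<^sub>0)"
  let ?Z = "\<lambda>n x. local_risk \<Theta> \<theta>\<^sub>0 p l n (post n x)"
  have \<theta>\<^sub>0: "\<theta>\<^sub>0 \<in> \<Theta>" using interior interior_subset by blast
  have M: "prob_space (?M n)" for n using \<theta>\<^sub>0 by (rule prob_space_sample)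
  have est_meas: "est n \<in> borel_measurable (?M n)" if "n \<ge> 1" for n
    using bayes[OF that] unfolding is_bayes_estimator_def measurable_restrict_space2_iff measurable_sample[OF \<theta>\<^sub>0]
    by blast
  \<comment> \<open>Posterior and Bayes estimator are determined only up to null sets of the
    marginal law; absolute continuity carries their properties over to the law at
    \<open>\<theta>\<^sub>0\<close>.\<close>
  have AE_M: "AE x in ?M n. R x" if "n \<ge> 1" "AE x in marginal n. R x" for n R
    using absolutely_continuous_AE[OF _ marginal[OF that(1)] that(2)] \<theta>\<^sub>0
    by (simp add: sets_marginal sets_sample)
  have l_meas: "l t \<in> borel_measurable (post n x)"
    if "t \<in> \<Theta>" "n \<ge> 1" "x \<in> space (power_measure \<mu> n)" for t n x
    using loss_function_measurable[OF loss(1) that(1)]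
      measurable_cong_sets[OF sets_post[OF that(2,3)] refl] measurable_cong_sets[OF sets_prior refl] by blast
  have l_nonneg: "0 \<le> l t \<theta>" if "t \<in> \<Theta>" "\<theta> \<in> \<Theta>" for t \<theta>
    using loss(1) that by (auto simp: loss_function_on_def)

  \<comment> \<open>Integrability of the loss under the posterior\<close>
  obtain \<delta> where \<delta>: "\<delta> > 0" "outer_nn_integral prior (\<lambda>\<theta>. SUP t\<in>nbhd \<Theta> \<theta>\<^sub>0 \<delta>. ennreal (l t \<theta>)) < \<infinity>"
    using loss(3) by blast
  \<comment> \<open>A measurable majorant of the supremum over \<open>t\<close>, which need not be
    measurable itself. One null set, on which \<open>g\<close> has infinite posterior integral, then
    serves all \<open>t\<close> near \<open>\<theta>\<^sub>0\<close> at once.\<close>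
  then obtain g where g: "g \<in> borel_measurable prior" "(\<integral>\<^sup>+\<theta>. g \<theta> \<partial>prior) < \<infinity>"
      "\<And>\<theta>. \<theta> \<in> space prior \<Longrightarrow> (SUP t\<in>nbhd \<Theta> \<theta>\<^sub>0 \<delta>. ennreal (l t \<theta>)) \<le> g \<theta>"
    unfolding outer_nn_integral_def INF_less_iff by blast
  have g_upper: "ennreal (l t \<theta>) \<le> g \<theta>" if "t \<in> nbhd \<Theta> \<theta>\<^sub>0 \<delta>" "\<theta> \<in> \<Theta>" for t \<theta>
    using SUP_upper[OF that(1), of "\<lambda>t. ennreal (l t \<theta>)"] g(3)[of \<theta>] that(2)
    by (auto simp: space_prior intro: order_trans)
  have nn_int: "(\<integral>\<^sup>+\<theta>. ennreal (l t \<theta>) \<partial>post n x) = ennreal (\<integral>\<theta>. l t \<theta> \<partial>post n x)"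
    if "t \<in> nbhd \<Theta> \<theta>\<^sub>0 \<delta>" "n \<ge> 1" "x \<in> space (power_measure \<mu> n)" "(\<integral>\<^sup>+\<theta>. g \<theta> \<partial>post n x) < \<infinity>" for t n x
  proof -
    have t: "t \<in> \<Theta>" using that(1) by (simp add: nbhd_def)
    have "(\<integral>\<^sup>+\<theta>. ennreal (l t \<theta>) \<partial>post n x) \<le> (\<integral>\<^sup>+\<theta>. g \<theta> \<partial>post n x)"
      using g_upper[OF that(1)] space_post[OF that(2,3)] by (intro nn_integral_mono) auto
    then have "integrable (post n x) (l t)"
      using that(4) l_nonneg[OF t] space_post[OF that(2,3)]
      by (intro integrableI_nonneg l_meas[OF t that(2,3)]) (auto intro!: AE_I2)
    then show ?thesis
      using l_nonneg[OF t] space_post[OF that(2,3)] by (intro nn_integral_eq_integral) (auto intro!: AE_I2)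
  qed
  have good: "AE x in ?M n. x \<in> space (power_measure \<mu> n) \<and> est n x \<in> \<Theta> \<and> (\<integral>\<^sup>+\<theta>. g \<theta> \<partial>post n x) < \<infinity> \<and>
      (\<forall>t\<in>\<Theta>. (\<integral>\<^sup>+\<theta>. ennreal (l (est n x) \<theta>) \<partial>post n x) \<le> (\<integral>\<^sup>+\<theta>. ennreal (l t \<theta>) \<partial>post n x))"
    if n: "n \<ge> 1" for n
  proof -
    have "AE x in marginal n. is_arg_min (\<lambda>t. \<integral>\<^sup>+\<theta>. ennreal (l t \<theta>) \<partial>post n x) (\<lambda>t. t \<in> \<Theta>) (est n x)"
      using bayes[OF n] by (simp add: is_bayes_estimator_def)
    from AE_M[OF n this] AE_M[OF n AE_posterior_integrable[OF n g(1,2)]] AE_space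
    show ?thesis
      by eventually_elim (use \<theta>\<^sub>0 in \<open>auto simp: is_arg_min_linorder space_sample\<close>)
  qed
  have est_H: "\<theta>\<^sub>0 + ?H n x /\<^sub>R sqrt (real n) = est n x" if "n \<ge> 1" for n x
    using that by simp
  \<comment> \<open>Bayes estimators minimize an \<open>ennreal\<close> risk, while
    \<open>local_risk\<close> is a Bochner integral; under \<open>fin\<close> the two agree, up to
    the scaling, at points within \<delta> of \<open>\<theta>\<^sub>0\<close>.\<close>
  have Z_eq: "ennreal (?Z n x t) =
      ennreal (real n powr (p/2)) * (\<integral>\<^sup>+\<theta>. ennreal (l (\<theta>\<^sub>0 + t /\<^sub>R sqrt (real n)) \<theta>) \<partial>post n x)"
    and Z_nonneg: "0 \<le> ?Z n x t"
    if t: "\<theta>\<^sub>0 + t /\<^sub>R sqrt (real n) \<in> nbhd \<Theta> \<theta>\<^sub>0 \<delta>" and n: "n \<ge> 1" and x: "x \<in> space (power_measure \<mu> n)"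
      and fin: "(\<integral>\<^sup>+\<theta>. g \<theta> \<partial>post n x) < \<infinity>" for n x t
  proof -
    have T: "\<theta>\<^sub>0 + t /\<^sub>R sqrt (real n) \<in> \<Theta>" using t by (simp add: nbhd_def)
    have e: "?Z n x t = real n powr (p/2) * (\<integral>\<theta>. l (\<theta>\<^sub>0 + t /\<^sub>R sqrt (real n)) \<theta> \<partial>post n x)"
      using sets_post[OF n x] sets_prior by (intro local_risk_eq n loss(1) T) simp
    have nn: "0 \<le> (\<integral>\<theta>. l (\<theta>\<^sub>0 + t /\<^sub>R sqrt (real n)) \<theta> \<partial>post n x)"
      using l_nonneg[OF T] space_post[OF n x] by (intro Bochner_Integration.integral_nonneg) auto
    show "ennreal (?Z n x t) =
        ennreal (real n powr (p/2)) * (\<integral>\<^sup>+\<theta>. ennreal (l (\<theta>\<^sub>0 + t /\<^sub>R sqrt (real n)) \<theta>) \<partial>post n x)"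
      unfolding nn_int[OF t n x fin] e by (simp add: ennreal_mult')
    show "0 \<le> ?Z n x t" unfolding e using nn by simp
  qed

  \<comment> \<open>The rescaled estimator minimizes the local risk\<close>
  obtain r0 where r0: "r0 > 0" "ball \<theta>\<^sub>0 r0 \<subseteq> \<Theta>" using interior by (meson mem_interior)
  have argmin: "\<forall>\<^sub>F n in sequentially. AE x in ?M n. ?H n x \<in> K \<longrightarrow> (\<forall>t\<in>K. ?Z n x (?H n x) \<le> ?Z n x t)"
    if K: "compact K" for K
  proof -
    obtain b where b: "b > 0" "\<And>t. t \<in> K \<Longrightarrow> norm t \<le> b"
      using compact_imp_bounded[OF K] by (auto simp: bounded_pos)
    \<comment> \<open>Uniformly over the bounded set \<open>K\<close>, the points
      \<open>\<theta>\<^sub>0 + t /\<^sub>R sqrt (real n)\<close> eventually lie in \<Theta> and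
      within \<delta> of \<open>\<theta>\<^sub>0\<close>.\<close>
    have "(\<lambda>n. b * (1 / sqrt (real n))) \<longlonglongrightarrow> b * 0"
      using tendsto_real_sqrt[OF lim_1_over_n] by (intro tendsto_mult_left) (simp add: real_sqrt_divide)
    then have "\<forall>\<^sub>F n in sequentially. b * (1 / sqrt (real n)) < min r0 \<delta>"
      by (rule order_tendstoD(2)) (use r0 \<delta> in simp)
    then show ?thesis
      using eventually_ge_at_top[of "1::nat"]
    proof eventually_elim
      case (elim n)
      then have n: "n \<ge> 1" by simp
      have KN: "\<theta>\<^sub>0 + t /\<^sub>R sqrt (real n) \<in> nbhd \<Theta> \<theta>\<^sub>0 \<delta>" if "t \<in> K" for t
      proof -
        have "norm (t /\<^sub>R sqrt (real n)) \<le> b * (1 / sqrt (real n))"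
          using b(2)[OF that] by (simp add: divide_inverse mult.commute mult_right_mono)
        then have "norm (t /\<^sub>R sqrt (real n)) < r0" "norm (t /\<^sub>R sqrt (real n)) \<le> \<delta>" using elim by auto
        then show ?thesis using r0(2) by (auto simp: nbhd_def dist_norm subset_iff)
      qed
      show ?case
        using good[OF n]
      proof eventually_elim
        case (elim x)
        show ?case
        proof (intro impI ballI)
          fix t assume HK: "?H n x \<in> K" and t: "t \<in> K"
          have "\<theta>\<^sub>0 + t /\<^sub>R sqrt (real n) \<in> \<Theta>" using KN[OF t] by (simp add: nbhd_def)
          then have "ennreal (?Z n x (?H n x)) \<le> ennreal (?Z n x t)"
            using elim KN[OF t] KN[OF HK] n unfolding est_H[OF n]
            by (subst (1 2) Z_eq) (auto simp: est_H[OF n] intro!: mult_left_mono)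
          then show "?Z n x (?H n x) \<le> ?Z n x t"
            using Z_nonneg[OF KN[OF t] n] elim by (simp add: ennreal_le_iff)
        qed
      qed
    qed
  qed

  \<comment> \<open>Posterior concentration near the true parameter\<close>
  obtain \<epsilon> c\<^sub>1 where \<epsilon>: "\<epsilon> > 0" and c: "c\<^sub>1 > 0"
    and lower: "\<And>t \<theta>. t \<in> nbhd \<Theta> \<theta>\<^sub>0 \<epsilon> \<Longrightarrow> \<theta> \<in> nbhd \<Theta> \<theta>\<^sub>0 \<epsilon> \<Longrightarrow> c\<^sub>1 * norm (t - \<theta>) powr p \<le> l t \<theta>"
    using i(1) by blast
  \<comment> \<open>\<open>B\<close> and \<open>N\<close> overlap in a sphere; what matters is that
    they cover \<Theta>.\<close>
  define B where "B = {\<theta>\<in>\<Theta>. \<epsilon> \<le> norm (\<theta> - \<theta>\<^sub>0)}"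
  define N where "N = nbhd \<Theta> \<theta>\<^sub>0 \<epsilon>"
  have BN: "B \<in> sets prior" "N \<in> sets prior"
    unfolding B_def N_def nbhd_def by (rule sets_prior_norm)+
  have consist: "(\<lambda>n. \<integral>\<^sup>+x. emeasure (post n x) B \<partial>?M n) \<longlonglongrightarrow> 0"
  proof -
    obtain K r where "K \<ge> 0" "r > 0" and tv: "\<And>\<theta> f. norm (\<theta> - \<theta>\<^sub>0) < r \<Longrightarrow> f \<in> borel_measurable \<mu> \<Longrightarrow>
      (\<And>x. x \<in> space \<mu> \<Longrightarrow> 0 \<le> f x \<and> f x \<le> (1::real)) \<Longrightarrow>
      \<bar>(\<integral>x. f x \<partial>P \<theta>) - (\<integral>x. f x \<partial>P \<theta>\<^sub>0)\<bar> \<le> K * norm (\<theta> - \<theta>\<^sub>0)"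
      using dqm_total_variation[OF sigma_finite prob_space_P sets_P dominated interior dqm(1)] by metis
    obtain \<phi> :: "nat \<Rightarrow> (nat \<Rightarrow> 'x) \<Rightarrow> real" where
      "\<And>n. \<phi> n \<in> borel_measurable (power_measure \<mu> n)"
      "\<And>n x. x \<in> space (power_measure \<mu> n) \<Longrightarrow> 0 \<le> \<phi> n x \<and> \<phi> n x \<le> 1"
      "(\<lambda>n. \<integral>x. \<phi> n x \<partial>?M n) \<longlonglongrightarrow> 0"
      "(\<lambda>n. SUP \<theta>\<in>{\<theta> \<in> \<Theta>. \<epsilon> \<le> norm (\<theta> - \<theta>\<^sub>0)}. ennreal (\<integral>x. 1 - \<phi> n x \<partial>power_measure (P \<theta>) n)) \<longlonglongrightarrow> 0"
      using tests[OF \<epsilon>] by blast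
    show ?thesis
      unfolding B_def by (rule posterior_consistent[where K = K and r = r and \<pi> = \<pi> and \<phi> = \<phi>]) fact+
  qed

  \<comment> \<open>Tightness of the rescaled estimator\<close>
  have tight: "\<exists>b. \<forall>\<^sub>F n in sequentially. measure (?M n) {x \<in> space (?M n). norm (?H n x) > b} \<le> e"
    if e: "e > 0" for e :: real
  proof -
    \<comment> \<open>The weak convergence is applied on the one-point compact set {0}:
      \<open>?Z n x 0\<close> is the rescaled posterior risk at
      \<open>\<theta>\<^sub>0\<close>.\<close>
    obtain z where z: "\<forall>\<^sub>F n in sequentially. \<forall>E\<in>sets (?M n).
        (AE x in ?M n. x \<in> E \<longrightarrow> z \<le> ?Z n x 0) \<longrightarrow> measure (?M n) E \<le> e / 3"
      using converges_in_distribution_linf_tight[OF _ Y(1) iii[of "{0}"], of 0 "e / 3"] M e by auto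
    \<comment> \<open>Solves c1 * b^p = 4 * 2^p * |z|, so that a longer \<open>h\<close> forces the
      risk up to level \<open>z\<close>.\<close>
    define b where "b = (\<bar>z\<bar> * (4 * 2 powr p) / c\<^sub>1) powr (1 / p)"
    have bz: "z \<le> v" if "norm h > b" "c\<^sub>1 * norm h powr p \<le> 4 * 2 powr p * v" for h :: "real^'d" and v
    proof -
      have "\<bar>z\<bar> * (4 * 2 powr p) / c\<^sub>1 = b powr p" using p c by (simp add: b_def powr_powr)
      also have "\<dots> \<le> norm h powr p" using p that by (intro powr_mono2) (auto simp: b_def)
      finally have "\<bar>z\<bar> * (4 * 2 powr p) \<le> c\<^sub>1 * norm h powr p" using c by (simp add: field_simps)
      then have "(4 * 2 powr p) * \<bar>z\<bar> \<le> (4 * 2 powr p) * v" using that(2) by (metis order_trans mult.commute)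
      then have "\<bar>z\<bar> \<le> v" by (rule mult_left_le_imp_le) simp
      then show ?thesis by simp
    qed
    \<comment> \<open>Markov's inequality at level 1/2 will double this to
      \<open>e / 3\<close>.\<close>
    have "\<forall>\<^sub>F n in sequentially. (\<integral>\<^sup>+x. emeasure (post n x) B \<partial>?M n) < ennreal (e / 6)"
      using consist by (rule order_tendstoD(2)) (use e in simp)
    moreover have "\<forall>\<^sub>F n in sequentially. measure (?M n) {x \<in> space (?M n). norm (est n x - \<theta>\<^sub>0) > \<epsilon>} < e / 3"
      using consistent[OF \<epsilon>] by (rule order_tendstoD(2)) (use e in simp)
    ultimately have "\<forall>\<^sub>F n in sequentially. measure (?M n) {x \<in> space (?M n). norm (?H n x) > b} \<le> e"
      using z eventually_ge_at_top[of "1::nat"]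
    proof eventually_elim
      case (elim n)
      note n = elim(4)
      interpret Mn: prob_space "?M n" by (rule M)
      note [measurable] = est_meas[OF n]
      have [measurable]: "(\<lambda>x. emeasure (post n x) B) \<in> borel_measurable (?M n)"
        using measurable_emeasure_post[OF n BN(1)] \<theta>\<^sub>0 by (simp add: measurable_sample)
      \<comment> \<open>Three cases at \<open>e / 3\<close> each: the estimator is farther than
        \<epsilon> from \<open>\<theta>\<^sub>0\<close>, or \<open>B\<close> has posterior mass at
        least 1/2, or neither. Only in the last do the estimator and \<open>\<theta>\<^sub>0\<close>
        both lie in \<open>N\<close>, where the lower bound on the loss holds, with \<open>N\<close>
        carrying half the mass.\<close>
      let ?E = "{x \<in> space (?M n). norm (?H n x) > b \<and> norm (est n x - \<theta>\<^sub>0) \<le> \<epsilon> \<and> emeasure (post n x) B < ennreal (1/2)}"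
      let ?E1 = "{x \<in> space (?M n). norm (est n x - \<theta>\<^sub>0) > \<epsilon>}"
      let ?E2 = "{x \<in> space (?M n). ennreal (1/2) \<le> emeasure (post n x) B}"
      have E [measurable]: "?E \<in> sets (?M n)" "?E1 \<in> sets (?M n)" "?E2 \<in> sets (?M n)" by measurable
      have "AE x in ?M n. x \<in> ?E \<longrightarrow> z \<le> ?Z n x 0"
        using good[OF n]
      proof eventually_elim
        case (elim x)
        then have x: "x \<in> space (power_measure \<mu> n)" by simp
        show ?case
        proof
          assume xE: "x \<in> ?E"
          interpret px: prob_space "post n x" by (rule prob_space_post[OF n x])
          have inN: "est n x \<in> N" "\<theta>\<^sub>0 \<in> N" using xE elim \<theta>\<^sub>0 \<epsilon> by (auto simp: N_def nbhd_def)
          have "1 = measure (post n x) \<Theta>" using px.prob_space space_post[OF n x] by simp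
          also have "\<dots> \<le> measure (post n x) (B \<union> N)"
            using BN sets_post[OF n x] by (intro px.finite_measure_mono) (auto simp: B_def N_def nbhd_def)
          also have "\<dots> \<le> measure (post n x) B + measure (post n x) N"
            using BN sets_post[OF n x] by (intro measure_Un_le) auto
          also have "measure (post n x) B < 1/2"
          proof -
            have "emeasure (post n x) B < ennreal (1/2)" using xE by blast
            then show ?thesis unfolding px.emeasure_eq_measure by (meson ennreal_leI leD leI)
          qed
          finally have half: "1/2 \<le> measure (post n x) N" by simp
          have N0: "\<theta>\<^sub>0 + 0 /\<^sub>R sqrt (real n) \<in> nbhd \<Theta> \<theta>\<^sub>0 \<delta>" using \<theta>\<^sub>0 \<delta>(1) by (simp add: nbhd_def)
          let ?R = "\<integral>\<^sup>+\<theta>. ennreal (l \<theta>\<^sub>0 \<theta>) \<partial>post n x"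
          have "ennreal (c\<^sub>1 * norm (est n x - \<theta>\<^sub>0) powr p) \<le> ennreal (4 * 2 powr p) * ?R"
            using inN BN(2) half c p elim \<theta>\<^sub>0 sets_post[OF n x] n x
            by (intro risk_lower_bound[where N=N] lower prob_space_post l_meas) (auto simp: N_def)
          then have "ennreal (real n powr (p/2)) * ennreal (c\<^sub>1 * norm (est n x - \<theta>\<^sub>0) powr p) \<le>
              ennreal (real n powr (p/2)) * (ennreal (4 * 2 powr p) * ?R)"
            by (rule mult_left_mono) simp
          also have "ennreal (real n powr (p/2)) * ennreal (c\<^sub>1 * norm (est n x - \<theta>\<^sub>0) powr p) =
              ennreal (c\<^sub>1 * norm (?H n x) powr p)"
          proof -
            \<comment> \<open>The factor n^(p/2) in the local risk is the p-th power of the scaling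
              sqrt n.\<close>
            have "norm (?H n x) powr p = real n powr (p/2) * norm (est n x - \<theta>\<^sub>0) powr p"
              using n by (simp add: powr_mult powr_half_sqrt[symmetric] powr_powr)
            then show ?thesis by (simp add: ennreal_mult'[symmetric] ac_simps)
          qed
          also have "ennreal (real n powr (p/2)) * (ennreal (4 * 2 powr p) * ?R) = ennreal (4 * 2 powr p) * ennreal (?Z n x 0)"
            using Z_eq[OF N0 n x] elim by (simp add: ac_simps)
          also have "\<dots> = ennreal (4 * 2 powr p * ?Z n x 0)" by (rule ennreal_mult'[symmetric]) simp
          finally have "c\<^sub>1 * norm (?H n x) powr p \<le> 4 * 2 powr p * ?Z n x 0"
            using Z_nonneg[OF N0 n x] elim by (subst (asm) ennreal_le_iff) auto
          moreover have "norm (?H n x) > b" using xE by blast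
          ultimately show "z \<le> ?Z n x 0" by (intro bz)
        qed
      qed
      then have 1: "measure (?M n) ?E \<le> e / 3" using elim(3) E(1) by blast
      \<comment> \<open>Restated in the product form in which Markov's inequality is
        applied.\<close>
      have "emeasure (?M n) ?E2 = emeasure (?M n) {x \<in> space (?M n). 1 \<le> 2 * emeasure (post n x) B}"
      proof (intro arg_cong[where f="emeasure (?M n)"] Collect_cong conj_cong refl)
        fix x assume "x \<in> space (?M n)"
        then interpret px: prob_space "post n x" using \<theta>\<^sub>0 by (intro prob_space_post n) (simp add: space_sample)
        show "(ennreal (1/2) \<le> emeasure (post n x) B) = (1 \<le> 2 * emeasure (post n x) B)"
        proof -
          let ?m = "measure (post n x) B"
          have "(ennreal (1/2) \<le> ennreal ?m) = (1/2 \<le> ?m)" "(ennreal 1 \<le> ennreal (2 * ?m)) = (1 \<le> 2 * ?m)"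
            by (rule ennreal_le_iff, simp)+
          moreover have "ennreal (2 * ?m) = 2 * ennreal ?m" using ennreal_mult'[of 2 ?m] by simp
          moreover have "(1 \<le> 2 * ?m) = (1/2 \<le> ?m)" by auto
          ultimately show ?thesis unfolding px.emeasure_eq_measure by (metis ennreal_1)
        qed
      qed
      also have "\<dots> \<le> 2 * (\<integral>\<^sup>+x. emeasure (post n x) B \<partial>?M n)"
        using nn_integral_Markov_inequality[of "\<lambda>x. emeasure (post n x) B" "space (?M n)" "?M n" 2]
        by (simp cong: nn_integral_cong)
      also have "\<dots> \<le> 2 * ennreal (e / 6)" using elim(1) by (intro mult_left_mono) auto
      also have "\<dots> = ennreal (e / 3)" using ennreal_mult'[of 2 "e / 6"] by simp
      finally have 2: "measure (?M n) ?E2 \<le> e / 3"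
        using e by (simp add: Mn.emeasure_eq_measure)
      have "measure (?M n) {x \<in> space (?M n). norm (?H n x) > b} \<le> measure (?M n) (?E \<union> (?E1 \<union> ?E2))"
        using E by (intro Mn.finite_measure_mono) auto
      also have "\<dots> \<le> measure (?M n) ?E + measure (?M n) (?E1 \<union> ?E2)"
        using E by (intro measure_Un_le) auto
      also have "measure (?M n) (?E1 \<union> ?E2) \<le> measure (?M n) ?E1 + measure (?M n) ?E2"
        using E by (intro measure_Un_le) auto
      finally show ?case using 1 2 elim(2) by linarith
    qed
    then show ?thesis by blast
  qed

  \<comment> \<open>Conclusion by the argmin theorem\<close>
  show ?thesis
  proof (rule argmin_converges_in_distribution[OF _ Y(1) minimizer(1) iii argmin tight])
    show "\<forall>\<^sub>F n in sequentially. prob_space (?M n) \<and> ?H n \<in> borel_measurable (?M n)"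
    proof (rule eventually_sequentiallyI[of 1])
      fix n :: nat assume "1 \<le> n"
      note [measurable] = est_meas[OF this]
      show "prob_space (?M n) \<and> ?H n \<in> borel_measurable (?M n)" using M by simp
    qed
    show "AE w in Q. continuous_on UNIV (limit_risk l\<^sub>0 ?\<Sigma> (Y w)) \<and>
        is_arg_min (limit_risk l\<^sub>0 ?\<Sigma> (Y w)) (\<lambda>_. True) (G w) \<and>
        (\<forall>t. is_arg_min (limit_risk l\<^sub>0 ?\<Sigma> (Y w)) (\<lambda>_. True) t \<longrightarrow> t = G w)"
      using limit_loss(2) minimizer(2) by eventually_elim auto
  qed
qed

end
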